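(* Let $\beta\in\ell^1(\mathbb Z)$ be a positive c-self-controlled sequence and $C>0$. There exists $T^*>0$, depending only on $C$ and $\beta$, such that the following holds whenever $0<T\le T^*$. Let $(f^i)_{i\in\mathbb Z}$ and $(g^i)_{i\in\mathbb Z}$ be shift-invariant families of symmetric infinite matrices (indexed by $\mathbb Z^2$), with $g^i$ constant and $f^i$ having entries in $C^0([0,T])$, such that $|f^0_{hk}(t)|\le C\beta_h\beta_k$ and $|g^0_{hk}|\le C\beta_h\beta_k$ for all $h,k\in\mathbb Z$, $t\in[0,T]$. Then there exists a smooth classical solution $(u^i)_{i\in\mathbb Z}$ on $[0,T]\times\mathcal X$ to the infinite-dimensional Nash system $$-\partial_t u^i-\Delta u^i+\tfrac12|D_iu^i|^2+\sum_{j\ne i}D_ju^j\cdot D_ju^i=\bar F^i,\qquad u^i(T,\cdot)=\bar G^i,\qquad i\in\mathbb Z .$$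
   Context: A nonnegative sequence $\beta\in\ell^2(\mathbb Z)$ is c-self-controlled if there is a constant $C'>0$ with $\sum_{j\in\mathbb Z}\beta_j\beta_{i-j}\le C'\beta_i$ for all $i\in\mathbb Z$. Fix $d\ge1$; $\mathcal X=\ell^\infty(\mathbb Z;\mathbb R^d)$, with elements $x=(x^j)_{j\in\mathbb Z}$. $D_j$ and $\Delta_j$ are the gradient and Laplacian with respect to $x^j\in\mathbb R^d$, and $\Delta=\sum_j\Delta_j$. A family $(M^i)_{i\in\mathbb Z}$ of symmetric matrices indexed by $\mathbb Z^2$ is shift-invariant if $M^{i+1}_{hk}=M^i_{h-1,k-1}$ for all $i,h,k$, i.e. $M^i_{hk}=M^0_{h-i,k-i}$. The costs are $$\bar F^i(t,x)=\tfrac12\sum_{h,k\in\mathbb Z}f^i_{hk}(t)\,\langle x^h,x^k\rangle_{\mathbb R^d},\qquad \bar G^i(x)=\tfrac12\sum_{h,k\in\mathbb Z}g^i_{hk}\,\langle x^h,x^k\rangle_{\mathbb R^d}.$$ A sequence $(u^i)_{i\in\mathbb Z}$ of real functions on $[0,T]\times\mathcal X$ is a classical solution if: (S1) each $u^i$ is $C^1$ in $t\in(0,T)$ and $C^2$ in $x\in\mathcal X$ in the Fréchet sense; (S2) for each $i$ the series $\Delta u^i=\sum_j\Delta_ju^i$ and $\sum_{j\ne i}D_ju^j\cdot D_ju^i$ converge uniformly on bounded subsets of $[0,T]\times\mathcal X$; (S3) the system holds pointwise on $(0,T)\times\mathcal X$; (S4) $u^i(T,\cdot)=\bar G^i$ for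 all $i$. "Smooth" means infinitely differentiable in $t$ and infinitely Fréchet differentiable in $x$. *)

theory Defs
  imports "HOL-Analysis.Analysis"
begin

definition c_self_controlled :: "(int \<Rightarrow> real) \<Rightarrow> bool" where
  "c_self_controlled \<beta> \<longleftrightarrow>
     (\<forall>i. 0 \<le> \<beta> i) \<and> (\<lambda>i. (\<beta> i)\<^sup>2) summable_on UNIV \<and>
     (\<exists>C'>0. \<forall>i. (\<Sum>\<^sub>\<infinity>j. \<beta> j * \<beta> (i - j)) \<le> C' * \<beta> i)"

text \<open>
  The dimension \<open>d\<close> is a term, not a type, so that a time horizon can be chosen before it.
  A point \<open>x\<close> of \<open>linf d\<close>, the space of bounded sequences of vectors of length \<open>d\<close>, has
  the number \<open>x (j, a)\<close> as the \<open>a\<close>-th component (\<open>a < d\<close>) of its \<open>j\<close>-th entry; the components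
  with \<open>a \<ge> d\<close> are zero. \<open>linf d\<close> is a closed subspace of the Banach space
  \<open>(int \<times> nat) \<Rightarrow>\<^sub>C real\<close> (all functions on the discrete space \<open>int \<times> nat\<close> are continuous).
  Its norm, the supremum of \<open>\<bar>x (j, a)\<bar>\<close>, lies within a factor \<open>sqrt d\<close> of the supremum of the
  Euclidean norms of the entries, so that bounded sets, Frechet derivatives and their continuity
  are the same for both norms.
\<close>

type_synonym seqs = "(int \<times> nat) \<Rightarrow>\<^sub>C real"

definition linf :: "nat \<Rightarrow> seqs set" where
  "linf d = {x. \<forall>j a. d \<le> a \<longrightarrow> apply_bcontfun x (j, a) = 0}"

definition entry_inner :: "nat \<Rightarrow> seqs \<Rightarrow> int \<Rightarrow> int \<Rightarrow> real" where
  "entry_inner d x h k = (\<Sum>a<d. apply_bcontfun x (h, a) * apply_bcontfun x (k, a))"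

definition unit_seq :: "int \<Rightarrow> nat \<Rightarrow> seqs" where
  "unit_seq j a = Bcontfun (\<lambda>p. if p = (j, a) then 1 else 0)"

lemma apply_unit_seq: "apply_bcontfun (unit_seq j a) p = (if p = (j, a) then 1 else 0)"
proof -
  have "open {q :: int \<times> nat}" for q
    using open_Times[OF open_discrete[of "{fst q}"] open_discrete[of "{snd q}"]] by simp
  then have "open S" for S :: "(int \<times> nat) set"
    using open_UN[of S "\<lambda>q. {q}"] by simp
  then have "continuous_on UNIV (\<lambda>p. if p = (j, a) then 1 else 0 :: real)"
    by (simp add: continuous_on_open_vimage)
  moreover have "bounded (range (\<lambda>p. if p = (j, a) then 1 else 0 :: real))"
    by (rule boundedI[of _ 1]) auto
  ultimately have "(\<lambda>p. if p = (j, a) then 1 else 0 :: real) \<in> bcontfun"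
    by (simp add: bcontfun_def)
  then show ?thesis
    by (simp add: unit_seq_def Bcontfun_inverse)
qed

definition pderiv_seq :: "int \<Rightarrow> nat \<Rightarrow> (seqs \<Rightarrow> real) \<Rightarrow> seqs \<Rightarrow> real" where
  "pderiv_seq j a \<phi> x = deriv (\<lambda>s. \<phi> (x + s *\<^sub>R unit_seq j a)) 0"

definition grad_inner :: "nat \<Rightarrow> int \<Rightarrow> (seqs \<Rightarrow> real) \<Rightarrow> (seqs \<Rightarrow> real) \<Rightarrow> seqs \<Rightarrow> real" where
  "grad_inner d j \<phi> \<psi> x = (\<Sum>a<d. pderiv_seq j a \<phi> x * pderiv_seq j a \<psi> x)"

definition entry_laplacian :: "nat \<Rightarrow> int \<Rightarrow> (seqs \<Rightarrow> real) \<Rightarrow> seqs \<Rightarrow> real" where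
  "entry_laplacian d j \<phi> x = (\<Sum>a<d. pderiv_seq j a (pderiv_seq j a \<phi>) x)"

definition quad_cost :: "nat \<Rightarrow> (int \<Rightarrow> int \<Rightarrow> real) \<Rightarrow> seqs \<Rightarrow> real" where
  "quad_cost d M x = 1/2 * (\<Sum>\<^sub>\<infinity>(h, k). M h k * entry_inner d x h k)"

definition symmetric_family :: "(int \<Rightarrow> int \<Rightarrow> int \<Rightarrow> real) \<Rightarrow> bool" where
  "symmetric_family M \<longleftrightarrow> (\<forall>i h k. M i h k = M i k h)"

definition shift_invariant :: "(int \<Rightarrow> int \<Rightarrow> int \<Rightarrow> real) \<Rightarrow> bool" where
  "shift_invariant M \<longleftrightarrow> (\<forall>i h k. M (i + 1) h k = M i (h - 1) (k - 1))"

text \<open>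
  Higher Frechet derivatives of a real function on a linear subspace \<open>S\<close> are taken to be
  bounded multilinear forms; a form of order \<open>n\<close> is applied to lists of \<open>n\<close> elements of \<open>S\<close>.
  In \<open>frechet_C S m f\<close> the second condition says that \<open>D n\<close> is Frechet differentiable as a map
  into the space of forms of order \<open>n\<close> with the operator norm, with derivative \<open>D (Suc n)\<close>,
  and the last one that \<open>D m\<close> is continuous for the operator norm.
\<close>

definition bounded_multilinear_on ::
    "'a::real_normed_vector set \<Rightarrow> nat \<Rightarrow> ('a list \<Rightarrow> real) \<Rightarrow> bool" where
  "bounded_multilinear_on S n A \<longleftrightarrow>
     (\<forall>vs \<in> lists S. length vs = n \<longrightarrow> (\<forall>i<n. \<forall>v\<in>S. \<forall>w\<in>S. \<forall>r.
        A (vs[i := v + w]) = A (vs[i := v]) + A (vs[i := w]) \<and>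
        A (vs[i := r *\<^sub>R v]) = r * A (vs[i := v]))) \<and>
     (\<exists>K. \<forall>vs \<in> lists S. length vs = n \<longrightarrow> \<bar>A vs\<bar> \<le> K * prod_list (map norm vs))"

definition frechet_C :: "'a::real_normed_vector set \<Rightarrow> nat \<Rightarrow> ('a \<Rightarrow> real) \<Rightarrow> bool" where
  "frechet_C S m f \<longleftrightarrow> (\<exists>D :: nat \<Rightarrow> 'a \<Rightarrow> 'a list \<Rightarrow> real.
     (\<forall>x\<in>S. D 0 x [] = f x) \<and>
     (\<forall>n\<le>m. \<forall>x\<in>S. bounded_multilinear_on S n (D n x)) \<and>
     (\<forall>n<m. \<forall>x\<in>S. \<forall>\<epsilon>>0. \<exists>\<delta>>0. \<forall>y\<in>S. norm (y - x) < \<delta> \<longrightarrow>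
        (\<forall>vs \<in> lists S. length vs = n \<longrightarrow>
           \<bar>D n y vs - D n x vs - D (Suc n) x ((y - x) # vs)\<bar>
             \<le> \<epsilon> * norm (y - x) * prod_list (map norm vs))) \<and>
     (\<forall>x\<in>S. \<forall>\<epsilon>>0. \<exists>\<delta>>0. \<forall>y\<in>S. norm (y - x) < \<delta> \<longrightarrow>
        (\<forall>vs \<in> lists S. length vs = m \<longrightarrow>
           \<bar>D m y vs - D m x vs\<bar> \<le> \<epsilon> * prod_list (map norm vs))))"

definition infinitely_differentiable_on :: "real set \<Rightarrow> (real \<Rightarrow> real) \<Rightarrow> bool" where
  "infinitely_differentiable_on I f \<longleftrightarrow> (\<exists>p :: nat \<Rightarrow> real \<Rightarrow> real.
     (\<forall>t\<in>I. p 0 t = f t) \<and>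
     (\<forall>n. \<forall>t\<in>I. (p n has_real_derivative p (Suc n) t) (at t within I)))"

text \<open>
  Series over the integers are unordered: they converge along the net of all finite sets of
  indices. The values of \<open>u\<close> outside \<open>{0..T} \<times> linf d\<close> are irrelevant.
\<close>

definition classical_solution ::
    "nat \<Rightarrow> real \<Rightarrow> (int \<Rightarrow> int \<Rightarrow> int \<Rightarrow> real \<Rightarrow> real) \<Rightarrow> (int \<Rightarrow> int \<Rightarrow> int \<Rightarrow> real)
       \<Rightarrow> (int \<Rightarrow> real \<Rightarrow> seqs \<Rightarrow> real) \<Rightarrow> bool" where
  "classical_solution d T f g u \<longleftrightarrow>
     (\<forall>i. \<forall>x\<in>linf d. (\<lambda>t. u i t x) C1_differentiable_on {0<..<T}) \<and>
     (\<forall>i. \<forall>t\<in>{0..T}. frechet_C (linf d) 2 (u i t)) \<and>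
     (\<forall>i B. B \<subseteq> {0..T} \<times> linf d \<and> bounded B \<longrightarrow>
        uniform_limit B
          (\<lambda>J (t, x). \<Sum>j\<in>J. entry_laplacian d j (u i t) x)
          (\<lambda>(t, x). \<Sum>\<^sub>\<infinity>j. entry_laplacian d j (u i t) x)
          (finite_subsets_at_top UNIV) \<and>
        uniform_limit B
          (\<lambda>J (t, x). \<Sum>j\<in>J. grad_inner d j (u j t) (u i t) x)
          (\<lambda>(t, x). \<Sum>\<^sub>\<infinity>j\<in>- {i}. grad_inner d j (u j t) (u i t) x)
          (finite_subsets_at_top (- {i}))) \<and>
     (\<forall>i. \<forall>t\<in>{0<..<T}. \<forall>x\<in>linf d.
        - deriv (\<lambda>s. u i s x) t
        - (\<Sum>\<^sub>\<infinity>j. entry_laplacian d j (u i t) x)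
        + 1/2 * grad_inner d i (u i t) (u i t) x
        + (\<Sum>\<^sub>\<infinity>j\<in>- {i}. grad_inner d j (u j t) (u i t) x)
        = quad_cost d (\<lambda>h k. f i h k t) x) \<and>
     (\<forall>i. \<forall>x\<in>linf d. u i T x = quad_cost d (g i) x)"

definition smooth_family :: "nat \<Rightarrow> real \<Rightarrow> (int \<Rightarrow> real \<Rightarrow> seqs \<Rightarrow> real) \<Rightarrow> bool" where
  "smooth_family d T u \<longleftrightarrow>
     (\<forall>i. \<forall>x\<in>linf d. infinitely_differentiable_on {0..T} (\<lambda>t. u i t x)) \<and>
     (\<forall>i. \<forall>t\<in>{0..T}. \<forall>m. frechet_C (linf d) m (u i t))"

end

theory Submission
  imports Defs
begin

text \<open>
  If the costs are quadratic, it is natural to look for quadratic \<open>u\<^sup>i\<close>, whose coefficients then solve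
  a system of ordinary differential equations in \<open>t\<close>. Such coefficients are in general only once
  differentiable when \<open>f\<close> is merely continuous, whereas \<open>u\<^sup>i\<close> has to be infinitely differentiable in \<open>t\<close>. The
  solution constructed here is therefore not quadratic. With \<open>\<tau> = T - t\<close> and \<open>x\<^sup>j\<close> for the first
  component of the \<open>j\<close>-th entry it has the form
  \<open>u\<^sup>i = q\<^sup>i + \<tau> r\<^sup>i + \<tau>\<^sup>2 (x\<^sup>i Q\<^sup>i(t, x) + \<Sum>\<^sub>j l\<^sup>i\<^sub>j x\<^sup>j)\<close>,
  where \<open>q\<^sup>i\<close> is the terminal cost, \<open>r\<^sup>i\<close> a quadratic form plus a constant, \<open>Q\<^sup>i\<close> a polynomial in \<open>t\<close>
  and finitely many coordinates outside the \<open>i\<close>-th entry, and \<open>l\<^sup>i\<close> a summable sequence. In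
  particular \<open>u\<^sup>i\<close> is a polynomial in \<open>t\<close> for fixed \<open>x\<close>.

  The form \<open>r\<^sup>i\<close> is chosen so that the \<open>i\<close>-th equation holds for \<open>q\<^sup>i + \<tau> r\<^sup>i\<close> at \<open>t = T\<close>; its
  coefficients contain the series \<open>\<Sum>\<^sub>j g\<^sup>j\<^sub>j\<^sub>h g\<^sup>i\<^sub>j\<^sub>k\<close>, and self-control of \<open>\<beta>\<close> keeps them below
  a multiple of \<open>\<beta>\<^sub>h\<^sub>-\<^sub>i \<beta>\<^sub>k\<^sub>-\<^sub>i\<close> (lemmas \<open>interaction_bound\<close> and \<open>base_compatible\<close>). What is left
  over in equation \<open>i\<close>, its residual, vanishes at \<open>t = T\<close> and is, uniformly on bounded sets, a limit of
  polynomials in \<open>t\<close> and finitely many coordinates.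

  The terms with \<open>Q\<close> and \<open>l\<close> cancel the residuals through the coupling \<open>D\<^sub>c u\<^sup>c \<cdot> D\<^sub>c u\<^sup>i\<close>. If player \<open>c\<close>
  has not been involved so far, set \<open>l\<^sup>i\<^sub>c = e\<close> and \<open>Q\<^sup>c = P / e\<close>. The coupling then contains
  \<open>\<tau>\<^sup>2 l\<^sup>i\<^sub>c \<cdot> \<tau>\<^sup>2 Q\<^sup>c = \<tau>\<^sup>4 P\<close>, and \<open>P\<close> can be chosen so that \<open>\<tau>\<^sup>4 P\<close> nearly equals the residual
  of equation \<open>i\<close> (lemma \<open>appr_flat\<close>). The number \<open>e\<close> is tiny, hence \<open>Q\<^sup>c\<close> is huge, but it enters
  the equation of another player \<open>k\<close> only with the factor \<open>D\<^sub>c u\<^sup>k\<close>, of size \<open>\<beta>\<^sub>c\<^sub>-\<^sub>k\<close>, and so does no harm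
  if \<open>c\<close> is far away (lemma \<open>good_step_exists\<close>). The equation of \<open>c\<close> itself is spoilt; its residual is
  cancelled later, by players further away. All players are treated in turn, each of them
  infinitely often, with errors of order \<open>2\<^sup>-\<^sup>s\<close> at stage \<open>s\<close> on the ball of radius \<open>s\<close>. Since \<open>Q\<^sup>i\<close> is never
  changed once player \<open>i\<close> has been involved, the functions \<open>u\<^sup>i\<close> converge; the changes of the
  coupling terms of each equation are summable, so that the series converge uniformly on bounded
  sets and all residuals vanish in the limit (lemma \<open>limit_dominated_and_exact\<close>).

  Frechet smoothness in \<open>x\<close> is obtained from derivatives along lines with locally uniform bounds,
  which are easily checked for quadratic forms, linear forms and products.
\<close>

section \<open>Unordered series of real numbers\<close>

lemma summable_on_dominated:
  fixes f :: "'a \<Rightarrow> real"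
  assumes "M summable_on A" "\<And>x. x \<in> A \<Longrightarrow> \<bar>f x\<bar> \<le> M x"
  shows "f summable_on A"
  using Infinite_Sum.abs_summable_on_comparison_test'[OF assms(1), of f] assms(2)
  by (simp add: summable_on_iff_abs_summable_on_real[of f])

lemma infsum_le_bound:
  fixes f :: "'a \<Rightarrow> real"
  assumes "M summable_on UNIV" "\<And>k. \<bar>f k\<bar> \<le> M k"
  shows "\<bar>\<Sum>\<^sub>\<infinity>k. f k\<bar> \<le> (\<Sum>\<^sub>\<infinity>k. M k)"
  using norm_infsum_le[OF has_sum_infsum[OF summable_on_dominated[OF assms(1)]] has_sum_infsum[OF assms(1)], of f]
    assms(2) by simp

lemma summable_on_finite_support:
  fixes f :: "'a \<Rightarrow> real"
  assumes "finite F" "\<And>k. k \<notin> F \<Longrightarrow> f k = 0"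
  shows "f summable_on UNIV"
  using summable_on_cong_neutral[of F UNIV f f] assms by (auto intro: summable_on_finite)

lemma infsum_finite_support:
  fixes f :: "'a \<Rightarrow> real"
  assumes "finite F" "\<And>k. k \<notin> F \<Longrightarrow> f k = 0"
  shows "(\<Sum>\<^sub>\<infinity>k. f k) = (\<Sum>k\<in>F. f k)"
  using infsum_cong_neutral[of F UNIV f f] assms by (auto simp: infsum_finite)

text \<open>
  Applied to the coupling series of an equation, of which a single correction alters one term.
\<close>

lemma infsum_add_single:
  fixes f :: "'a \<Rightarrow> real"
  assumes "f summable_on UNIV"
  shows "(\<Sum>\<^sub>\<infinity>k. f k + (if k = c then b else 0)) = (\<Sum>\<^sub>\<infinity>k. f k) + b"
proof -
  have "(\<Sum>\<^sub>\<infinity>k. f k + (if k = c then b else 0)) = (\<Sum>\<^sub>\<infinity>k. f k) + (\<Sum>\<^sub>\<infinity>k. if k = c then b else 0)"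
    by (rule infsum_add[OF assms summable_on_finite_support[of "{c}"]]) auto
  also have "(\<Sum>\<^sub>\<infinity>k. if k = c then b else 0) = b"
    by (subst infsum_finite_support[of "{c}"]) auto
  finally show ?thesis .
qed

lemma infsum_finite_sum:
  fixes f :: "'b \<Rightarrow> 'a \<Rightarrow> real"
  assumes "finite A" "\<And>a. a \<in> A \<Longrightarrow> f a summable_on UNIV"
  shows "(\<Sum>\<^sub>\<infinity>k. \<Sum>a\<in>A. f a k) = (\<Sum>a\<in>A. \<Sum>\<^sub>\<infinity>k. f a k) \<and> (\<lambda>k. \<Sum>a\<in>A. f a k) summable_on UNIV"
  using assms
proof (induction A rule: finite_induct)
  case (insert a A)
  then show ?case using infsum_add[of "f a" UNIV "\<lambda>k. \<Sum>a\<in>A. f a k"]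
    summable_on_add[of "f a" UNIV "\<lambda>k. \<Sum>a\<in>A. f a k"] by simp
qed simp

lemma summable_on_products:
  fixes p :: "'a \<Rightarrow> real" and q :: "'b \<Rightarrow> real"
  assumes "p summable_on UNIV" "q summable_on UNIV" "\<And>h. 0 \<le> p h" "\<And>k. 0 \<le> q k"
  shows "(\<lambda>(h, k). p h * q k) summable_on UNIV"
proof -
  have "(\<lambda>(h, k). p h * q k) summable_on Sigma UNIV (\<lambda>_. UNIV)"
    by (rule summable_on_SigmaI[where g = "\<lambda>h. p h * (\<Sum>\<^sub>\<infinity>k. q k)"])
       (use assms in \<open>auto intro!: has_sum_cmult_right has_sum_infsum summable_on_cmult_left\<close>)
  then show ?thesis by simp
qed

lemma infsum_pairs:
  fixes f :: "'a \<times> 'b \<Rightarrow> real"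
  assumes "f summable_on UNIV"
  shows "(\<Sum>\<^sub>\<infinity>h. \<Sum>\<^sub>\<infinity>k. f (h, k)) = (\<Sum>\<^sub>\<infinity>p. f p)"
  using infsum_Sigma_banach[of f UNIV "\<lambda>_. UNIV"] assms by simp

lemma infsum_swap_pair: "(\<Sum>\<^sub>\<infinity>(h, k). f h k) = (\<Sum>\<^sub>\<infinity>(k, h). f h k :: real)"
proof -
  have "bij_betw prod.swap UNIV UNIV" by (simp add: bij_betw_def)
  from infsum_reindex_bij_betw[OF this, of "\<lambda>(h, k). f h k"] show ?thesis
    by (simp add: case_prod_unfold)
qed

lemma summable_on_along_injection:
  fixes c :: "nat \<Rightarrow> 'a" and E :: "nat \<Rightarrow> real"
  assumes "inj c" "\<And>r. 0 \<le> E r" "summable E"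
  shows "(\<lambda>j. if j \<in> range c then E (inv c j) else 0) summable_on UNIV"
proof -
  have "E summable_on UNIV"
    using assms(2,3) by (intro norm_summable_imp_summable_on) simp
  then have "((\<lambda>j. E (inv c j)) \<circ> c) summable_on UNIV"
    using assms(1) by (simp add: o_def)
  then have "(\<lambda>j. E (inv c j)) summable_on range c"
    using summable_on_reindex[OF assms(1)] by blast
  then show ?thesis
    by (rule summable_on_cong_neutral[THEN iffD1, rotated -1]) auto
qed

lemma bij_int_shift: "bij_betw (\<lambda>j::int. j - i) UNIV UNIV"
  by (rule bij_betwI[of _ _ _ "\<lambda>j. j + i"]) auto

lemma summable_on_shift:
  fixes w :: "int \<Rightarrow> real"
  shows "w summable_on UNIV \<Longrightarrow> (\<lambda>j. w (j - i)) summable_on UNIV"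
  using summable_on_reindex_bij_betw[OF bij_int_shift, of w i] by simp

text \<open>
  The terms of a summable family tend to zero at infinity, simultaneously along finitely many
  shifts. New players are placed at such a far point \<open>c\<close>.
\<close>

lemma summable_on_far:
  fixes w :: "int \<Rightarrow> real"
  assumes "w summable_on UNIV" "0 < \<delta>" "finite B" "finite F"
  obtains c where "c \<notin> F" "\<And>b. b \<in> B \<Longrightarrow> \<bar>w (c - b)\<bar> < \<delta>"
proof -
  have "\<forall>\<^sub>F X in finite_subsets_at_top UNIV. dist (sum w X) (\<Sum>\<^sub>\<infinity>k. w k) < \<delta> / 2"
    using has_sum_infsum[OF assms(1)] assms(2) unfolding has_sum_def by (intro tendstoD) auto
  then obtain X where X: "finite X"
    "\<And>Y. finite Y \<Longrightarrow> X \<subseteq> Y \<Longrightarrow> dist (sum w Y) (\<Sum>\<^sub>\<infinity>k. w k) < \<delta> / 2"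
    unfolding eventually_finite_subsets_at_top by auto
  have small: "\<bar>w k\<bar> < \<delta>" if "k \<notin> X" for k
  proof -
    have "sum w (insert k X) = w k + sum w X" using X(1) that by simp
    then have "\<bar>(w k + sum w X) - (\<Sum>\<^sub>\<infinity>k. w k)\<bar> < \<delta> / 2" "\<bar>sum w X - (\<Sum>\<^sub>\<infinity>k. w k)\<bar> < \<delta> / 2"
      using X(2)[of X] X(2)[of "insert k X"] X(1) unfolding dist_real_def by auto
    then show ?thesis by linarith
  qed
  have "finite (F \<union> (\<Union>b\<in>B. (\<lambda>k. k + b) ` X))" using assms X(1) by auto
  then obtain c where c: "c \<notin> F \<union> (\<Union>b\<in>B. (\<lambda>k. k + b) ` X)"
    using ex_new_if_finite[OF infinite_UNIV_int] by blast
  have "\<bar>w (c - b)\<bar> < \<delta>" if "b \<in> B" for b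
  proof (rule small, rule notI)
    assume "c - b \<in> X"
    then have "c \<in> (\<lambda>k. k + b) ` X" by (intro image_eqI[of _ _ "c - b"]) auto
    with c that show False by blast
  qed
  with c that show thesis by blast
qed

text \<open>
  Dominated convergence for series: the domination makes the convergence of the partial sums uniform in
  \<open>n\<close>, so that the two limits may be interchanged.
\<close>

lemma infsum_dominated_limit:
  fixes F :: "nat \<Rightarrow> 'a \<Rightarrow> real"
  assumes lim: "\<And>k. (\<lambda>n. F n k) \<longlonglongrightarrow> G k"
    and dom: "\<And>n k. n0 \<le> n \<Longrightarrow> \<bar>F n k\<bar> \<le> M k" and M: "M summable_on UNIV"
  shows "(\<lambda>n. \<Sum>\<^sub>\<infinity>k. F n k) \<longlonglongrightarrow> (\<Sum>\<^sub>\<infinity>k. G k)"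
proof -
  have u: "uniform_limit {n0..} (\<lambda>X n. \<Sum>k\<in>X. F n k) (\<lambda>n. \<Sum>\<^sub>\<infinity>k. F n k) (finite_subsets_at_top UNIV)"
    by (rule Weierstrass_m_test_general[OF _ M]) (use dom in auto)
  have "\<bar>G k\<bar> \<le> M k" for k
    using lim[of k] dom by (intro LIMSEQ_le_const2[OF tendsto_rabs]) auto
  then have "G summable_on UNIV"
    by (rule summable_on_dominated[OF M])
  then have g: "((\<lambda>X. \<Sum>k\<in>X. G k) \<longlongrightarrow> (\<Sum>\<^sub>\<infinity>k. G k)) (finite_subsets_at_top UNIV)"
    using has_sum_infsum unfolding has_sum_def by blast
  show ?thesis
    by (rule swap_uniform_limit'[OF _ g u])
       (auto intro!: tendsto_sum lim eventually_ge_at_top[THEN eventually_mono])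
qed

section \<open>Smoothness on a linear subspace from derivatives along lines\<close>

definition line_deriv :: "'a::real_normed_vector \<Rightarrow> ('a \<Rightarrow> real) \<Rightarrow> 'a \<Rightarrow> real" where
  "line_deriv v f x = deriv (\<lambda>s. f (x + s *\<^sub>R v)) 0"

text \<open>
  \<open>smooth_bd S n h f\<close> bounds \<open>f\<close> and its derivatives along lines in \<open>S\<close> up to order \<open>n\<close>: at a point
  of norm \<open>r\<close>, the derivative along \<open>v\<^sub>1, \<dots>, v\<^sub>k\<close> is at most \<open>h r\<close> times the product of the norms of
  the directions. A single function \<open>h\<close> serves all orders up to \<open>n\<close>, which makes sums and products easy
  to treat by induction on \<open>n\<close>.
\<close>

fun smooth_bd ::
    "'a::real_normed_vector set \<Rightarrow> nat \<Rightarrow> (real \<Rightarrow> real) \<Rightarrow> ('a \<Rightarrow> real) \<Rightarrow> bool" where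
  "smooth_bd S 0 h f \<longleftrightarrow> (\<forall>x\<in>S. \<bar>f x\<bar> \<le> h (norm x))"
| "smooth_bd S (Suc n) h f \<longleftrightarrow> (\<forall>x\<in>S. \<bar>f x\<bar> \<le> h (norm x)) \<and>
     (\<exists>D. (\<forall>v\<in>S. smooth_bd S n (\<lambda>r. norm v * h r) (D v)) \<and>
          (\<forall>x\<in>S. \<forall>v\<in>S. ((\<lambda>s. f (x + s *\<^sub>R v)) has_real_derivative D v x) (at 0)) \<and>
          (\<forall>x\<in>S. \<forall>v\<in>S. \<forall>w\<in>S. D (v + w) x = D v x + D w x) \<and>
          (\<forall>x\<in>S. \<forall>v\<in>S. \<forall>r. D (r *\<^sub>R v) x = r * D v x))"

lemma smooth_bd_bound: "smooth_bd S n h f \<Longrightarrow> x \<in> S \<Longrightarrow> \<bar>f x\<bar> \<le> h (norm x)"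
  by (cases n) auto

lemma smooth_bd_Suc: "smooth_bd S (Suc n) h f \<Longrightarrow> smooth_bd S n h f"
proof (induction n arbitrary: h f)
  case (Suc n)
  from Suc.prems obtain D where D: "\<forall>v\<in>S. smooth_bd S (Suc n) (\<lambda>r. norm v * h r) (D v)"
    "\<forall>x\<in>S. \<forall>v\<in>S. ((\<lambda>s. f (x + s *\<^sub>R v)) has_real_derivative D v x) (at 0)"
    "\<forall>x\<in>S. \<forall>v\<in>S. \<forall>w\<in>S. D (v + w) x = D v x + D w x"
    "\<forall>x\<in>S. \<forall>v\<in>S. \<forall>r. D (r *\<^sub>R v) x = r * D v x"
    by auto
  have "\<forall>v\<in>S. smooth_bd S n (\<lambda>r. norm v * h r) (D v)"
    using D(1) Suc.IH by blast
  with D(2-) Suc.prems show ?case by auto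
qed simp

lemma smooth_bd_mono:
  "smooth_bd S n h f \<Longrightarrow> (\<And>r. 0 \<le> r \<Longrightarrow> h r \<le> k r) \<Longrightarrow> smooth_bd S n k f"
proof (induction n arbitrary: h k f)
  case 0
  then show ?case by (auto intro: order_trans)
next
  case (Suc n)
  from Suc.prems(1) obtain D where D: "\<forall>v\<in>S. smooth_bd S n (\<lambda>r. norm v * h r) (D v)"
    "\<forall>x\<in>S. \<forall>v\<in>S. ((\<lambda>s. f (x + s *\<^sub>R v)) has_real_derivative D v x) (at 0)"
    "\<forall>x\<in>S. \<forall>v\<in>S. \<forall>w\<in>S. D (v + w) x = D v x + D w x"
    "\<forall>x\<in>S. \<forall>v\<in>S. \<forall>r. D (r *\<^sub>R v) x = r * D v x"
    by auto
  have "\<forall>v\<in>S. smooth_bd S n (\<lambda>r. norm v * k r) (D v)"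
    using D(1) Suc.prems(2) by (blast intro: Suc.IH mult_left_mono norm_ge_zero)
  moreover have "\<forall>x\<in>S. \<bar>f x\<bar> \<le> k (norm x)"
    using Suc.prems by (auto intro: order_trans)
  ultimately show ?case using D(2-) by auto
qed

lemma smooth_bd_cong_on:
  assumes "subspace S"
  shows "smooth_bd S n h f \<Longrightarrow> (\<And>x. x \<in> S \<Longrightarrow> f x = g x) \<Longrightarrow> smooth_bd S n h g"
proof (cases n)
  case (Suc m)
  assume f: "smooth_bd S n h f" and eq: "\<And>x. x \<in> S \<Longrightarrow> f x = g x"
  have "(\<lambda>s. f (x + s *\<^sub>R v)) = (\<lambda>s. g (x + s *\<^sub>R v))" if "x \<in> S" "v \<in> S" for x v
    using eq that assms by (auto simp: subspace_add subspace_scale)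
  with f eq show ?thesis unfolding Suc smooth_bd.simps by simp
qed simp

lemma smooth_bd_add:
  "smooth_bd S n h f \<Longrightarrow> smooth_bd S n k g \<Longrightarrow> smooth_bd S n (\<lambda>r. h r + k r) (\<lambda>x. f x + g x)"
proof (induction n arbitrary: h k f g)
  case 0
  then show ?case by (auto intro!: order_trans[OF abs_triangle_ineq] add_mono)
next
  case (Suc n)
  from Suc.prems(1) obtain D where D: "\<forall>v\<in>S. smooth_bd S n (\<lambda>r. norm v * h r) (D v)"
    "\<forall>x\<in>S. \<forall>v\<in>S. ((\<lambda>s. f (x + s *\<^sub>R v)) has_real_derivative D v x) (at 0)"
    "\<forall>x\<in>S. \<forall>v\<in>S. \<forall>w\<in>S. D (v + w) x = D v x + D w x"
    "\<forall>x\<in>S. \<forall>v\<in>S. \<forall>r. D (r *\<^sub>R v) x = r * D v x" by auto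
  from Suc.prems(2) obtain E where E: "\<forall>v\<in>S. smooth_bd S n (\<lambda>r. norm v * k r) (E v)"
    "\<forall>x\<in>S. \<forall>v\<in>S. ((\<lambda>s. g (x + s *\<^sub>R v)) has_real_derivative E v x) (at 0)"
    "\<forall>x\<in>S. \<forall>v\<in>S. \<forall>w\<in>S. E (v + w) x = E v x + E w x"
    "\<forall>x\<in>S. \<forall>v\<in>S. \<forall>r. E (r *\<^sub>R v) x = r * E v x" by auto
  have 1: "\<forall>v\<in>S. smooth_bd S n (\<lambda>r. norm v * (h r + k r)) (\<lambda>x. D v x + E v x)"
    unfolding distrib_left using D(1) E(1) Suc.IH by blast
  have 0: "\<forall>x\<in>S. \<bar>f x + g x\<bar> \<le> h (norm x) + k (norm x)"
    using Suc.prems by (auto intro!: order_trans[OF abs_triangle_ineq] add_mono)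
  show ?case unfolding smooth_bd.simps
    using D(2-) E(2-)
    by (intro conjI 0 exI[of _ "\<lambda>v x. D v x + E v x"] 1)
       (auto intro!: derivative_eq_intros simp: distrib_left)
qed

text \<open>
  By the product rule each differentiation doubles the number of terms, hence the factor \<open>2 ^ n\<close>.
\<close>

lemma smooth_bd_mult:
  "smooth_bd S n h f \<Longrightarrow> smooth_bd S n k g \<Longrightarrow> (\<And>r. 0 \<le> r \<Longrightarrow> 0 \<le> h r) \<Longrightarrow>
   (\<And>r. 0 \<le> r \<Longrightarrow> 0 \<le> k r) \<Longrightarrow> smooth_bd S n (\<lambda>r. 2 ^ n * (h r * k r)) (\<lambda>x. f x * g x)"
proof (induction n arbitrary: h k f g)
  case 0
  then show ?case by (auto simp: abs_mult intro!: mult_mono)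
next
  case (Suc n)
  from Suc.prems(1) obtain D where D: "\<forall>v\<in>S. smooth_bd S n (\<lambda>r. norm v * h r) (D v)"
    "\<forall>x\<in>S. \<forall>v\<in>S. ((\<lambda>s. f (x + s *\<^sub>R v)) has_real_derivative D v x) (at 0)"
    "\<forall>x\<in>S. \<forall>v\<in>S. \<forall>w\<in>S. D (v + w) x = D v x + D w x"
    "\<forall>x\<in>S. \<forall>v\<in>S. \<forall>r. D (r *\<^sub>R v) x = r * D v x" by auto
  from Suc.prems(2) obtain E where E: "\<forall>v\<in>S. smooth_bd S n (\<lambda>r. norm v * k r) (E v)"
    "\<forall>x\<in>S. \<forall>v\<in>S. ((\<lambda>s. g (x + s *\<^sub>R v)) has_real_derivative E v x) (at 0)"
    "\<forall>x\<in>S. \<forall>v\<in>S. \<forall>w\<in>S. E (v + w) x = E v x + E w x"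
    "\<forall>x\<in>S. \<forall>v\<in>S. \<forall>r. E (r *\<^sub>R v) x = r * E v x" by auto
  have 1: "smooth_bd S n (\<lambda>r. norm v * (2 ^ Suc n * (h r * k r)))
             (\<lambda>x. D v x * g x + f x * E v x)" if "v \<in> S" for v
  proof -
    have a: "smooth_bd S n (\<lambda>r. 2 ^ n * (norm v * h r * k r)) (\<lambda>x. D v x * g x)"
      using D(1) that Suc.prems(3,4) smooth_bd_Suc[OF Suc.prems(2)] by (intro Suc.IH) auto
    have b: "smooth_bd S n (\<lambda>r. 2 ^ n * (h r * (norm v * k r))) (\<lambda>x. f x * E v x)"
      using E(1) that Suc.prems(3,4) smooth_bd_Suc[OF Suc.prems(1)] by (intro Suc.IH) auto
    have "(\<lambda>r. norm v * (2 ^ Suc n * (h r * k r)))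
        = (\<lambda>r. 2 ^ n * (norm v * h r * k r) + 2 ^ n * (h r * (norm v * k r)))"
      by (auto simp: algebra_simps)
    then show ?thesis using smooth_bd_add[OF a b] by simp
  qed
  have 0: "\<forall>x\<in>S. \<bar>f x * g x\<bar> \<le> 2 ^ Suc n * (h (norm x) * k (norm x))"
  proof
    fix x assume x: "x \<in> S"
    have "\<bar>f x * g x\<bar> \<le> h (norm x) * k (norm x)"
      using Suc.prems x by (auto simp: abs_mult intro!: mult_mono)
    also have "\<dots> \<le> 2 ^ Suc n * (h (norm x) * k (norm x))"
      using mult_right_mono[OF one_le_power[of "2::real" "Suc n"], of "h (norm x) * k (norm x)"]
        Suc.prems(3,4)[of "norm x"] by simp
    finally show "\<bar>f x * g x\<bar> \<le> 2 ^ Suc n * (h (norm x) * k (norm x))" .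
  qed
  have 2: "\<forall>x\<in>S. \<forall>v\<in>S. ((\<lambda>s. f (x + s *\<^sub>R v) * g (x + s *\<^sub>R v)) has_real_derivative
      D v x * g x + f x * E v x) (at 0)"
    using D(2) E(2) by (auto intro!: derivative_eq_intros)
  show ?case unfolding smooth_bd.simps
    using D(3-) E(3-) 1
    by (intro conjI 0 exI[of _ "\<lambda>v x. D v x * g x + f x * E v x"] 2)
       (auto simp: algebra_simps)
qed

lemma smooth_bd_const: "smooth_bd S n (\<lambda>r. \<bar>c\<bar>) (\<lambda>x. c)"
proof (induction n arbitrary: c)
  case (Suc n)
  have "smooth_bd S n (\<lambda>r. norm v * \<bar>c\<bar>) (\<lambda>x. 0)" for v
    by (rule smooth_bd_mono[OF Suc[of 0]]) simp
  then show ?case by (auto intro!: exI[of _ "\<lambda>v x. 0"])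
qed simp

lemma smooth_bd_linear:
  assumes S: "subspace S"
    and add: "\<And>x y. x \<in> S \<Longrightarrow> y \<in> S \<Longrightarrow> L (x + y) = L x + L y"
    and scale: "\<And>r x. x \<in> S \<Longrightarrow> L (r *\<^sub>R x) = r * L x"
    and bd: "\<And>x. x \<in> S \<Longrightarrow> \<bar>L x\<bar> \<le> K * norm x" and K: "0 \<le> K"
  shows "smooth_bd S n (\<lambda>r. K * (1 + r)) L"
proof -
  have 0: "\<bar>L x\<bar> \<le> K * (1 + norm x)" if "x \<in> S" for x
    using bd[OF that] K by (simp add: algebra_simps)
  show ?thesis
  proof (cases n)
    case (Suc m)
    have "smooth_bd S m (\<lambda>r. norm v * (K * (1 + r))) (\<lambda>x. L v)" if "v \<in> S" for v
    proof (rule smooth_bd_mono[OF smooth_bd_const])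
      fix r :: real assume "0 \<le> r"
      have "\<bar>L v\<bar> \<le> K * norm v" using bd that by blast
      also have "\<dots> \<le> K * norm v * (1 + r)" using K \<open>0 \<le> r\<close> by (simp add: mult_left_le algebra_simps)
      finally show "\<bar>L v\<bar> \<le> norm v * (K * (1 + r))" by (simp add: algebra_simps)
    qed
    moreover have "((\<lambda>s. L (x + s *\<^sub>R v)) has_real_derivative L v) (at 0)"
      if "x \<in> S" "v \<in> S" for x v
    proof -
      have "(\<lambda>s. L (x + s *\<^sub>R v)) = (\<lambda>s. L x + s * L v)"
        using add scale that S by (auto simp: subspace_scale)
      then show ?thesis by (auto intro!: derivative_eq_intros)
    qed
    ultimately show ?thesis using 0 add scale
      unfolding Suc smooth_bd.simps by (intro conjI exI[of _ "\<lambda>v x. L v"]) auto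
  qed (use 0 in auto)
qed

text \<open>
  The derivative of \<open>x \<mapsto> B x x / 2\<close> along \<open>v\<close> is \<open>x \<mapsto> B x v\<close>, which is linear.
\<close>

lemma smooth_bd_quadratic:
  assumes S: "subspace S"
    and add: "\<And>x y z. x \<in> S \<Longrightarrow> y \<in> S \<Longrightarrow> z \<in> S \<Longrightarrow> B (x + y) z = B x z + B y z"
    and scale: "\<And>r x z. x \<in> S \<Longrightarrow> z \<in> S \<Longrightarrow> B (r *\<^sub>R x) z = r * B x z"
    and sym: "\<And>x z. x \<in> S \<Longrightarrow> z \<in> S \<Longrightarrow> B x z = B z x"
    and bd: "\<And>x z. x \<in> S \<Longrightarrow> z \<in> S \<Longrightarrow> \<bar>B x z\<bar> \<le> K * norm x * norm z" and K: "0 \<le> K"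
  shows "smooth_bd S n (\<lambda>r. K * (1 + r)^2) (\<lambda>x. 1/2 * B x x)"
    and "x \<in> S \<Longrightarrow> v \<in> S \<Longrightarrow> ((\<lambda>s. 1/2 * B (x + s *\<^sub>R v) (x + s *\<^sub>R v)) has_real_derivative B x v) (at 0)"
proof -
  have D: "((\<lambda>s. 1/2 * B (x + s *\<^sub>R v) (x + s *\<^sub>R v)) has_real_derivative B x v) (at 0)"
    if "x \<in> S" "v \<in> S" for x v
  proof -
    have "B (x + s *\<^sub>R v) (x + s *\<^sub>R v) = B x x + 2 * s * B x v + s^2 * B v v" for s
    proof -
      have sv: "s *\<^sub>R v \<in> S" "x + s *\<^sub>R v \<in> S"
        using S that by (auto simp: subspace_scale subspace_add)
      have "B (x + s *\<^sub>R v) (x + s *\<^sub>R v) = B x (x + s *\<^sub>R v) + s * B v (x + s *\<^sub>R v)"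
        using sv that by (simp add: add scale)
      also have "\<dots> = B (x + s *\<^sub>R v) x + s * B (x + s *\<^sub>R v) v"
        using sv that by (simp add: sym)
      also have "B (x + s *\<^sub>R v) x = B x x + s * B x v"
        using sv that by (simp add: add scale sym[of v x])
      also have "B (x + s *\<^sub>R v) v = B x v + s * B v v"
        using sv that by (simp add: add scale)
      finally show ?thesis by (simp add: algebra_simps power2_eq_square)
    qed
    then show ?thesis by (auto intro!: derivative_eq_intros)
  qed
  then show "x \<in> S \<Longrightarrow> v \<in> S \<Longrightarrow>
    ((\<lambda>s. 1/2 * B (x + s *\<^sub>R v) (x + s *\<^sub>R v)) has_real_derivative B x v) (at 0)" .
  have 0: "\<bar>1/2 * B x x\<bar> \<le> K * (1 + norm x)^2" if "x \<in> S" for x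
  proof -
    have "\<bar>1/2 * B x x\<bar> \<le> K * (norm x * norm x)" using bd[OF that that] by simp
    also have "\<dots> \<le> K * (1 + norm x)^2"
      using K by (intro mult_left_mono) (auto simp: power2_eq_square algebra_simps)
    finally show ?thesis .
  qed
  show "smooth_bd S n (\<lambda>r. K * (1 + r)^2) (\<lambda>x. 1/2 * B x x)"
  proof (cases n)
    case (Suc m)
    have "smooth_bd S m (\<lambda>r. norm v * (K * (1 + r)^2)) (\<lambda>x. B x v)" if v: "v \<in> S" for v
    proof (rule smooth_bd_mono[OF smooth_bd_linear[OF S]])
      show "B (x + y) v = B x v + B y v" if "x \<in> S" "y \<in> S" for x y using add that v by blast
      show "B (r *\<^sub>R x) v = r * B x v" if "x \<in> S" for r x using scale that v by blast
      show "\<bar>B x v\<bar> \<le> (K * norm v) * norm x" if "x \<in> S" for x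
        using bd[OF that v] by (simp add: algebra_simps)
      show "0 \<le> K * norm v" using K by simp
      fix r :: real assume "0 \<le> r"
      then have "1 + r \<le> (1 + r)^2" by (simp add: power2_eq_square)
      then have "K * norm v * (1 + r) \<le> K * norm v * (1 + r)^2"
        using K by (intro mult_left_mono) auto
      then show "K * norm v * (1 + r) \<le> norm v * (K * (1 + r)^2)"
        by (simp add: algebra_simps)
    qed
    moreover have "B x (v + w) = B x v + B x w" "B x (r *\<^sub>R v) = r * B x v"
      if "x \<in> S" "v \<in> S" "w \<in> S" for x v w r
    proof -
      have "v + w \<in> S" "r *\<^sub>R v \<in> S" using S that by (auto simp: subspace_scale subspace_add)
      then show "B x (v + w) = B x v + B x w" "B x (r *\<^sub>R v) = r * B x v"
        using that by (simp_all add: sym[of x] add scale)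
    qed
    ultimately show ?thesis using 0 D unfolding Suc smooth_bd.simps
      by (intro conjI exI[of _ "\<lambda>v x. B x v"]) auto
  qed (use 0 in auto)
qed

lemma smooth_bd_line_deriv:
  assumes S: "subspace S" and f: "smooth_bd S (Suc n) h f" and v: "v \<in> S"
  shows "smooth_bd S n (\<lambda>r. norm v * h r) (line_deriv v f)"
    and "x \<in> S \<Longrightarrow> ((\<lambda>s. f (x + s *\<^sub>R v)) has_real_derivative line_deriv v f (x + s *\<^sub>R v)) (at s)"
    and "x \<in> S \<Longrightarrow> w \<in> S \<Longrightarrow> line_deriv (v + w) f x = line_deriv v f x + line_deriv w f x"
    and "x \<in> S \<Longrightarrow> line_deriv (r *\<^sub>R v) f x = r * line_deriv v f x"
proof -
  from f obtain D where D: "\<forall>v\<in>S. smooth_bd S n (\<lambda>r. norm v * h r) (D v)"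
    "\<forall>x\<in>S. \<forall>v\<in>S. ((\<lambda>s. f (x + s *\<^sub>R v)) has_real_derivative D v x) (at 0)"
    "\<forall>x\<in>S. \<forall>v\<in>S. \<forall>w\<in>S. D (v + w) x = D v x + D w x"
    "\<forall>x\<in>S. \<forall>v\<in>S. \<forall>r. D (r *\<^sub>R v) x = r * D v x" by auto
  have eq: "line_deriv v f x = D v x" if "x \<in> S" "v \<in> S" for x v
    using D(2) that unfolding line_deriv_def by (auto intro: DERIV_imp_deriv)
  show "smooth_bd S n (\<lambda>r. norm v * h r) (line_deriv v f)"
    by (rule smooth_bd_cong_on[OF S, of _ _ "D v"]) (use D v eq in auto)
  show "x \<in> S \<Longrightarrow> w \<in> S \<Longrightarrow> line_deriv (v + w) f x = line_deriv v f x + line_deriv w f x"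
    using eq v D(3) S by (simp add: subspace_add)
  show "x \<in> S \<Longrightarrow> line_deriv (r *\<^sub>R v) f x = r * line_deriv v f x"
    using eq v D(4) S by (simp add: subspace_scale)
  assume x: "x \<in> S"
  let ?y = "x + s *\<^sub>R v"
  have y: "?y \<in> S" using S x v by (simp add: subspace_add subspace_scale)
  have "((\<lambda>r. f (?y + r *\<^sub>R v)) has_real_derivative line_deriv v f ?y) (at 0)"
    using D(2) y v eq by simp
  then have "((\<lambda>r. f (?y + (r - s) *\<^sub>R v)) has_real_derivative line_deriv v f ?y) (at s)"
    using DERIV_shift[of "\<lambda>r. f (?y + (r - s) *\<^sub>R v)" "line_deriv v f ?y" 0 s] by simp
  then show "((\<lambda>s. f (x + s *\<^sub>R v)) has_real_derivative line_deriv v f ?y) (at s)"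
    by (simp add: algebra_simps)
qed

lemma smooth_bd_iterated:
  assumes S: "subspace S"
  shows "smooth_bd S m h f \<Longrightarrow> set vs \<subseteq> S \<Longrightarrow> length vs \<le> m \<Longrightarrow>
    smooth_bd S (m - length vs) (\<lambda>r. prod_list (map norm vs) * h r) (foldr line_deriv vs f)"
proof (induction vs)
  case (Cons v vs)
  then have "smooth_bd S (Suc (m - length (v # vs)))
      (\<lambda>r. prod_list (map norm vs) * h r) (foldr line_deriv vs f)"
    by (simp add: Suc_diff_Suc)
  from smooth_bd_line_deriv(1)[OF S this, of v] Cons.prems show ?case
    by (simp add: mult.assoc)
qed simp

lemma line_deriv_cong_on:
  assumes "subspace S" "x \<in> S" "v \<in> S" "\<And>x. x \<in> S \<Longrightarrow> f x = g x"
  shows "line_deriv v f x = line_deriv v g x"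
proof -
  have "(\<lambda>s. f (x + s *\<^sub>R v)) = (\<lambda>s. g (x + s *\<^sub>R v))"
    using assms by (auto simp: subspace_add subspace_scale)
  then show ?thesis by (simp add: line_deriv_def)
qed

text \<open>
  In the first slot this is linearity of the derivative in its direction. In a later slot the
  functions being differentiated are themselves additive and homogeneous in that direction by induction, and
  differentiation along the first direction preserves such identities.
\<close>

lemma iterated_multilinear:
  assumes S: "subspace S" and f: "smooth_bd S m h f"
  shows "set vs \<subseteq> S \<Longrightarrow> length vs \<le> m \<Longrightarrow> i < length vs \<Longrightarrow> v \<in> S \<Longrightarrow> w \<in> S \<Longrightarrow> x \<in> S \<Longrightarrow>
     foldr line_deriv (vs[i := v + w]) f x
       = foldr line_deriv (vs[i := v]) f x + foldr line_deriv (vs[i := w]) f x \<and>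
     foldr line_deriv (vs[i := r *\<^sub>R v]) f x = r * foldr line_deriv (vs[i := v]) f x"
proof (induction vs arbitrary: i x)
  case (Cons u vs)
  have sm: "smooth_bd S (Suc (m - length (u # vs))) (\<lambda>r. prod_list (map norm ws) * h r)
      (foldr line_deriv ws f)" if "set ws \<subseteq> S" "length ws = length vs" for ws
    using smooth_bd_iterated[OF S f, of ws] that Cons.prems by (simp add: Suc_diff_Suc)
  show ?case
  proof (cases i)
    case 0
    have g: "smooth_bd S (Suc (m - length (u # vs))) (\<lambda>r. prod_list (map norm vs) * h r)
      (foldr line_deriv vs f)" using sm[of vs] Cons.prems by simp
    show ?thesis using smooth_bd_line_deriv(3,4)[OF S g] Cons.prems by (simp add: 0)
  next
    case (Suc k)
    have up: "set (vs[k := z]) \<subseteq> S" if "z \<in> S" for z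
      using Cons.prems that set_update_subset_insert[of vs k z] by auto
    have d: "((\<lambda>s. foldr line_deriv (vs[k := z]) f (x + s *\<^sub>R u)) has_real_derivative
       line_deriv u (foldr line_deriv (vs[k := z]) f) x) (at 0)" if "z \<in> S" for z
      using smooth_bd_line_deriv(2)[OF S sm[OF up[OF that]], of u x 0] Cons.prems by simp
    have IH: "foldr line_deriv (vs[k := v + w]) f y
       = foldr line_deriv (vs[k := v]) f y + foldr line_deriv (vs[k := w]) f y"
      "foldr line_deriv (vs[k := r *\<^sub>R v]) f y = r * foldr line_deriv (vs[k := v]) f y"
      if "y \<in> S" for y
      using Cons.IH[of k y] Cons.prems that Suc by auto
    have "line_deriv u (foldr line_deriv (vs[k := v + w]) f) x
       = line_deriv u (\<lambda>y. foldr line_deriv (vs[k := v]) f y + foldr line_deriv (vs[k := w]) f y) x"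
      by (rule line_deriv_cong_on[OF S]) (use Cons.prems IH in auto)
    also have "\<dots> = line_deriv u (foldr line_deriv (vs[k := v]) f) x
        + line_deriv u (foldr line_deriv (vs[k := w]) f) x"
      unfolding line_deriv_def
      by (intro DERIV_imp_deriv DERIV_add d[unfolded line_deriv_def] Cons.prems)
    finally have 1: "line_deriv u (foldr line_deriv (vs[k := v + w]) f) x
      = line_deriv u (foldr line_deriv (vs[k := v]) f) x
        + line_deriv u (foldr line_deriv (vs[k := w]) f) x" .
    have "line_deriv u (foldr line_deriv (vs[k := r *\<^sub>R v]) f) x
       = line_deriv u (\<lambda>y. r * foldr line_deriv (vs[k := v]) f y) x"
      by (rule line_deriv_cong_on[OF S]) (use Cons.prems IH in auto)
    also have "\<dots> = r * line_deriv u (foldr line_deriv (vs[k := v]) f) x"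
      unfolding line_deriv_def
      by (intro DERIV_imp_deriv DERIV_cmult d[unfolded line_deriv_def] Cons.prems)
    finally show ?thesis using 1 by (simp add: Suc)
  qed
qed simp

text \<open>
  The candidates for the Frechet derivatives are the iterated derivatives along lines. On a segment the mean
  value theorem, applied twice, bounds the remainder of the first-order expansion of the \<open>n\<close>-th derivative by the
  size of the derivative of order \<open>n + 2\<close> times the square of the length of the increment. The bounds are
  uniform over the directions, so this is differentiability in the operator norm.
\<close>

theorem smooth_bd_imp_frechet_C:
  fixes S :: "'a::real_normed_vector set"
  assumes S: "subspace S"
    and f: "\<And>n. \<exists>h. mono_on {0..} h \<and> (\<forall>r\<ge>0. 0 \<le> h r) \<and> smooth_bd S n h f"
  shows "frechet_C S m f"
proof -
  define D where "D n x vs = foldr line_deriv vs f x" for n :: nat and x :: 'a and vs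
  obtain h where h: "mono_on {0..} h" "\<And>r. 0 \<le> r \<Longrightarrow> 0 \<le> h r" and sm: "smooth_bd S (m + 2) h f"
    using f by blast
  have bd: "\<bar>foldr line_deriv vs f x\<bar> \<le> prod_list (map norm vs) * h R"
    if "set vs \<subseteq> S" "length vs \<le> m + 2" "x \<in> S" "norm x \<le> R" for vs x R
  proof -
    have "\<bar>foldr line_deriv vs f x\<bar> \<le> prod_list (map norm vs) * h (norm x)"
      using smooth_bd_bound[OF smooth_bd_iterated[OF S sm that(1,2)] that(3)] .
    also have "\<dots> \<le> prod_list (map norm vs) * h R"
      using h(1) that(4) by (intro mult_left_mono prod_list_nonneg)
        (auto simp: mono_on_def intro: order_trans[OF norm_ge_zero])
    finally show ?thesis .
  qed
  have dr: "((\<lambda>s. foldr line_deriv vs f (x + s *\<^sub>R w)) has_real_derivative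
      foldr line_deriv (w # vs) f (x + s *\<^sub>R w)) (at s)"
    if "set vs \<subseteq> S" "length vs \<le> m + 1" "x \<in> S" "w \<in> S" for vs x w s
  proof -
    have "m + 2 - length vs = Suc (m + 1 - length vs)" using that by simp
    then show ?thesis
      using smooth_bd_line_deriv(2)[OF S, of "m + 1 - length vs" _ "foldr line_deriv vs f" w x s]
        smooth_bd_iterated[OF S sm that(1)] that by simp
  qed
  have mvt: "\<bar>foldr line_deriv vs f (x + s *\<^sub>R w) - foldr line_deriv vs f x\<bar>
      \<le> norm w * prod_list (map norm vs) * h (norm x + norm w)"
    if "set vs \<subseteq> S" "length vs \<le> m + 1" "x \<in> S" "w \<in> S" "0 \<le> s" "s \<le> 1" for vs x w s
  proof (cases "s = 0")
    case False
    note vs = that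
    let ?\<phi> = "\<lambda>s. foldr line_deriv vs f (x + s *\<^sub>R w)"
    obtain z where z: "0 < z" "z < s" "?\<phi> s - ?\<phi> 0 = (s - 0) * foldr line_deriv (w # vs) f (x + z *\<^sub>R w)"
      using MVT2[of 0 s ?\<phi> "\<lambda>s. foldr line_deriv (w # vs) f (x + s *\<^sub>R w)", OF _ dr]
        vs False by auto
    have "norm (x + z *\<^sub>R w) \<le> norm x + norm w"
      using z that by (intro order_trans[OF norm_triangle_ineq] add_left_mono)
        (simp add: mult_left_le_one_le)
    then have "\<bar>foldr line_deriv (w # vs) f (x + z *\<^sub>R w)\<bar> \<le> prod_list (map norm (w # vs)) * h (norm x + norm w)"
      using that S by (intro bd) (auto simp: subspace_add subspace_scale)
    moreover have "\<bar>?\<phi> s - ?\<phi> 0\<bar> \<le> \<bar>foldr line_deriv (w # vs) f (x + z *\<^sub>R w)\<bar>"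
      unfolding z(3) using that by (simp add: abs_mult mult_left_le_one_le)
    ultimately show ?thesis by simp
  qed (use h(2)[of "norm x + norm w"] in \<open>auto intro!: mult_nonneg_nonneg prod_list_nonneg\<close>)
  have taylor: "\<bar>foldr line_deriv vs f (x + w) - foldr line_deriv vs f x - foldr line_deriv (w # vs) f x\<bar>
      \<le> norm w * norm w * prod_list (map norm vs) * h (norm x + norm w)"
    if "set vs \<subseteq> S" "length vs \<le> m" "x \<in> S" "w \<in> S" for vs x w
  proof -
    note vs = that
    let ?\<phi> = "\<lambda>s. foldr line_deriv vs f (x + s *\<^sub>R w)"
    obtain z where z: "0 < z" "z < 1" "?\<phi> 1 - ?\<phi> 0 = (1 - 0) * foldr line_deriv (w # vs) f (x + z *\<^sub>R w)"
      using MVT2[of 0 1 ?\<phi> "\<lambda>s. foldr line_deriv (w # vs) f (x + s *\<^sub>R w)", OF _ dr] vs by auto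
    have "\<bar>foldr line_deriv (w # vs) f (x + z *\<^sub>R w) - foldr line_deriv (w # vs) f x\<bar>
       \<le> norm w * prod_list (map norm (w # vs)) * h (norm x + norm w)"
      using that z by (intro mvt) auto
    then show ?thesis using z(3) by (simp add: algebra_simps)
  qed
  \<comment> \<open>The factor \<open>h\<close> is bounded on the ball of radius \<open>norm x + 1\<close>.\<close>
  have small: "\<exists>\<delta>>0. \<forall>y\<in>S. norm (y - x) < \<delta> \<longrightarrow> norm (y - x) * h (norm x + norm (y - x)) \<le> \<epsilon>"
    if "x \<in> S" "0 < \<epsilon>" for x and \<epsilon> :: real
  proof -
    let ?H = "h (norm x + 1)"
    have H: "0 \<le> ?H" using h by simp
    have "norm w * h (norm x + norm w) \<le> \<epsilon>" if "norm w < min 1 (\<epsilon> / (?H + 1))" for w :: 'a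
    proof -
      have "h (norm x + norm w) \<le> ?H"
        using h(1) that by (auto simp: mono_on_def)
      then have "norm w * h (norm x + norm w) \<le> norm w * (?H + 1)"
        by (intro mult_left_mono) auto
      also have "\<dots> \<le> \<epsilon>" using that H by (simp add: field_simps)
      finally show ?thesis .
    qed
    then show ?thesis using \<open>0 < \<epsilon>\<close> H by (intro exI[of _ "min 1 (\<epsilon> / (?H + 1))"]) auto
  qed
  show ?thesis unfolding frechet_C_def
  proof (intro exI[of _ D] conjI ballI allI impI)
    fix n x assume n: "n \<le> m" and x: "x \<in> S"
    show "bounded_multilinear_on S n (D n x)"
      unfolding bounded_multilinear_on_def
    proof (intro conjI ballI allI impI exI[of _ "h (norm x)"])
      fix vs i v w r assume "vs \<in> lists S" "length vs = n" "i < n" "v \<in> S" "w \<in> S"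
      then show "D n x (vs[i := v + w]) = D n x (vs[i := v]) + D n x (vs[i := w])"
        "D n x (vs[i := r *\<^sub>R v]) = r * D n x (vs[i := v])"
        using iterated_multilinear[OF S sm, of vs i v w x r] x n by (auto simp: D_def lists_eq_set)
    next
      fix vs assume "vs \<in> lists S" "length vs = n"
      then show "\<bar>D n x vs\<bar> \<le> h (norm x) * prod_list (map norm vs)"
        using bd[of vs x "norm x"] x n by (simp add: D_def lists_eq_set mult.commute)
    qed
  next
    fix n x and \<epsilon> :: real assume n: "n < m" and x: "x \<in> S" and e: "0 < \<epsilon>"
    obtain \<delta> where \<delta>: "\<delta> > 0" and
      "\<forall>y\<in>S. norm (y - x) < \<delta> \<longrightarrow> norm (y - x) * h (norm x + norm (y - x)) \<le> \<epsilon>"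
      using small[OF x e] by blast
    then have "\<bar>D n y vs - D n x vs - D (Suc n) x ((y - x) # vs)\<bar>
                \<le> \<epsilon> * norm (y - x) * prod_list (map norm vs)"
      if "y \<in> S" "norm (y - x) < \<delta>" "vs \<in> lists S" "length vs = n" for y vs
    proof -
      have "y - x \<in> S" using S x that by (simp add: subspace_diff)
      then have "\<bar>D n y vs - D n x vs - D (Suc n) x ((y - x) # vs)\<bar>
         \<le> norm (y - x) * norm (y - x) * prod_list (map norm vs) * h (norm x + norm (y - x))"
        using taylor[of vs x "y - x"] that n x unfolding D_def by (simp add: lists_eq_set)
      also have "\<dots> = (norm (y - x) * h (norm x + norm (y - x))) * (norm (y - x) * prod_list (map norm vs))"
        by (simp add: algebra_simps)
      also have "\<dots> \<le> \<epsilon> * (norm (y - x) * prod_list (map norm vs))"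
        using that \<open>\<forall>y\<in>S. _\<close> by (intro mult_right_mono mult_nonneg_nonneg prod_list_nonneg) auto
      finally show ?thesis by (simp add: algebra_simps)
    qed
    with \<delta> show "\<exists>\<delta>>0. \<forall>y\<in>S. norm (y - x) < \<delta> \<longrightarrow>
        (\<forall>vs \<in> lists S. length vs = n \<longrightarrow>
           \<bar>D n y vs - D n x vs - D (Suc n) x ((y - x) # vs)\<bar>
             \<le> \<epsilon> * norm (y - x) * prod_list (map norm vs))" by blast
  next
    fix x and \<epsilon> :: real assume x: "x \<in> S" and e: "0 < \<epsilon>"
    obtain \<delta> where \<delta>: "\<delta> > 0" and
      "\<forall>y\<in>S. norm (y - x) < \<delta> \<longrightarrow> norm (y - x) * h (norm x + norm (y - x)) \<le> \<epsilon>"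
      using small[OF x e] by blast
    then have "\<bar>D m y vs - D m x vs\<bar> \<le> \<epsilon> * prod_list (map norm vs)"
      if "y \<in> S" "norm (y - x) < \<delta>" "vs \<in> lists S" "length vs = m" for y vs
    proof -
      have "y - x \<in> S" using S x that by (simp add: subspace_diff)
      then have "\<bar>D m y vs - D m x vs\<bar>
         \<le> norm (y - x) * prod_list (map norm vs) * h (norm x + norm (y - x))"
        using mvt[of vs x "y - x" 1] that x unfolding D_def by (simp add: lists_eq_set)
      also have "\<dots> = (norm (y - x) * h (norm x + norm (y - x))) * prod_list (map norm vs)"
        by (simp add: algebra_simps)
      also have "\<dots> \<le> \<epsilon> * prod_list (map norm vs)"
        using that \<open>\<forall>y\<in>S. _\<close> by (intro mult_right_mono prod_list_nonneg) auto
      finally show ?thesis .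
    qed
    with \<delta> show "\<exists>\<delta>>0. \<forall>y\<in>S. norm (y - x) < \<delta> \<longrightarrow>
        (\<forall>vs \<in> lists S. length vs = m \<longrightarrow> \<bar>D m y vs - D m x vs\<bar> \<le> \<epsilon> * prod_list (map norm vs))"
      by blast
  qed (simp add: D_def)
qed

definition smooth_fun :: "'a::real_normed_vector set \<Rightarrow> ('a \<Rightarrow> real) \<Rightarrow> bool" where
  "smooth_fun S f \<longleftrightarrow> (\<forall>n. \<exists>h. mono_on {0..} h \<and> (\<forall>r\<ge>0. 0 \<le> h r) \<and> smooth_bd S n h f)"

lemma smooth_fun_const: "smooth_fun S (\<lambda>x. c)"
  unfolding smooth_fun_def
  by (intro allI exI[of _ "\<lambda>r. \<bar>c\<bar>"] conjI smooth_bd_const) (auto simp: mono_on_def)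

lemma smooth_fun_add:
  assumes "smooth_fun S f" "smooth_fun S g"
  shows "smooth_fun S (\<lambda>x. f x + g x)"
  unfolding smooth_fun_def
proof
  fix n
  obtain h where h: "mono_on {0..} h" "\<And>r. 0 \<le> r \<Longrightarrow> 0 \<le> h r" "smooth_bd S n h f"
    using assms(1) unfolding smooth_fun_def by blast
  obtain k where k: "mono_on {0..} k" "\<And>r. 0 \<le> r \<Longrightarrow> 0 \<le> k r" "smooth_bd S n k g"
    using assms(2) unfolding smooth_fun_def by blast
  have "mono_on {0..} (\<lambda>r. h r + k r)"
    using h(1,2) k(1,2) by (auto simp: mono_on_def intro!: add_mono mult_mono)
  moreover have "\<forall>r\<ge>0. 0 \<le> h r + k r" using h(2) k(2) by simp
  ultimately show "\<exists>h. mono_on {0..} h \<and> (\<forall>r\<ge>0. 0 \<le> h r) \<and> smooth_bd S n h (\<lambda>x. f x + g x)"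
    using smooth_bd_add[OF h(3) k(3)] by blast
qed

lemma smooth_fun_mult:
  assumes "smooth_fun S f" "smooth_fun S g"
  shows "smooth_fun S (\<lambda>x. f x * g x)"
  unfolding smooth_fun_def
proof
  fix n
  obtain h where h: "mono_on {0..} h" "\<And>r. 0 \<le> r \<Longrightarrow> 0 \<le> h r" "smooth_bd S n h f"
    using assms(1) unfolding smooth_fun_def by blast
  obtain k where k: "mono_on {0..} k" "\<And>r. 0 \<le> r \<Longrightarrow> 0 \<le> k r" "smooth_bd S n k g"
    using assms(2) unfolding smooth_fun_def by blast
  have "mono_on {0..} (\<lambda>r. 2 ^ n * (h r * k r))"
    using h(1,2) k(1,2) by (auto simp: mono_on_def intro!: add_mono mult_mono)
  moreover have "\<forall>r\<ge>0. 0 \<le> 2 ^ n * (h r * k r)" using h(2) k(2) by simp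
  ultimately show "\<exists>h. mono_on {0..} h \<and> (\<forall>r\<ge>0. 0 \<le> h r) \<and> smooth_bd S n h (\<lambda>x. f x * g x)"
    using smooth_bd_mult[OF h(3) k(3) h(2) k(2)] by blast
qed

lemma smooth_fun_linear:
  assumes "subspace S"
    and "\<And>x y. x \<in> S \<Longrightarrow> y \<in> S \<Longrightarrow> L (x + y) = L x + L y"
    and "\<And>r x. x \<in> S \<Longrightarrow> L (r *\<^sub>R x) = r * L x"
    and "\<And>x. x \<in> S \<Longrightarrow> \<bar>L x\<bar> \<le> K * norm x" and "0 \<le> K"
  shows "smooth_fun S L"
  unfolding smooth_fun_def
  by (intro allI exI[of _ "\<lambda>r. K * (1 + r)"] conjI smooth_bd_linear assms)
     (use \<open>0 \<le> K\<close> in \<open>auto simp: mono_on_def intro: mult_left_mono\<close>)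

lemma smooth_fun_quadratic:
  assumes "subspace S"
    and "\<And>x y z. x \<in> S \<Longrightarrow> y \<in> S \<Longrightarrow> z \<in> S \<Longrightarrow> B (x + y) z = B x z + B y z"
    and "\<And>r x z. x \<in> S \<Longrightarrow> z \<in> S \<Longrightarrow> B (r *\<^sub>R x) z = r * B x z"
    and "\<And>x z. x \<in> S \<Longrightarrow> z \<in> S \<Longrightarrow> B x z = B z x"
    and "\<And>x z. x \<in> S \<Longrightarrow> z \<in> S \<Longrightarrow> \<bar>B x z\<bar> \<le> K * norm x * norm z" and "0 \<le> K"
  shows "smooth_fun S (\<lambda>x. 1/2 * B x x)"
  unfolding smooth_fun_def
  by (intro allI exI[of _ "\<lambda>r. K * (1 + r)^2"] conjI smooth_bd_quadratic assms)
     (use \<open>0 \<le> K\<close> in \<open>auto simp: mono_on_def intro!: mult_left_mono power_mono\<close>)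

lemma smooth_fun_frechet_C: "subspace S \<Longrightarrow> smooth_fun S f \<Longrightarrow> frechet_C S m f"
  unfolding smooth_fun_def by (rule smooth_bd_imp_frechet_C) auto

section \<open>Cylinder polynomials\<close>

lemma subspace_linf: "subspace (linf d)"
  by (auto simp: subspace_def linf_def)

lemma coord_le_norm: "\<bar>apply_bcontfun x p\<bar> \<le> norm (x :: seqs)"
  using norm_bounded[of x p] by simp

text \<open>
  Polynomials in the time and in the coordinates of the entries with index in \<open>S\<close>. As an inductive set of functions
  they inherit all closure properties by induction.
\<close>

inductive cyl :: "int set \<Rightarrow> (real \<Rightarrow> seqs \<Rightarrow> real) \<Rightarrow> bool" for S where
  cyl_const: "cyl S (\<lambda>t x. c)"
| cyl_time: "cyl S (\<lambda>t x. t)"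
| cyl_coord: "j \<in> S \<Longrightarrow> cyl S (\<lambda>t x. apply_bcontfun x (j, a))"
| cyl_add: "cyl S \<phi> \<Longrightarrow> cyl S \<psi> \<Longrightarrow> cyl S (\<lambda>t x. \<phi> t x + \<psi> t x)"
| cyl_mult: "cyl S \<phi> \<Longrightarrow> cyl S \<psi> \<Longrightarrow> cyl S (\<lambda>t x. \<phi> t x * \<psi> t x)"

lemma cyl_mono: "cyl S \<phi> \<Longrightarrow> S \<subseteq> S' \<Longrightarrow> cyl S' \<phi>"
  by (induction rule: cyl.induct) (auto intro: cyl.intros)

lemma cyl_diff:
  assumes "cyl S \<phi>" "cyl S \<psi>"
  shows "cyl S (\<lambda>t x. \<phi> t x - \<psi> t x)"
  using cyl_add[OF assms(1) cyl_mult[OF cyl_const[of S "-1"] assms(2)]] by simp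

lemma cyl_power: "cyl S \<phi> \<Longrightarrow> cyl S (\<lambda>t x. \<phi> t x ^ n)"
  by (induction n) (auto intro: cyl.intros)

lemma cyl_sum: "(\<And>k. k \<in> A \<Longrightarrow> cyl S (\<phi> k)) \<Longrightarrow> cyl S (\<lambda>t x. \<Sum>k\<in>A. \<phi> k t x)"
proof (induction A rule: infinite_finite_induct)
  case (insert k A)
  then have "cyl S (\<lambda>t x. \<phi> k t x + (\<Sum>k\<in>A. \<phi> k t x))" by (intro cyl_add) auto
  with insert show ?case by simp
qed (auto intro: cyl_const)

lemma cyl_bounded:
  "cyl S \<phi> \<Longrightarrow> \<exists>K\<ge>0. \<forall>t\<in>{0..T}. \<forall>x. norm x \<le> R \<longrightarrow> \<bar>\<phi> t x\<bar> \<le> K"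
proof (induction rule: cyl.induct)
  case (cyl_const c)
  then show ?case by (intro exI[of _ "\<bar>c\<bar>"]) auto
next
  case cyl_time
  then show ?case by (intro exI[of _ "\<bar>T\<bar>"]) auto
next
  case (cyl_coord j a)
  have "\<bar>apply_bcontfun x (j, a)\<bar> \<le> \<bar>R\<bar>" if "norm x \<le> R" for x :: seqs
    using coord_le_norm[of x "(j, a)"] that by simp
  then show ?case by (intro exI[of _ "\<bar>R\<bar>"]) auto
next
  case (cyl_add \<phi> \<psi>)
  then obtain K L where "K \<ge> 0" "\<forall>t\<in>{0..T}. \<forall>x. norm x \<le> R \<longrightarrow> \<bar>\<phi> t x\<bar> \<le> K"
    "L \<ge> 0" "\<forall>t\<in>{0..T}. \<forall>x. norm x \<le> R \<longrightarrow> \<bar>\<psi> t x\<bar> \<le> L" by auto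
  then show ?case by (intro exI[of _ "K + L"]) (auto intro!: order_trans[OF abs_triangle_ineq] add_mono)
next
  case (cyl_mult \<phi> \<psi>)
  then obtain K L where "K \<ge> 0" "\<forall>t\<in>{0..T}. \<forall>x. norm x \<le> R \<longrightarrow> \<bar>\<phi> t x\<bar> \<le> K"
    "L \<ge> 0" "\<forall>t\<in>{0..T}. \<forall>x. norm x \<le> R \<longrightarrow> \<bar>\<psi> t x\<bar> \<le> L" by auto
  then show ?case by (intro exI[of _ "K * L"]) (auto simp: abs_mult intro!: mult_mono)
qed

lemma cyl_has_pderiv:
  "cyl S \<phi> \<Longrightarrow> \<exists>\<psi>. cyl S \<psi> \<and> (\<forall>t x. ((\<lambda>s. \<phi> t (x + s *\<^sub>R unit_seq j a)) has_real_derivative \<psi> t x) (at 0))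
     \<and> (j \<notin> S \<longrightarrow> \<psi> = (\<lambda>t x. 0))"
proof (induction rule: cyl.induct)
  case (cyl_const c)
  then show ?case by (intro exI[of _ "\<lambda>t x. 0"]) (auto intro: cyl.intros)
next
  case cyl_time
  then show ?case by (intro exI[of _ "\<lambda>t x. 0"]) (auto intro: cyl.intros)
next
  case (cyl_coord k b)
  show ?case
    by (rule exI[of _ "\<lambda>t x. if (k, b) = (j, a) then 1 else 0"])
       (use cyl_coord in \<open>auto intro!: cyl.intros derivative_eq_intros simp: apply_unit_seq\<close>)
next
  case (cyl_add \<phi> \<psi>)
  then obtain \<phi>' \<psi>' where
    "cyl S \<phi>'" "\<forall>t x. ((\<lambda>s. \<phi> t (x + s *\<^sub>R unit_seq j a)) has_real_derivative \<phi>' t x) (at 0)"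
    "j \<notin> S \<longrightarrow> \<phi>' = (\<lambda>t x. 0)"
    "cyl S \<psi>'" "\<forall>t x. ((\<lambda>s. \<psi> t (x + s *\<^sub>R unit_seq j a)) has_real_derivative \<psi>' t x) (at 0)"
    "j \<notin> S \<longrightarrow> \<psi>' = (\<lambda>t x. 0)" by auto
  then show ?case
    by (intro exI[of _ "\<lambda>t x. \<phi>' t x + \<psi>' t x"]) (auto intro!: cyl.intros derivative_eq_intros)
next
  case (cyl_mult \<phi> \<psi>)
  then obtain \<phi>' \<psi>' where
    "cyl S \<phi>'" "\<forall>t x. ((\<lambda>s. \<phi> t (x + s *\<^sub>R unit_seq j a)) has_real_derivative \<phi>' t x) (at 0)"
    "j \<notin> S \<longrightarrow> \<phi>' = (\<lambda>t x. 0)"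
    "cyl S \<psi>'" "\<forall>t x. ((\<lambda>s. \<psi> t (x + s *\<^sub>R unit_seq j a)) has_real_derivative \<psi>' t x) (at 0)"
    "j \<notin> S \<longrightarrow> \<psi>' = (\<lambda>t x. 0)" by auto
  with cyl_mult show ?case
    by (intro exI[of _ "\<lambda>t x. \<phi>' t x * \<psi> t x + \<phi> t x * \<psi>' t x"])
       (auto intro!: cyl.intros derivative_eq_intros)
qed

text \<open>
  A cylinder polynomial over \<open>S\<close> does not depend on the entries outside \<open>S\<close>; this is what makes
  players outside the set used so far invisible to the equations treated so far.
\<close>

lemma cyl_pderiv_seq:
  assumes "cyl S \<phi>"
  shows "cyl S (\<lambda>t. pderiv_seq j a (\<phi> t))"
    and "((\<lambda>s. \<phi> t (x + s *\<^sub>R unit_seq j a)) has_real_derivative pderiv_seq j a (\<phi> t) x) (at 0)"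
    and "j \<notin> S \<Longrightarrow> pderiv_seq j a (\<phi> t) x = 0"
proof -
  obtain \<psi> where \<psi>: "cyl S \<psi>"
    "\<And>t x. ((\<lambda>s. \<phi> t (x + s *\<^sub>R unit_seq j a)) has_real_derivative \<psi> t x) (at 0)"
    "j \<notin> S \<longrightarrow> \<psi> = (\<lambda>t x. 0)"
    using cyl_has_pderiv[OF assms] by blast
  have eq: "pderiv_seq j a (\<phi> t) = \<psi> t" for t
    unfolding pderiv_seq_def using \<psi>(2) by (auto intro!: ext DERIV_imp_deriv)
  show "cyl S (\<lambda>t. pderiv_seq j a (\<phi> t))"
    "((\<lambda>s. \<phi> t (x + s *\<^sub>R unit_seq j a)) has_real_derivative pderiv_seq j a (\<phi> t) x) (at 0)"
    "j \<notin> S \<Longrightarrow> pderiv_seq j a (\<phi> t) x = 0"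
    using \<psi> by (auto simp: eq)
qed

lemma entry_laplacian_cyl: "cyl S \<phi> \<Longrightarrow> cyl S (\<lambda>t. entry_laplacian d j (\<phi> t))"
  unfolding entry_laplacian_def by (intro cyl_sum cyl_pderiv_seq)

lemma cyl_laplacian_outside:
  assumes "cyl S \<phi>" "j \<notin> S"
  shows "entry_laplacian d j (\<phi> t) x = 0"
proof -
  have "pderiv_seq j a (\<phi> t) = (\<lambda>x. 0)" for a using cyl_pderiv_seq(3)[OF assms] by auto
  then have "pderiv_seq j a (pderiv_seq j a (\<phi> t)) x = 0" for a by (simp add: pderiv_seq_def)
  then show ?thesis by (simp add: entry_laplacian_def)
qed

lemma cyl_has_tderiv:
  "cyl S \<phi> \<Longrightarrow> \<exists>\<psi>. cyl S \<psi> \<and> (\<forall>t x. ((\<lambda>s. \<phi> s x) has_real_derivative \<psi> t x) (at t))"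
proof (induction rule: cyl.induct)
  case (cyl_const c)
  then show ?case by (intro exI[of _ "\<lambda>t x. 0"]) (auto intro: cyl.intros)
next
  case cyl_time
  then show ?case by (intro exI[of _ "\<lambda>t x. 1"]) (auto intro: cyl.intros)
next
  case (cyl_coord k b)
  show ?case by (intro exI[of _ "\<lambda>t x. 0"]) (auto intro: cyl.intros)
next
  case (cyl_add \<phi> \<psi>)
  then obtain \<phi>' \<psi>' where
    "cyl S \<phi>'" "\<forall>t x. ((\<lambda>s. \<phi> s x) has_real_derivative \<phi>' t x) (at t)"
    "cyl S \<psi>'" "\<forall>t x. ((\<lambda>s. \<psi> s x) has_real_derivative \<psi>' t x) (at t)" by auto
  then show ?case
    by (intro exI[of _ "\<lambda>t x. \<phi>' t x + \<psi>' t x"]) (auto intro!: cyl.intros derivative_eq_intros)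
next
  case (cyl_mult \<phi> \<psi>)
  then obtain \<phi>' \<psi>' where
    "cyl S \<phi>'" "\<forall>t x. ((\<lambda>s. \<phi> s x) has_real_derivative \<phi>' t x) (at t)"
    "cyl S \<psi>'" "\<forall>t x. ((\<lambda>s. \<psi> s x) has_real_derivative \<psi>' t x) (at t)" by auto
  with cyl_mult show ?case
    by (intro exI[of _ "\<lambda>t x. \<phi>' t x * \<psi> t x + \<phi> t x * \<psi>' t x"])
       (auto intro!: cyl.intros derivative_eq_intros)
qed

lemma cyl_tderiv:
  assumes "cyl S \<phi>"
  shows "cyl S (\<lambda>t x. deriv (\<lambda>s. \<phi> s x) t)"
    and "((\<lambda>s. \<phi> s x) has_real_derivative deriv (\<lambda>s. \<phi> s x) t) (at t)"
proof -
  obtain \<psi> where \<psi>: "cyl S \<psi>" "\<And>t x. ((\<lambda>s. \<phi> s x) has_real_derivative \<psi> t x) (at t)"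
    using cyl_has_tderiv[OF assms] by blast
  have eq: "deriv (\<lambda>s. \<phi> s x) t = \<psi> t x" for t x
    using \<psi>(2) by (auto intro!: DERIV_imp_deriv)
  show "cyl S (\<lambda>t x. deriv (\<lambda>s. \<phi> s x) t)"
    "((\<lambda>s. \<phi> s x) has_real_derivative deriv (\<lambda>s. \<phi> s x) t) (at t)"
    using \<psi> by (auto simp: eq)
qed

lemma cyl_continuous_time: "cyl S \<phi> \<Longrightarrow> continuous_on A (\<lambda>t. \<phi> t x)"
  using cyl_tderiv(2) DERIV_isCont by (blast intro: continuous_at_imp_continuous_on)

lemma cyl_infinitely_differentiable:
  assumes "cyl S \<phi>"
  shows "infinitely_differentiable_on I (\<lambda>t. \<phi> t x)"
proof -
  define p where "p n = ((\<lambda>\<phi> t x. deriv (\<lambda>s. \<phi> s x) t) ^^ n) \<phi>" for n :: nat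
  have "cyl S (p n)" for n
    by (induction n) (use assms cyl_tderiv(1) in \<open>auto simp: p_def\<close>)
  then have "((\<lambda>s. p n s x) has_real_derivative p (Suc n) t x) (at t)" for n t
    using cyl_tderiv(2)[of S "p n" x t] by (simp add: p_def)
  then show ?thesis unfolding infinitely_differentiable_on_def
    by (intro exI[of _ "\<lambda>n t. p n t x"]) (auto simp: p_def intro: has_field_derivative_at_within)
qed

lemma cyl_smooth_fun: "cyl S \<phi> \<Longrightarrow> smooth_fun (linf d) (\<phi> t)"
proof (induction rule: cyl.induct)
  case (cyl_coord j a)
  show ?case
    by (rule smooth_fun_linear[OF subspace_linf, of _ _ 1])
       (auto simp: coord_le_norm)
qed (auto intro: smooth_fun_const smooth_fun_add smooth_fun_mult)

text \<open>
  A polynomial that vanishes at \<open>t = T\<close> is divisible by \<open>T - t\<close>, also within cylinder polynomials.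
\<close>

lemma cyl_divide_time:
  "cyl S \<phi> \<Longrightarrow> \<exists>\<psi>. cyl S \<psi> \<and> (\<forall>t x. \<phi> t x - \<phi> T x = (T - t) * \<psi> t x)"
proof (induction rule: cyl.induct)
  case (cyl_const c)
  then show ?case by (intro exI[of _ "\<lambda>t x. 0"]) (auto intro: cyl.intros)
next
  case cyl_time
  then show ?case by (intro exI[of _ "\<lambda>t x. -1"]) (auto intro: cyl.intros)
next
  case (cyl_coord k b)
  show ?case by (intro exI[of _ "\<lambda>t x. 0"]) (auto intro: cyl.intros)
next
  case (cyl_add \<phi> \<psi>)
  then obtain \<phi>' \<psi>' where
    "cyl S \<phi>'" "\<forall>t x. \<phi> t x - \<phi> T x = (T - t) * \<phi>' t x"
    "cyl S \<psi>'" "\<forall>t x. \<psi> t x - \<psi> T x = (T - t) * \<psi>' t x" by auto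
  then show ?case
    by (intro exI[of _ "\<lambda>t x. \<phi>' t x + \<psi>' t x"]) (auto intro!: cyl.intros simp: algebra_simps)
next
  case (cyl_mult \<phi> \<psi>)
  then obtain \<phi>' \<psi>' where
    1: "cyl S \<phi>'" "\<forall>t x. \<phi> t x - \<phi> T x = (T - t) * \<phi>' t x"
    "cyl S \<psi>'" "\<forall>t x. \<psi> t x - \<psi> T x = (T - t) * \<psi>' t x" by auto
  have "\<phi> t x * \<psi> t x - \<phi> T x * \<psi> T x = (T - t) * (\<phi>' t x * \<psi> t x + (\<phi> t x + (t - T) * \<phi>' t x) * \<psi>' t x)" for t x
  proof -
    have e: "\<phi> T x = \<phi> t x - (T - t) * \<phi>' t x" "\<psi> T x = \<psi> t x - (T - t) * \<psi>' t x"
      using 1(2)[rule_format, of t x] 1(4)[rule_format, of t x] by linarith+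
    show ?thesis unfolding e by (simp add: algebra_simps)
  qed
  with 1 cyl_mult show ?case
    by (intro exI[of _ "\<lambda>t x. \<phi>' t x * \<psi> t x + (\<phi> t x + (t - T) * \<phi>' t x) * \<psi>' t x"])
       (auto intro!: cyl.intros cyl_diff)
qed

section \<open>Functions approximable by cylinder polynomials\<close>

text \<open>
  The closure of the cylinder polynomials under uniform convergence on bounded sets. Residuals belong to this
  class, although their coefficients are merely continuous in time and involve infinitely many
  coordinates.
\<close>

definition appr :: "real \<Rightarrow> nat \<Rightarrow> (real \<Rightarrow> seqs \<Rightarrow> real) \<Rightarrow> bool" where
  "appr T d \<phi> \<longleftrightarrow> (\<forall>R. \<forall>e>0. \<exists>S P. finite S \<and> cyl S P \<and>
     (\<forall>t\<in>{0..T}. \<forall>x\<in>linf d. norm x \<le> R \<longrightarrow> \<bar>\<phi> t x - P t x\<bar> \<le> e))"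

lemma apprD:
  assumes "appr T d \<phi>" "0 < e"
  obtains S P where "finite S" "cyl S P"
    "\<And>t x. t \<in> {0..T} \<Longrightarrow> x \<in> linf d \<Longrightarrow> norm x \<le> R \<Longrightarrow> \<bar>\<phi> t x - P t x\<bar> \<le> e"
  using assms unfolding appr_def by meson

lemma cyl_appr: "finite S \<Longrightarrow> cyl S \<phi> \<Longrightarrow> appr T d \<phi>"
  unfolding appr_def by (intro allI impI exI[of _ S] exI[of _ \<phi>]) auto

lemma appr_bounded:
  assumes "appr T d \<phi>"
  shows "\<exists>K\<ge>0. \<forall>t\<in>{0..T}. \<forall>x\<in>linf d. norm x \<le> R \<longrightarrow> \<bar>\<phi> t x\<bar> \<le> K"
proof -
  obtain S P where P: "finite S" "cyl S P"
    "\<And>t x. t \<in> {0..T} \<Longrightarrow> x \<in> linf d \<Longrightarrow> norm x \<le> R \<Longrightarrow> \<bar>\<phi> t x - P t x\<bar> \<le> 1"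
    using apprD[OF assms zero_less_one] by metis
  obtain K where K: "K \<ge> 0" "\<forall>t\<in>{0..T}. \<forall>x. norm x \<le> R \<longrightarrow> \<bar>P t x\<bar> \<le> K"
    using cyl_bounded[OF P(2)] by blast
  have "\<bar>\<phi> t x\<bar> \<le> K + 1" if "t \<in> {0..T}" "x \<in> linf d" "norm x \<le> R" for t x
    using P(3)[OF that] K(2)[rule_format, OF that(1,3)] by linarith
  with K(1) show ?thesis by (intro exI[of _ "K + 1"]) auto
qed

lemma appr_limit:
  assumes "\<And>R e. 0 < e \<Longrightarrow> \<exists>\<psi>. appr T d \<psi> \<and>
     (\<forall>t\<in>{0..T}. \<forall>x\<in>linf d. norm x \<le> R \<longrightarrow> \<bar>\<phi> t x - \<psi> t x\<bar> \<le> e)"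
  shows "appr T d \<phi>"
  unfolding appr_def
proof (intro allI impI)
  fix R e :: real assume e: "0 < e"
  then obtain \<psi> where \<psi>: "appr T d \<psi>"
    "\<And>t x. t\<in>{0..T} \<Longrightarrow> x\<in>linf d \<Longrightarrow> norm x \<le> R \<Longrightarrow> \<bar>\<phi> t x - \<psi> t x\<bar> \<le> e/2"
    using assms[of "e/2" R] by auto
  obtain S P where P: "finite S" "cyl S P"
    "\<And>t x. t \<in> {0..T} \<Longrightarrow> x \<in> linf d \<Longrightarrow> norm x \<le> R \<Longrightarrow> \<bar>\<psi> t x - P t x\<bar> \<le> e/2"
    using apprD[OF \<psi>(1), of "e/2"] e by (metis half_gt_zero)
  have "\<bar>\<phi> t x - P t x\<bar> \<le> e" if "t\<in>{0..T}" "x\<in>linf d" "norm x \<le> R" for t x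
    using P(3)[OF that] \<psi>(2)[OF that] by linarith
  with P show "\<exists>S P. finite S \<and> cyl S P \<and> (\<forall>t\<in>{0..T}. \<forall>x\<in>linf d. norm x \<le> R \<longrightarrow> \<bar>\<phi> t x - P t x\<bar> \<le> e)"
    by blast
qed

lemma appr_add:
  assumes "appr T d \<phi>" "appr T d \<psi>"
  shows "appr T d (\<lambda>t x. \<phi> t x + \<psi> t x)"
  unfolding appr_def
proof (intro allI impI)
  fix R e :: real assume e: "0 < e"
  obtain S P where P: "finite S" "cyl S P"
    "\<And>t x. t \<in> {0..T} \<Longrightarrow> x \<in> linf d \<Longrightarrow> norm x \<le> R \<Longrightarrow> \<bar>\<phi> t x - P t x\<bar> \<le> e/2"
    using apprD[OF assms(1), of "e/2"] e by (metis half_gt_zero)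
  obtain S' P' where P': "finite S'" "cyl S' P'"
    "\<And>t x. t \<in> {0..T} \<Longrightarrow> x \<in> linf d \<Longrightarrow> norm x \<le> R \<Longrightarrow> \<bar>\<psi> t x - P' t x\<bar> \<le> e/2"
    using apprD[OF assms(2), of "e/2"] e by (metis half_gt_zero)
  have "\<bar>\<phi> t x + \<psi> t x - (P t x + P' t x)\<bar> \<le> e" if "t\<in>{0..T}" "x\<in>linf d" "norm x \<le> R" for t x
    using P(3)[OF that] P'(3)[OF that] by linarith
  moreover have "cyl (S \<union> S') (\<lambda>t x. P t x + P' t x)"
    using P(2) P'(2) by (intro cyl_add) (auto intro: cyl_mono)
  ultimately show "\<exists>S P. finite S \<and> cyl S P \<and>
      (\<forall>t\<in>{0..T}. \<forall>x\<in>linf d. norm x \<le> R \<longrightarrow> \<bar>\<phi> t x + \<psi> t x - P t x\<bar> \<le> e)"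
    using P(1) P'(1) by (intro exI[of _ "S \<union> S'"] exI[of _ "\<lambda>t x. P t x + P' t x"]) auto
qed

lemma appr_mult:
  assumes "appr T d \<phi>" "appr T d \<psi>"
  shows "appr T d (\<lambda>t x. \<phi> t x * \<psi> t x)"
  unfolding appr_def
proof (intro allI impI)
  fix R e :: real assume e: "0 < e"
  obtain K where K: "K \<ge> 0" "\<forall>t\<in>{0..T}. \<forall>x\<in>linf d. norm x \<le> R \<longrightarrow> \<bar>\<phi> t x\<bar> \<le> K"
    using appr_bounded[OF assms(1)] by blast
  have "0 < e / (2 * (K + 1))" using e K by simp
  then obtain S' P' where P': "finite S'" "cyl S' P'"
    "\<And>t x. t \<in> {0..T} \<Longrightarrow> x \<in> linf d \<Longrightarrow> norm x \<le> R \<Longrightarrow> \<bar>\<psi> t x - P' t x\<bar> \<le> e / (2 * (K + 1))"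
    using apprD[OF assms(2)] by metis
  obtain L where L: "L \<ge> 0" "\<forall>t\<in>{0..T}. \<forall>x. norm x \<le> R \<longrightarrow> \<bar>P' t x\<bar> \<le> L"
    using cyl_bounded[OF P'(2)] by blast
  have "0 < e / (2 * (L + 1))" using e L by simp
  then obtain S P where P: "finite S" "cyl S P"
    "\<And>t x. t \<in> {0..T} \<Longrightarrow> x \<in> linf d \<Longrightarrow> norm x \<le> R \<Longrightarrow> \<bar>\<phi> t x - P t x\<bar> \<le> e / (2 * (L + 1))"
    using apprD[OF assms(1)] by metis
  have "\<bar>\<phi> t x * \<psi> t x - P t x * P' t x\<bar> \<le> e" if "t\<in>{0..T}" "x\<in>linf d" "norm x \<le> R" for t x
  proof -
    have "\<phi> t x * \<psi> t x - P t x * P' t x = \<phi> t x * (\<psi> t x - P' t x) + (\<phi> t x - P t x) * P' t x"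
      by (simp add: algebra_simps)
    then have "\<bar>\<phi> t x * \<psi> t x - P t x * P' t x\<bar>
        \<le> \<bar>\<phi> t x\<bar> * \<bar>\<psi> t x - P' t x\<bar> + \<bar>\<phi> t x - P t x\<bar> * \<bar>P' t x\<bar>"
      by (metis abs_mult abs_triangle_ineq)
    also have "\<dots> \<le> K * (e / (2 * (K + 1))) + e / (2 * (L + 1)) * L"
      using P(3)[OF that] P'(3)[OF that] K L that e by (intro add_mono mult_mono) auto
    also have "\<dots> \<le> e/2 + e/2"
      using K(1) L(1) e by (intro add_mono) (auto simp: field_simps)
    finally show ?thesis by simp
  qed
  moreover have "cyl (S \<union> S') (\<lambda>t x. P t x * P' t x)"
    using P(2) P'(2) by (intro cyl_mult) (auto intro: cyl_mono)
  ultimately show "\<exists>S P. finite S \<and> cyl S P \<and>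
      (\<forall>t\<in>{0..T}. \<forall>x\<in>linf d. norm x \<le> R \<longrightarrow> \<bar>\<phi> t x * \<psi> t x - P t x\<bar> \<le> e)"
    using P(1) P'(1) by (intro exI[of _ "S \<union> S'"] exI[of _ "\<lambda>t x. P t x * P' t x"]) auto
qed

lemma appr_const: "appr T d (\<lambda>t x. c)"
  using cyl_appr[of "{}"] cyl_const by blast

lemma appr_diff:
  assumes "appr T d \<phi>" "appr T d \<psi>"
  shows "appr T d (\<lambda>t x. \<phi> t x - \<psi> t x)"
  using appr_add[OF assms(1) appr_mult[OF appr_const[of T d "-1"] assms(2)]] by simp

lemma appr_sum: "(\<And>k. k \<in> A \<Longrightarrow> appr T d (\<phi> k)) \<Longrightarrow> appr T d (\<lambda>t x. \<Sum>k\<in>A. \<phi> k t x)"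
proof (induction A rule: infinite_finite_induct)
  case (insert k A)
  then have "appr T d (\<lambda>t x. \<phi> k t x + (\<Sum>k\<in>A. \<phi> k t x))" by (intro appr_add) auto
  with insert show ?case by simp
qed (auto intro: appr_const)

lemma appr_coord: "appr T d (\<lambda>t x. apply_bcontfun x (j, a))"
  using cyl_appr[of "{j}"] cyl_coord by blast

lemma appr_infsum:
  assumes "\<And>k. appr T d (\<phi> k)"
    and "\<And>R. \<exists>M. M summable_on UNIV \<and>
      (\<forall>k. \<forall>t\<in>{0..T}. \<forall>x\<in>linf d. norm x \<le> R \<longrightarrow> \<bar>\<phi> k t x\<bar> \<le> M k)"
  shows "appr T d (\<lambda>t x. \<Sum>\<^sub>\<infinity>k. \<phi> k t x)"
proof (rule appr_limit)
  fix R e :: real assume e: "0 < e"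
  obtain M where M: "M summable_on UNIV"
    "\<forall>k. \<forall>t\<in>{0..T}. \<forall>x\<in>linf d. norm x \<le> R \<longrightarrow> \<bar>\<phi> k t x\<bar> \<le> M k"
    using assms(2) by blast
  define Y where "Y = {(t, x). t \<in> {0..T} \<and> x \<in> linf d \<and> norm x \<le> R}"
  have "uniform_limit Y (\<lambda>X y. \<Sum>k\<in>X. (\<lambda>(t, x). \<phi> k t x) y)
     (\<lambda>y. \<Sum>\<^sub>\<infinity>k. (\<lambda>(t, x). \<phi> k t x) y) (finite_subsets_at_top UNIV)"
    by (rule Weierstrass_m_test_general[OF _ M(1)]) (use M(2) in \<open>auto simp: Y_def\<close>)
  from uniform_limitD[OF this e] have "\<forall>\<^sub>F X in finite_subsets_at_top UNIV. \<forall>y\<in>Y.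
     dist (\<Sum>k\<in>X. (\<lambda>(t, x). \<phi> k t x) y) (\<Sum>\<^sub>\<infinity>k. (\<lambda>(t, x). \<phi> k t x) y) < e" .
  then obtain X where X: "\<forall>y\<in>Y. dist (\<Sum>k\<in>X. (\<lambda>(t, x). \<phi> k t x) y) (\<Sum>\<^sub>\<infinity>k. (\<lambda>(t, x). \<phi> k t x) y) < e"
    using eventually_happens'[OF finite_subsets_at_top_neq_bot] by blast
  have "\<bar>(\<Sum>\<^sub>\<infinity>k. \<phi> k t x) - (\<Sum>k\<in>X. \<phi> k t x)\<bar> \<le> e" if "t\<in>{0..T}" "x\<in>linf d" "norm x \<le> R" for t x
    using bspec[OF X, of "(t, x)"] that by (simp add: Y_def dist_real_def abs_minus_commute)
  then show "\<exists>\<psi>. appr T d \<psi> \<and>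
     (\<forall>t\<in>{0..T}. \<forall>x\<in>linf d. norm x \<le> R \<longrightarrow> \<bar>(\<Sum>\<^sub>\<infinity>k. \<phi> k t x) - \<psi> t x\<bar> \<le> e)"
    using appr_sum[of X T d \<phi>] assms(1) by blast
qed

text \<open>
  This is the Weierstrass approximation theorem, and the only place where the data are made smooth in
  time.
\<close>

lemma appr_continuous:
  assumes "continuous_on {0..T} a"
  shows "appr T d (\<lambda>t x. a t)"
proof (rule appr_limit)
  fix R e :: real assume "0 < e"
  then obtain p where p: "real_polynomial_function p" "\<And>t. t \<in> {0..T} \<Longrightarrow> \<bar>a t - p t\<bar> < e"
    using Stone_Weierstrass_real_polynomial_function[OF compact_Icc assms] by auto
  then obtain c n where "p = (\<lambda>t. \<Sum>i\<le>n. c i * t ^ i)"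
    by (auto simp: real_polynomial_function_iff_sum)
  then have "cyl {} (\<lambda>t x. p t)" by (auto intro!: cyl_sum cyl.intros cyl_power)
  then show "\<exists>\<psi>. appr T d \<psi> \<and> (\<forall>t\<in>{0..T}. \<forall>x\<in>linf d. norm x \<le> R \<longrightarrow> \<bar>a t - \<psi> t x\<bar> \<le> e)"
    using p(2) cyl_appr[of "{}"] by (intro exI[of _ "\<lambda>t x. p t"]) (auto intro: less_imp_le)
qed

text \<open>
  With \<open>y = t / T\<close>, the function \<open>1 - y\<^sup>N\<close> is divisible by \<open>1 - y\<close>, and multiplying \<open>1 - y\<close> by its cube
  gives a multiple of \<open>(1 - y)\<^sup>4\<close>. In units of \<open>T\<close> the error is at most \<open>3 (1 - y) y\<^sup>N\<close>, which is at most \<open>3 / N\<close> because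
  \<open>N y\<^sup>N\<close> is below the geometric sum \<open>\<Sum>\<^sub>k\<^sub><\<^sub>N y\<^sup>k\<close>.
\<close>

lemma time_flattening:
  assumes T: "0 < T" and e: "0 < e"
  obtains q where "cyl {} (\<lambda>t x. q t)" "\<And>t. t \<in> {0..T} \<Longrightarrow> \<bar>(T - t) - (T - t)^4 * q t\<bar> \<le> e"
proof -
  obtain N :: nat where N: "3 * T / e < real N" using reals_Archimedean2 by blast
  define \<sigma> where "\<sigma> t = (\<Sum>k<N. (t * (1 / T)) ^ k)" for t
  define q where "q t = \<sigma> t ^ 3 * (1 / T ^ 3)" for t
  have "cyl {} (\<lambda>t x. q t)" unfolding q_def \<sigma>_def
    by (intro cyl_mult cyl_power cyl_sum cyl_const cyl_time)
  moreover have "\<bar>(T - t) - (T - t)^4 * q t\<bar> \<le> e" if t: "t \<in> {0..T}" for t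
  proof -
    define y where "y = t / T"
    have y: "0 \<le> y" "y \<le> 1" "T - t = T * (1 - y)" using t T by (auto simp: y_def field_simps)
    have s: "(1 - y) * \<sigma> t = 1 - y ^ N"
      unfolding \<sigma>_def y_def by (simp add: one_diff_power_eq)
    have "(T - t)^4 * q t = (T - t) * ((1 - y) * \<sigma> t) ^ 3"
      unfolding q_def y(3) using T by (simp add: power_mult_distrib power4_eq_xxxx power3_eq_cube)
    then have eq: "(T - t) - (T - t)^4 * q t = T * ((1 - y) * (1 - (1 - y ^ N) ^ 3))"
      unfolding s y(3) by (simp add: algebra_simps)
    have z: "0 \<le> y ^ N" "y ^ N \<le> 1" using y by (auto simp: power_le_one)
    have cube: "1 - (1 - z) ^ 3 \<le> 3 * z" "0 \<le> 1 - (1 - z) ^ 3" if "0 \<le> z" "z \<le> 1" for z :: real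
    proof -
      have "1 - (1 - z) ^ 3 = 3 * z - z * z * (3 - z)" by (simp add: power3_eq_cube algebra_simps)
      moreover have "0 \<le> z * z * (3 - z)" using that by simp
      ultimately show "1 - (1 - z) ^ 3 \<le> 3 * z" by simp
      show "0 \<le> 1 - (1 - z) ^ 3" using that by (simp add: power_le_one)
    qed
    have "real N * ((1 - y) * y ^ N) = (1 - y) * (\<Sum>k<N. y ^ N)" by simp
    also have "\<dots> \<le> (1 - y) * (\<Sum>k<N. y ^ k)"
      using y by (intro mult_left_mono sum_mono power_decreasing) auto
    also have "\<dots> = 1 - y ^ N" by (simp add: one_diff_power_eq)
    also have "\<dots> \<le> 1" using z by simp
    finally have N2: "real N * ((1 - y) * y ^ N) \<le> 1" .
    have Npos: "0 < real N" using N T e by (smt (verit) divide_pos_pos)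
    have "T * ((1 - y) * (1 - (1 - y ^ N) ^ 3)) \<le> T * ((1 - y) * (3 * y ^ N))"
      using T y cube[OF z] by (intro mult_left_mono) auto
    also have "\<dots> = 3 * T * ((1 - y) * y ^ N)" by simp
    also have "\<dots> \<le> 3 * T * (1 / real N)"
      using N2 Npos T by (intro mult_left_mono) (auto simp: field_simps)
    also have "\<dots> \<le> e" using N Npos e by (simp add: field_simps)
    finally have "T * ((1 - y) * (1 - (1 - y ^ N) ^ 3)) \<le> e" .
    moreover have "0 \<le> T * ((1 - y) * (1 - (1 - y ^ N) ^ 3))"
      using T y cube[OF z] by (intro mult_nonneg_nonneg) auto
    ultimately show ?thesis unfolding eq by simp
  qed
  ultimately show thesis using that by blast
qed

text \<open>
  A function in the closure that vanishes at the terminal time is approximated even by multiples of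
  \<open>(T - t)\<^sup>4\<close>: subtract from an approximating polynomial its terminal value, divide by \<open>T - t\<close>, and flatten the
  factor \<open>T - t\<close>. Four powers are needed because the correction is a product of two terms that each
  carry the factor \<open>(T - t)\<^sup>2\<close>.
\<close>

lemma appr_flat:
  assumes T: "0 < T" and \<phi>: "appr T d \<phi>" "\<And>x. x \<in> linf d \<Longrightarrow> \<phi> T x = 0" and e: "0 < e"
  obtains S P where "finite S" "cyl S P"
    "\<And>t x. t \<in> {0..T} \<Longrightarrow> x \<in> linf d \<Longrightarrow> norm x \<le> R \<Longrightarrow> \<bar>\<phi> t x - (T - t)^4 * P t x\<bar> \<le> e"
proof -
  obtain S P where P: "finite S" "cyl S P"
    "\<And>t x. t \<in> {0..T} \<Longrightarrow> x \<in> linf d \<Longrightarrow> norm x \<le> R \<Longrightarrow> \<bar>\<phi> t x - P t x\<bar> \<le> e/3"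
    using apprD[OF \<phi>(1), of "e/3"] e by (metis divide_pos_pos zero_less_numeral)
  obtain Q where Q: "cyl S Q" "\<And>t x. P t x - P T x = (T - t) * Q t x"
    using cyl_divide_time[OF P(2)] by blast
  obtain K where K: "K \<ge> 0" "\<forall>t\<in>{0..T}. \<forall>x. norm x \<le> R \<longrightarrow> \<bar>Q t x\<bar> \<le> K"
    using cyl_bounded[OF Q(1)] by blast
  have "0 < e / (3 * (K + 1))" using e K by simp
  then obtain q where q: "cyl {} (\<lambda>t x. q t)"
    "\<And>t. t \<in> {0..T} \<Longrightarrow> \<bar>(T - t) - (T - t)^4 * q t\<bar> \<le> e / (3 * (K + 1))"
    using time_flattening[OF T] by metis
  have "\<bar>\<phi> t x - (T - t)^4 * (q t * Q t x)\<bar> \<le> e" if "t \<in> {0..T}" "x \<in> linf d" "norm x \<le> R" for t x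
  proof -
    have "\<phi> t x - (T - t)^4 * (q t * Q t x)
      = (\<phi> t x - P t x) + P T x + ((T - t) - (T - t)^4 * q t) * Q t x"
      using Q(2)[of t x] by (simp add: algebra_simps)
    moreover have "\<bar>\<phi> t x - P t x\<bar> \<le> e/3" "\<bar>P T x\<bar> \<le> e/3"
      using P(3)[OF that] P(3)[of T x] that T \<phi>(2) by auto
    moreover have "\<bar>((T - t) - (T - t)^4 * q t) * Q t x\<bar> \<le> e / (3 * (K + 1)) * K"
      unfolding abs_mult using q(2)[OF that(1)] K that e by (intro mult_mono) auto
    moreover have "e / (3 * (K + 1)) * K \<le> e/3" using K(1) e by (simp add: field_simps)
    ultimately show ?thesis by linarith
  qed
  moreover have "cyl S (\<lambda>t x. q t * Q t x)" using cyl_mono[OF q(1)] Q(1) by (intro cyl_mult) auto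
  ultimately show thesis using that[OF P(1), of "\<lambda>t x. q t * Q t x"] by blast
qed

section \<open>Cancelling residuals by passing them to other players\<close>

text \<open>
  In equation \<open>i\<close> the term \<open>D\<^sub>i u\<^sup>i \<cdot> D\<^sub>i u\<^sup>i\<close> has the coefficient one half, all others the coefficient one. With this
  weight they form one series.
\<close>

definition self_weight :: "int \<Rightarrow> int \<Rightarrow> real" where
  "self_weight i j = (if j = i then 1/2 else 1)"

lemma self_weight_bounds: "0 \<le> self_weight i j" "self_weight i j \<le> 1"
  by (auto simp: self_weight_def)

text \<open>
  An abstract starting point for the corrections. \<open>DV i j a\<close> stands for the derivative of the \<open>i\<close>-th starting function with
  respect to component \<open>a\<close> of entry \<open>j\<close>, and \<open>Rem i\<close> for the sum of all terms of equation \<open>i\<close> for the starting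
  functions except the products of gradients. The last assumption says that the starting functions satisfy the equations at
  \<open>t = T\<close>.
\<close>

locale flexible_drift =
  fixes d :: nat and T :: real
    and DV :: "int \<Rightarrow> int \<Rightarrow> nat \<Rightarrow> real \<Rightarrow> seqs \<Rightarrow> real"
    and Rem :: "int \<Rightarrow> real \<Rightarrow> seqs \<Rightarrow> real"
    and w :: "int \<Rightarrow> real"
  assumes d: "1 \<le> d" and T: "0 < T"
    and w_nonneg: "0 \<le> w j" and w_sum: "w summable_on UNIV"
    and DV_appr: "appr T d (DV i j a)"
    and DV_bound: "t \<in> {0..T} \<Longrightarrow> x \<in> linf d \<Longrightarrow> \<bar>DV i j a t x\<bar> \<le> w (j - i) * norm x"
    and Rem_appr: "appr T d (Rem i)"
    and compat: "x \<in> linf d \<Longrightarrow>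
      Rem i T x = (\<Sum>\<^sub>\<infinity>j. self_weight i j * (\<Sum>a<d. DV j j a T x * DV i j a T x))"
begin

text \<open>
  For the corrected functions, \<open>own_grad Q j a\<close> is component \<open>a\<close> of \<open>D\<^sub>j u\<^sup>j\<close> and \<open>cross_grad Q l i j a\<close> that of
  \<open>D\<^sub>j u\<^sup>i\<close>, where \<open>Q\<^sup>j\<close> does not depend on entry \<open>j\<close> and \<open>l\<^sup>j\<^sub>j = 0\<close>. Equation \<open>i\<close> says that \<open>residual Q l i\<close>
  vanishes.
\<close>

definition own_grad :: "(int \<Rightarrow> real \<Rightarrow> seqs \<Rightarrow> real) \<Rightarrow> int \<Rightarrow> nat \<Rightarrow> real \<Rightarrow> seqs \<Rightarrow> real" where
  "own_grad Q j a t x = DV j j a t x + (if a = 0 then (T - t)^2 * Q j t x else 0)"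

definition cross_grad ::
    "(int \<Rightarrow> real \<Rightarrow> seqs \<Rightarrow> real) \<Rightarrow> (int \<Rightarrow> int \<Rightarrow> real) \<Rightarrow> int \<Rightarrow> int \<Rightarrow> nat \<Rightarrow> real \<Rightarrow> seqs \<Rightarrow> real" where
  "cross_grad Q l i j a t x = DV i j a t x + (T - t)^2 *
     (apply_bcontfun x (i, 0) * pderiv_seq j a (Q i t) x
      + (if a = 0 then l i j + (if j = i then Q i t x else 0) else 0))"

definition coupling ::
    "(int \<Rightarrow> real \<Rightarrow> seqs \<Rightarrow> real) \<Rightarrow> (int \<Rightarrow> int \<Rightarrow> real) \<Rightarrow> int \<Rightarrow> int \<Rightarrow> real \<Rightarrow> seqs \<Rightarrow> real" where
  "coupling Q l i j t x = self_weight i j * (\<Sum>a<d. own_grad Q j a t x * cross_grad Q l i j a t x)"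

definition source_term ::
    "(int \<Rightarrow> real \<Rightarrow> seqs \<Rightarrow> real) \<Rightarrow> (int \<Rightarrow> int \<Rightarrow> real) \<Rightarrow> int \<Rightarrow> real \<Rightarrow> seqs \<Rightarrow> real" where
  "source_term Q l i t x = Rem i t x
     - 2 * (T - t) * (apply_bcontfun x (i, 0) * Q i t x + (\<Sum>\<^sub>\<infinity>j. l i j * apply_bcontfun x (j, 0)))
     + (T - t)^2 * (apply_bcontfun x (i, 0)
         * (deriv (\<lambda>s. Q i s x) t + (\<Sum>\<^sub>\<infinity>j. entry_laplacian d j (Q i t) x)))"

definition residual ::
    "(int \<Rightarrow> real \<Rightarrow> seqs \<Rightarrow> real) \<Rightarrow> (int \<Rightarrow> int \<Rightarrow> real) \<Rightarrow> int \<Rightarrow> real \<Rightarrow> seqs \<Rightarrow> real" where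
  "residual Q l i t x = source_term Q l i t x - (\<Sum>\<^sub>\<infinity>j. coupling Q l i j t x)"

text \<open>
  \<open>U\<close> is the finite set of players involved so far. That \<open>Q i\<close> avoids entry \<open>i\<close> makes \<open>x\<^sup>i Q\<^sup>i\<close> linear in \<open>x\<^sup>i\<close>
  with derivative \<open>Q\<^sup>i\<close>.
\<close>

definition admissible ::
    "int set \<Rightarrow> (int \<Rightarrow> real \<Rightarrow> seqs \<Rightarrow> real) \<Rightarrow> (int \<Rightarrow> int \<Rightarrow> real) \<Rightarrow> bool" where
  "admissible U Q l \<longleftrightarrow> finite U \<and>
     (\<forall>i. \<exists>S\<subseteq>U. i \<notin> S \<and> cyl S (Q i)) \<and>
     (\<forall>i. i \<notin> U \<longrightarrow> Q i = (\<lambda>t x. 0)) \<and>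
     (\<forall>i j. l i j \<noteq> 0 \<longrightarrow> i \<in> U \<and> j \<in> U \<and> i \<noteq> j)"

lemma admissible_cyl: "admissible U Q l \<Longrightarrow> cyl U (Q i)"
  unfolding admissible_def by (blast intro: cyl_mono)

lemma admissible_pderiv:
  assumes "admissible U Q l" "j \<notin> U \<or> j = i"
  shows "pderiv_seq j a (Q i t) x = 0"
proof -
  obtain S where "S \<subseteq> U" "i \<notin> S" "cyl S (Q i)" using assms(1) unfolding admissible_def by blast
  then show ?thesis using cyl_pderiv_seq(3)[of S "Q i" j a t x] assms(2) by blast
qed

lemma admissible_laplacian:
  assumes "admissible U Q l" "j \<notin> U"
  shows "entry_laplacian d j (Q i t) x = 0"
  by (rule cyl_laplacian_outside[OF admissible_cyl[OF assms(1)] assms(2)])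

lemma coupling_outside:
  assumes "admissible U Q l" "j \<notin> U"
  shows "coupling Q l i j t x = self_weight i j * (\<Sum>a<d. DV j j a t x * DV i j a t x)"
proof -
  have "Q j = (\<lambda>t x. 0)" "l i j = 0" using assms unfolding admissible_def by blast+
  then have "own_grad Q j a t x = DV j j a t x" "cross_grad Q l i j a t x = DV i j a t x" for a
    using admissible_pderiv[OF assms(1), of j i] assms(2) by (auto simp: own_grad_def cross_grad_def)
  then show ?thesis by (simp add: coupling_def)
qed

lemma coupling_appr:
  assumes "admissible U Q l"
  shows "appr T d (coupling Q l i j)"
proof -
  have fin: "finite U" using assms by (simp add: admissible_def)
  note Q = admissible_cyl[OF assms]
  have time: "appr T d (\<lambda>t x. (T - t)^2)"
    by (rule cyl_appr[of "{}"]) (auto intro!: cyl_power cyl_diff cyl.intros)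
  have "appr T d (own_grad Q j a)" for a
    unfolding own_grad_def using DV_appr appr_mult[OF time cyl_appr[OF fin Q]]
    by (cases "a = 0") (auto intro!: appr_add)
  moreover have "appr T d (\<lambda>t x. if a = 0 then l i j + (if j = i then Q i t x else 0) else 0)" for a :: nat
    by (cases "a = 0"; cases "j = i") (auto intro!: appr_const appr_add cyl_appr[OF fin Q])
  then have "appr T d (cross_grad Q l i j a)" for a
    unfolding cross_grad_def using cyl_appr[OF fin cyl_pderiv_seq(1)[OF Q]]
    by (intro appr_add appr_mult time DV_appr appr_coord)
  ultimately have "appr T d (\<lambda>t x. self_weight i j * (\<Sum>a<d. own_grad Q j a t x * cross_grad Q l i j a t x))"
    by (intro appr_mult appr_sum appr_const) auto
  then show ?thesis by (simp add: coupling_def[abs_def])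
qed

text \<open>
  Outside \<open>U\<close> both factors are derivatives of starting functions: \<open>DV j j\<close> is bounded independently of \<open>j\<close>, and
  \<open>DV i j\<close> decays in \<open>j\<close>. The finitely many remaining terms are bounded on bounded sets.
\<close>

lemma coupling_dominated:
  assumes "admissible U Q l"
  shows "\<exists>M. M summable_on UNIV \<and>
    (\<forall>j. \<forall>t\<in>{0..T}. \<forall>x\<in>linf d. norm x \<le> R \<longrightarrow> \<bar>coupling Q l i j t x\<bar> \<le> M j)"
proof -
  have fin: "finite U" using assms by (simp add: admissible_def)
  obtain K where K: "\<And>j. K j \<ge> 0" "\<And>j t x. t\<in>{0..T} \<Longrightarrow> x\<in>linf d \<Longrightarrow> norm x \<le> R \<Longrightarrow> \<bar>coupling Q l i j t x\<bar> \<le> K j"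
    using appr_bounded[OF coupling_appr[OF assms]] by metis
  define M where "M j = (real d * w 0 * R^2) * w (j - i) + (if j \<in> U then K j else 0)" for j
  have "(\<lambda>j. w (j - i)) summable_on UNIV"
    using w_sum by (rule summable_on_shift)
  then have "(\<lambda>j. (real d * w 0 * R^2) * w (j - i)) summable_on UNIV"
    by (rule summable_on_cmult_right)
  moreover have "(\<lambda>j. if j \<in> U then K j else 0) summable_on UNIV"
    by (rule summable_on_finite_support[OF fin]) auto
  ultimately have "M summable_on UNIV" unfolding M_def by (rule summable_on_add)
  moreover have "\<bar>coupling Q l i j t x\<bar> \<le> M j" if "t\<in>{0..T}" "x\<in>linf d" "norm x \<le> R" for j t x
  proof (cases "j \<in> U")
    case True
    have "0 \<le> real d * w 0 * R^2 * w (j - i)" using w_nonneg by simp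
    then show ?thesis using K(2)[OF that, of j] True by (simp add: M_def)
  next
    case False
    have R: "0 \<le> R" using that(3) norm_ge_zero[of x] by linarith
    have "\<bar>DV j j a t x * DV i j a t x\<bar> \<le> (w 0 * R) * (w (j - i) * R)" for a
      unfolding abs_mult using DV_bound[OF that(1,2), of j j a] DV_bound[OF that(1,2), of i j a] w_nonneg R that(3)
      by (intro mult_mono) (auto intro: order_trans mult_left_mono)
    then have "\<bar>\<Sum>a<d. DV j j a t x * DV i j a t x\<bar> \<le> (\<Sum>a<d. (w 0 * R) * (w (j - i) * R))"
      by (intro order_trans[OF sum_abs] sum_mono) auto
    then have "\<bar>self_weight i j * (\<Sum>a<d. DV j j a t x * DV i j a t x)\<bar> \<le> 1 * (\<Sum>a<d. (w 0 * R) * (w (j - i) * R))"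
      unfolding abs_mult using self_weight_bounds[of i j] by (intro mult_mono) auto
    also have "\<dots> = M j" using False by (simp add: M_def power2_eq_square)
    finally show ?thesis using coupling_outside[OF assms False] by simp
  qed
  ultimately show ?thesis by blast
qed

lemma coupling_summable:
  assumes "admissible U Q l" "t \<in> {0..T}" "x \<in> linf d"
  shows "(\<lambda>j. coupling Q l i j t x) summable_on UNIV"
proof -
  obtain M where M: "M summable_on UNIV"
    "\<forall>j. \<forall>t\<in>{0..T}. \<forall>y\<in>linf d. norm y \<le> norm x \<longrightarrow> \<bar>coupling Q l i j t y\<bar> \<le> M j"
    using coupling_dominated[OF assms(1), of "norm x" i] by metis
  show ?thesis
    by (rule summable_on_dominated[OF M(1)]) (use M(2) assms(2,3) in blast)
qed

lemma link_sum:
  assumes "admissible U Q l"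
  shows "(\<Sum>\<^sub>\<infinity>j. l i j * apply_bcontfun x (j, 0)) = (\<Sum>j\<in>U. l i j * apply_bcontfun x (j, 0))"
  using assms unfolding admissible_def by (intro infsum_finite_support) auto

text \<open>
  Only finitely many terms come from the corrections, and these are cylinder polynomials. The rest is a series
  dominated by the decay of \<open>DV\<close>.
\<close>

lemma residual_appr:
  assumes "admissible U Q l"
  shows "appr T d (residual Q l i)"
proof -
  have fin: "finite U" using assms by (simp add: admissible_def)
  note Q = admissible_cyl[OF assms]
  have time: "appr T d (\<lambda>t x. T - t)"
    by (rule cyl_appr[of "{}"]) (auto intro!: cyl_diff cyl.intros)
  then have time2: "appr T d (\<lambda>t x. (T - t)^2)"
    using appr_mult[OF time time] by (simp add: power2_eq_square)
  have lap: "(\<Sum>\<^sub>\<infinity>j. entry_laplacian d j (Q i t) x) = (\<Sum>j\<in>U. entry_laplacian d j (Q i t) x)" for t x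
    using admissible_laplacian[OF assms] by (intro infsum_finite_support[OF fin]) auto
  have "appr T d (\<lambda>t x. \<Sum>j\<in>U. entry_laplacian d j (Q i t) x)"
    by (rule appr_sum[OF cyl_appr[OF fin entry_laplacian_cyl[OF Q]]])
  moreover have "appr T d (\<lambda>t x. \<Sum>j\<in>U. l i j * apply_bcontfun x (j, 0))"
    by (rule appr_sum[OF appr_mult[OF appr_const appr_coord]])
  moreover have "appr T d (\<lambda>t x. 2 * (T - t))"
    by (rule appr_mult[OF appr_const time])
  ultimately have "appr T d (source_term Q l i)"
    unfolding source_term_def[abs_def] link_sum[OF assms] lap
    by (intro appr_add appr_diff appr_mult[OF time2] appr_mult[OF appr_coord]
        appr_mult[of T d "\<lambda>t x. 2 * (T - t)"] Rem_appr appr_coord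
        cyl_appr[OF fin Q] cyl_appr[OF fin cyl_tderiv(1)[OF Q]])
  moreover have "appr T d (\<lambda>t x. \<Sum>\<^sub>\<infinity>j. coupling Q l i j t x)"
    using coupling_dominated[OF assms] by (intro appr_infsum coupling_appr[OF assms])
  ultimately show ?thesis unfolding residual_def[abs_def] by (rule appr_diff)
qed

text \<open>
  The corrections carry the factor \<open>(T - t)\<^sup>2\<close>, so that even their time derivatives vanish at \<open>t = T\<close>.
\<close>

lemma residual_terminal: "x \<in> linf d \<Longrightarrow> residual Q l i T x = 0"
proof -
  assume x: "x \<in> linf d"
  have "own_grad Q j a T x = DV j j a T x" "cross_grad Q l i j a T x = DV i j a T x" for j a
    by (auto simp: own_grad_def cross_grad_def)
  with compat[OF x] show ?thesis by (simp add: residual_def source_term_def coupling_def)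
qed

text \<open>
  Stage \<open>s\<close> treats player \<open>p\<close> with the new player \<open>c\<close>. On the ball of radius \<open>s\<close>, the new term \<open>(T - t)\<^sup>4 e P\<close> of the coupling
  cancels the residual of \<open>p\<close> up to \<open>2\<^sup>-\<^sup>s\<close>; the other three bounds concern the side effects in the
  equations of \<open>p\<close> and of the players involved so far.
\<close>

definition good_step ::
    "nat \<Rightarrow> int \<Rightarrow> int set \<Rightarrow> (int \<Rightarrow> real \<Rightarrow> seqs \<Rightarrow> real) \<Rightarrow> (int \<Rightarrow> int \<Rightarrow> real)
      \<Rightarrow> int \<Rightarrow> real \<Rightarrow> (real \<Rightarrow> seqs \<Rightarrow> real) \<Rightarrow> bool" where
  "good_step s p U Q l c e P \<longleftrightarrow> c \<notin> insert p U \<and> 0 < e \<and> e \<le> (1/2)^s \<and>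
     (\<forall>t\<in>{0..T}. \<forall>x\<in>linf d. norm x \<le> real s \<longrightarrow>
        (\<forall>i\<in>insert p U. \<bar>(T - t)^2 * P t x * DV i c 0 t x\<bar> \<le> (1/2)^s) \<and>
        \<bar>(T - t)^2 * e * DV c c 0 t x\<bar> \<le> (1/2)^s \<and>
        \<bar>2 * (T - t) * e * apply_bcontfun x (c, 0)\<bar> \<le> (1/2)^s \<and>
        \<bar>residual Q l p t x - (T - t)^4 * e * P t x\<bar> \<le> (1/2)^s)"

text \<open>
  The choices are made in the order \<open>e P\<close>, \<open>e\<close>, \<open>c\<close>: the product \<open>e P\<close> comes from the approximation of the residual,
  \<open>e\<close> makes the side effects of the link from \<open>p\<close> to \<open>c\<close> small, and then \<open>P\<close> is known and \<open>c\<close> is moved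
  so far away that \<open>P\<close>, however large, hardly affects the players involved so far.
\<close>

lemma good_step_exists:
  assumes "admissible U Q l"
  obtains c e P U' where "good_step s p U Q l c e P" "insert c (insert p U) \<subseteq> U'"
    "admissible U' (Q(c := P)) (l(p := (l p)(c := e)))"
proof -
  let ?h = "(1/2::real)^s"
  have fin: "finite U" using assms by (simp add: admissible_def)
  obtain S P0 where P0: "finite S" "cyl S P0"
    "\<And>t x. t \<in> {0..T} \<Longrightarrow> x \<in> linf d \<Longrightarrow> norm x \<le> real s \<Longrightarrow> \<bar>residual Q l p t x - (T - t)^4 * P0 t x\<bar> \<le> ?h"
    using appr_flat[OF T residual_appr[OF assms] residual_terminal, of ?h] by (metis zero_less_power half_gt_zero zero_less_one)
  \<comment> \<open>The denominator dominates both side effects of the link, \<open>T\<^sup>2 w\<^sub>0 s\<close> and \<open>2 T s\<close>, and \<open>1\<close> gives \<open>e \<le> 2\<^sup>-\<^sup>s\<close>.\<close>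
  define e where "e = ?h / (1 + T^2 * w 0 * real s + 2 * T * real s)"
  have den: "1 \<le> 1 + T^2 * w 0 * real s + 2 * T * real s"
    using T w_nonneg[of 0] by simp
  then have epos: "0 < e" by (simp add: e_def)
  have e1: "e * (1 + T^2 * w 0 * real s + 2 * T * real s) = ?h"
    using den by (simp add: e_def)
  have nn: "0 \<le> e * (T^2 * w 0 * real s)" "0 \<le> e * (2 * T * real s)"
    using epos T w_nonneg[of 0] by simp_all
  have e2: "e \<le> ?h" "e * (T^2 * w 0 * real s) \<le> ?h" "e * (2 * T * real s) \<le> ?h"
    using e1 nn epos unfolding distrib_left mult_1_right by linarith+
  \<comment> \<open>The factor \<open>e\<close> of the link is divided out, so \<open>P\<close> may be large; it is bounded on the ball.\<close>
  define P where "P t x = (1 / e) * P0 t x" for t x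
  have P: "cyl S P" unfolding P_def[abs_def] by (intro cyl_mult P0 cyl_const)
  obtain K where K: "K \<ge> 0" "\<forall>t\<in>{0..T}. \<forall>x. norm x \<le> real s \<longrightarrow> \<bar>P t x\<bar> \<le> K"
    using cyl_bounded[OF P] by blast
  have "0 < ?h / (1 + T^2 * K * real s)"
    using K(1) by (intro divide_pos_pos add_pos_nonneg) auto
  then obtain c where c: "c \<notin> S \<union> insert p U" "\<And>b. b \<in> insert p U \<Longrightarrow> \<bar>w (c - b)\<bar> < ?h / (1 + T^2 * K * real s)"
    using summable_on_far[OF w_sum, of _ "insert p U" "S \<union> insert p U"] fin P0(1) by auto
  have "good_step s p U Q l c e P"
    unfolding good_step_def
  proof (intro conjI ballI impI)
    fix t x assume tx: "t \<in> {0..T}" "x \<in> linf d" "norm x \<le> real s"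
    have tau: "0 \<le> T - t" "T - t \<le> T" "(T - t)^2 \<le> T^2"
      using tx(1) by (auto intro!: power_mono)
    show "\<bar>residual Q l p t x - (T - t)^4 * e * P t x\<bar> \<le> ?h"
      using P0(3)[OF tx] epos by (simp add: P_def)
    have "\<bar>(T - t)^2 * e * DV c c 0 t x\<bar> \<le> T^2 * e * (w 0 * real s)"
      unfolding abs_mult using tau epos DV_bound[OF tx(1,2), of c c 0] mult_left_mono[OF tx(3), of "w 0"] w_nonneg[of 0]
      by (intro mult_mono) auto
    then show "\<bar>(T - t)^2 * e * DV c c 0 t x\<bar> \<le> ?h" using e2(2) by (simp add: algebra_simps)
    have "\<bar>2 * (T - t) * e * apply_bcontfun x (c, 0)\<bar> \<le> 2 * T * e * real s"
      unfolding abs_mult using tau epos order_trans[OF coord_le_norm tx(3)]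
      by (intro mult_mono) auto
    then show "\<bar>2 * (T - t) * e * apply_bcontfun x (c, 0)\<bar> \<le> ?h" using e2(3) by (simp add: algebra_simps)
    fix i assume i: "i \<in> insert p U"
    have "\<bar>(T - t)^2 * P t x * DV i c 0 t x\<bar> \<le> T^2 * K * (w (c - i) * real s)"
      unfolding abs_mult using tau K tx DV_bound[OF tx(1,2), of i c 0] mult_left_mono[OF tx(3), of "w (c - i)"] w_nonneg[of "c - i"]
      by (intro mult_mono) auto
    also have "\<dots> = w (c - i) * (T^2 * K * real s)" by (simp add: algebra_simps)
    also have "\<dots> \<le> w (c - i) * (1 + T^2 * K * real s)"
      using w_nonneg[of "c - i"] by (intro mult_left_mono) auto
    also have "\<dots> \<le> ?h"
      using c(2)[OF i] K(1) w_nonneg[of "c - i"] by (simp add: pos_less_divide_eq[OF add_pos_nonneg] less_imp_le)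
    finally show "\<bar>(T - t)^2 * P t x * DV i c 0 t x\<bar> \<le> ?h" .
  qed (use c epos e2 in auto)
  moreover have "admissible (insert c (insert p U) \<union> S) (Q(c := P)) (l(p := (l p)(c := e)))"
    unfolding admissible_def
  proof (intro conjI allI)
    show "finite (insert c (insert p U) \<union> S)" using fin P0(1) by simp
    fix i
    show "\<exists>S'\<subseteq>insert c (insert p U) \<union> S. i \<notin> S' \<and> cyl S' ((Q(c := P)) i)"
    proof (cases "i = c")
      case True
      then show ?thesis using P c(1) by (intro exI[of _ S]) auto
    next
      case False
      obtain S0 where "S0 \<subseteq> U" "i \<notin> S0" "cyl S0 (Q i)"
        using assms unfolding admissible_def by blast
      then show ?thesis using False by (intro exI[of _ S0]) auto
    qed
    show "i \<notin> insert c (insert p U) \<union> S \<longrightarrow> (Q(c := P)) i = (\<lambda>t x. 0)"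
      using assms unfolding admissible_def by simp
    fix j
    have "l i j \<noteq> 0 \<longrightarrow> i \<in> U \<and> j \<in> U \<and> i \<noteq> j"
      using assms unfolding admissible_def by simp
    then show "(l(p := (l p)(c := e))) i j \<noteq> 0 \<longrightarrow>
        i \<in> insert c (insert p U) \<union> S \<and> j \<in> insert c (insert p U) \<union> S \<and> i \<noteq> j"
      using c(1) by auto
  qed
  ultimately show thesis using that[of c e P "insert c (insert p U) \<union> S"] by blast
qed

text \<open>
  The amount by which the coupling with \<open>c\<close> in equation \<open>i\<close> grows when \<open>c\<close> becomes the new partner of player \<open>p\<close>.
\<close>

definition change ::
    "int \<Rightarrow> int \<Rightarrow> real \<Rightarrow> (real \<Rightarrow> seqs \<Rightarrow> real) \<Rightarrow> int \<Rightarrow> real \<Rightarrow> seqs \<Rightarrow> real" where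
  "change p c e P i t x = (T - t)^2 * P t x * DV i c 0 t x
     + (if i = p then (T - t)^2 * e * DV c c 0 t x + (T - t)^4 * e * P t x else 0)"

text \<open>
  Before the step \<open>Q\<^sup>c\<close> is zero and the corrections of the players in \<open>insert p U\<close> do not involve entry \<open>c\<close>, so
  the only term to change is the one with \<open>j = c\<close>, and its change is explicit.
\<close>

lemma coupling_step:
  assumes adm: "admissible U Q l" and c: "c \<notin> insert p U" and i: "i \<in> insert p U"
  shows "coupling (Q(c := P)) (l(p := (l p)(c := e))) i j t x
    = coupling Q l i j t x + (if j = c then change p c e P i t x else 0)"
proof (cases "j = c")
  case True
  have Qc: "Q c = (\<lambda>t x. 0)" "l i c = 0" "i \<noteq> c" using adm c i unfolding admissible_def by blast+
  have pd: "pderiv_seq c a (Q i t) x = 0" for a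
    using admissible_pderiv[OF adm, of c i] c by blast
  obtain d' where d': "d = Suc d'" using d by (cases d) auto
  have "(\<Sum>a<d. own_grad (Q(c := P)) c a t x * cross_grad (Q(c := P)) (l(p := (l p)(c := e))) i c a t x)
     = (\<Sum>a<d. own_grad Q c a t x * cross_grad Q l i c a t x) + change p c e P i t x"
    unfolding d' sum.lessThan_Suc_shift own_grad_def cross_grad_def change_def using Qc pd
    by (auto simp: algebra_simps power2_eq_square power4_eq_xxxx)
  then show ?thesis using True Qc(3) by (simp add: coupling_def self_weight_def)
next
  case False
  have "i \<noteq> c" using c i by blast
  with False have "own_grad (Q(c := P)) j = own_grad Q j"
    "cross_grad (Q(c := P)) (l(p := (l p)(c := e))) i j = cross_grad Q l i j"
    by (auto simp: own_grad_def cross_grad_def fun_eq_iff)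
  with False show ?thesis by (simp add: coupling_def)
qed

lemma residual_step:
  assumes adm: "admissible U Q l" and c: "c \<notin> insert p U" and i: "i \<in> insert p U"
    and tx: "t \<in> {0..T}" "x \<in> linf d"
  shows "residual (Q(c := P)) (l(p := (l p)(c := e))) i t x
    = residual Q l i t x - change p c e P i t x
      - (if i = p then 2 * (T - t) * e * apply_bcontfun x (c, 0) else 0)"
proof -
  have Qc: "l i c = 0" "i \<noteq> c" using adm c i unfolding admissible_def by blast+
  have "(\<Sum>\<^sub>\<infinity>j. coupling (Q(c := P)) (l(p := (l p)(c := e))) i j t x)
      = (\<Sum>\<^sub>\<infinity>j. coupling Q l i j t x) + change p c e P i t x"
    unfolding coupling_step[OF adm c i] by (rule infsum_add_single[OF coupling_summable[OF adm tx]])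
  moreover have "(\<Sum>\<^sub>\<infinity>j. (l(p := (l p)(c := e))) i j * apply_bcontfun x (j, 0))
     = (\<Sum>\<^sub>\<infinity>j. l i j * apply_bcontfun x (j, 0)) + (if i = p then e * apply_bcontfun x (c, 0) else 0)"
  proof -
    have "(\<lambda>j. (l(p := (l p)(c := e))) i j * apply_bcontfun x (j, 0))
      = (\<lambda>j. l i j * apply_bcontfun x (j, 0) + (if j = c then (if i = p then e * apply_bcontfun x (c, 0) else 0) else 0))"
      using Qc by auto
    moreover have "(\<lambda>j. l i j * apply_bcontfun x (j, 0)) summable_on UNIV"
      using adm by (intro summable_on_finite_support[of U]) (auto simp: admissible_def)
    ultimately show ?thesis by (simp only: infsum_add_single)
  qed
  ultimately show ?thesis using Qc(2) unfolding residual_def source_term_def by (simp add: algebra_simps)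
qed

end

section \<open>The limit of infinitely many corrections\<close>

text \<open>
  The data after stage \<open>s\<close> are \<open>U (Suc s)\<close>, \<open>Q (Suc s)\<close> and \<open>l (Suc s)\<close>; stage \<open>s\<close> treats player \<open>p s\<close> with the new
  player \<open>c s\<close>.
\<close>

locale correction_sequence = flexible_drift +
  fixes p :: "nat \<Rightarrow> int" and U :: "nat \<Rightarrow> int set"
    and Q :: "nat \<Rightarrow> int \<Rightarrow> real \<Rightarrow> seqs \<Rightarrow> real" and l :: "nat \<Rightarrow> int \<Rightarrow> int \<Rightarrow> real"
    and c :: "nat \<Rightarrow> int" and e :: "nat \<Rightarrow> real" and P :: "nat \<Rightarrow> real \<Rightarrow> seqs \<Rightarrow> real"
  assumes often: "\<exists>s\<ge>n. p s = i"
    and start: "U 0 = {}"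
    and adm: "admissible (U s) (Q s) (l s)"
    and good: "good_step s (p s) (U s) (Q s) (l s) (c s) (e s) (P s)"
    and U_step: "insert (c s) (insert (p s) (U s)) \<subseteq> U (Suc s)"
    and Q_step: "Q (Suc s) = (Q s)(c s := P s)"
    and l_step: "l (Suc s) = (l s)(p s := (l s (p s))(c s := e s))"
begin

lemma U_mono: "s \<le> r \<Longrightarrow> U s \<subseteq> U r"
proof -
  have "U n \<subseteq> U (Suc n)" for n using U_step[of n] by simp
  then show "s \<le> r \<Longrightarrow> U s \<subseteq> U r" by (rule lift_Suc_mono_le)
qed

lemma c_new: "c s \<notin> insert (p s) (U s)"
  using good[of s] by (simp add: good_step_def)

text \<open>
  The polynomial of a player that has been involved, and all links to it, therefore remain as they are. This is why the
  limits below exist.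
\<close>

lemma c_fresh: "j \<in> U s \<Longrightarrow> s \<le> r \<Longrightarrow> c r \<noteq> j"
  using c_new[of r] U_mono[of s r] by blast

lemma inj_c: "inj c"
proof (rule linorder_injI)
  fix s r :: nat assume "s < r"
  then have "c s \<in> U r" using U_step[of s] U_mono[of "Suc s" r] by auto
  then show "c s \<noteq> c r" using c_new[of r] by auto
qed

lemma Q_frozen: "s \<le> r \<Longrightarrow> j \<in> U s \<Longrightarrow> Q r j = Q s j"
proof (induction r rule: dec_induct)
  case (step r)
  with c_fresh[of j s r] show ?case by (simp add: Q_step)
qed simp

lemma l_frozen: "s \<le> r \<Longrightarrow> j \<in> U s \<Longrightarrow> l r i j = l s i j"
proof (induction r rule: dec_induct)
  case (step r)
  with c_fresh[of j s r] show ?case by (auto simp: l_step)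
qed simp

lemma exhaust: "\<exists>s. i \<in> U s"
  using often[of 0 i] U_step by blast

definition stage :: "int \<Rightarrow> nat" where "stage j = (LEAST s. j \<in> U s)"
definition Qlim :: "int \<Rightarrow> real \<Rightarrow> seqs \<Rightarrow> real" where "Qlim j = Q (stage j) j"
definition llim :: "int \<Rightarrow> int \<Rightarrow> real" where "llim i j = l (stage j) i j"

lemma stage: "j \<in> U (stage j)" "j \<in> U s \<Longrightarrow> stage j \<le> s"
  unfolding stage_def using exhaust[of j] by (auto intro: LeastI_ex Least_le)

lemma Qlim_eq: "j \<in> U s \<Longrightarrow> Q s j = Qlim j"
  unfolding Qlim_def using stage Q_frozen by blast

lemma llim_eq: "j \<in> U s \<Longrightarrow> l s i j = llim i j"
  unfolding llim_def using stage l_frozen by blast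

lemma in_U: "stage j \<le> s \<Longrightarrow> j \<in> U s"
  using stage(1) U_mono by blast

lemma coupling_frozen:
  assumes "i \<in> U s" "j \<in> U s"
  shows "coupling (Q s) (l s) i j t x = coupling Qlim llim i j t x"
  unfolding coupling_def own_grad_def cross_grad_def Qlim_eq[OF assms(1)] Qlim_eq[OF assms(2)] llim_eq[OF assms(2)] ..

definition link_bound :: "int \<Rightarrow> real" where
  "link_bound j = (if j \<in> range c then (1/2) ^ inv c j else 0)"

lemma link_bound_summable: "link_bound summable_on UNIV"
  unfolding link_bound_def[abs_def]
  by (rule summable_on_along_injection[OF inj_c]) (auto intro: summable_geometric)

lemma link_bounds: "0 \<le> l s i j \<and> l s i j \<le> link_bound j"
proof (induction s)
  case 0
  have "l 0 i j = 0" using adm[of 0] start unfolding admissible_def by blast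
  then show ?case by (simp add: link_bound_def)
next
  case (Suc s)
  have "0 \<le> e s" "e s \<le> (1/2) ^ s" using good[of s] by (auto simp: good_step_def)
  with Suc show ?case using inv_f_f[OF inj_c, of s]
    by (auto simp: l_step link_bound_def)
qed

lemma llim_bounds: "0 \<le> llim i j" "llim i j \<le> link_bound j"
  using link_bounds by (auto simp: llim_def)

lemma llim_summable: "llim i summable_on UNIV"
  using llim_bounds by (intro summable_on_dominated[OF link_bound_summable]) auto

lemma link_sum_limit:
  fixes x :: seqs
  shows "(\<lambda>s. \<Sum>\<^sub>\<infinity>j. l s i j * apply_bcontfun x (j, 0)) \<longlonglongrightarrow> (\<Sum>\<^sub>\<infinity>j. llim i j * apply_bcontfun x (j, 0))"
proof (rule infsum_dominated_limit)
  show "(\<lambda>s. l s i j * apply_bcontfun x (j, 0)) \<longlonglongrightarrow> llim i j * apply_bcontfun x (j, 0)" for j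
    using eventually_ge_at_top[of "stage j"]
    by (intro tendsto_eventually, eventually_elim) (simp add: llim_eq[OF in_U])
  show "\<bar>l s i j * apply_bcontfun x (j, 0)\<bar> \<le> link_bound j * norm x" for s j
    unfolding abs_mult using link_bounds[of s i j] coord_le_norm[of x "(j, 0)"] by (intro mult_mono) auto
  show "(\<lambda>j. link_bound j * norm x) summable_on UNIV"
    using link_bound_summable by (rule summable_on_cmult_left)
qed

text \<open>
  Fix an equation \<open>i\<close> and a ball. The numbers \<open>y r\<close> bound the residual before stage \<open>r\<close>: a stage that treats \<open>i\<close> brings it
  below \<open>4 \<cdot> 2\<^sup>-\<^sup>r\<close>, any other stage adds at most \<open>2\<^sup>-\<^sup>r\<close>. When \<open>i\<close> is treated, the coupling changes by about
  the current residual, so the sizes \<open>y r\<close> at these stages have to be summable. They are, by a telescoping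
  argument: at such a stage \<open>y r\<close> exceeds the drop \<open>y r - y (r + 1)\<close> by a multiple of \<open>2\<^sup>-\<^sup>r\<close>. Hence
  the coupling terms of all stages have a common summable bound. By dominated convergence the residuals converge to
  the residual of the limit, which is zero because it is a limit of the residuals along the stages that treat \<open>i\<close>.
\<close>

lemma limit_dominated_and_exact:
  "\<exists>M. M summable_on UNIV \<and>
     (\<forall>t\<in>{0..T}. \<forall>x\<in>linf d. norm x \<le> R \<longrightarrow>
        (\<forall>j. \<bar>coupling Qlim llim i j t x\<bar> \<le> M j) \<and> residual Qlim llim i t x = 0)"
proof -
  \<comment> \<open>From stage \<open>n0\<close> on, player \<open>i\<close> is involved and the ball lies within the ball of the stage.\<close>
  define n0 where "n0 = max (stage i) (nat \<lceil>R\<rceil>)"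
  have i: "i \<in> U s" if "n0 \<le> s" for s using that in_U[of i s] by (simp add: n0_def)
  have R: "R \<le> real s" if "n0 \<le> s" for s using that unfolding n0_def by linarith
  define h :: "nat \<Rightarrow> real" where "h s = (1/2)^s" for s :: nat
  have h: "0 < h s" for s by (simp add: h_def)
  obtain Y where Y: "Y \<ge> 0" "\<forall>t\<in>{0..T}. \<forall>x\<in>linf d. norm x \<le> R \<longrightarrow> \<bar>residual (Q n0) (l n0) i t x\<bar> \<le> Y"
    using appr_bounded[OF residual_appr[OF adm[of n0]]] by blast
  define y where "y = rec_nat Y (\<lambda>r z. if p r = i \<and> n0 \<le> r then 4 * h r else z + h r)"
  have y0: "y 0 = Y" and ySuc: "y (Suc r) = (if p r = i \<and> n0 \<le> r then 4 * h r else y r + h r)" for r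
    by (simp_all add: y_def)
  have ypos: "0 \<le> y r" for r
    by (induction r) (use Y h in \<open>auto simp: y0 ySuc less_imp_le intro!: add_nonneg_nonneg\<close>)
  have "Y \<le> y r" if "r \<le> n0" for r
    using that by (induction r) (use h in \<open>auto simp: y0 ySuc less_imp_le intro: add_increasing2\<close>)
  then have yn0: "Y \<le> y n0" by simp
  \<comment> \<open>At a stage that treats \<open>i\<close> this is \<open>y r + 4 h r\<close>, otherwise \<open>7 h r\<close>; in both cases it bounds the change of the coupling.\<close>
  define E where "E r = y r - y (Suc r) + 8 * h r" for r
  have Epos: "0 \<le> E r" for r
    using ypos[of r] h[of r] by (auto simp: E_def ySuc)
  have "summable E"
  proof (rule summableI_nonneg_bounded[OF Epos])
    fix n
    have "(\<Sum>r<n. E r) = y 0 - y n + 8 * (\<Sum>r<n. h r)"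
      by (induction n) (auto simp: E_def algebra_simps)
    moreover have "(\<Sum>r<n. h r) \<le> 2"
      unfolding h_def using geometric_sum[of "1/2::real" n] by simp
    ultimately show "(\<Sum>r<n. E r) \<le> Y + 16" using ypos[of n] y0 by linarith
  qed
  note E_lim = summable_LIMSEQ_zero[OF this]
  have facts: "\<bar>(T - t)^2 * P r t x * DV i (c r) 0 t x\<bar> \<le> h r"
    "\<bar>(T - t)^2 * e r * DV (c r) (c r) 0 t x\<bar> \<le> h r"
    "\<bar>2 * (T - t) * e r * apply_bcontfun x (c r, 0)\<bar> \<le> h r"
    "p r = i \<Longrightarrow> \<bar>residual (Q r) (l r) i t x - (T - t)^4 * e r * P r t x\<bar> \<le> h r"
    if "t \<in> {0..T}" "x \<in> linf d" "norm x \<le> R" "n0 \<le> r" for t x r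
  proof -
    have "norm x \<le> real r" using that(3) R[OF that(4)] by linarith
    then show "\<bar>(T - t)^2 * P r t x * DV i (c r) 0 t x\<bar> \<le> h r"
      "\<bar>(T - t)^2 * e r * DV (c r) (c r) 0 t x\<bar> \<le> h r"
      "\<bar>2 * (T - t) * e r * apply_bcontfun x (c r, 0)\<bar> \<le> h r"
      "p r = i \<Longrightarrow> \<bar>residual (Q r) (l r) i t x - (T - t)^4 * e r * P r t x\<bar> \<le> h r"
      using good[of r] that(1,2) i[OF that(4)] unfolding good_step_def h_def by blast+
  qed
  have residual_bound: "\<bar>residual (Q r) (l r) i t x\<bar> \<le> y r"
    if tx: "t \<in> {0..T}" "x \<in> linf d" "norm x \<le> R" and r: "n0 \<le> r" for t x r
    using r
  proof (induction r rule: dec_induct)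
    case base
    then show ?case using Y(2) tx yn0 by force
  next
    case (step r)
    have "residual (Q (Suc r)) (l (Suc r)) i t x = residual (Q r) (l r) i t x - change (p r) (c r) (e r) (P r) i t x
        - (if i = p r then 2 * (T - t) * e r * apply_bcontfun x (c r, 0) else 0)"
      unfolding Q_step l_step using i[OF step(1)] by (intro residual_step[OF adm c_new _ tx(1,2)]) auto
    then show ?case
      using facts[OF tx step(1)] step(1,3) unfolding change_def ySuc by (auto split: if_splits)
  qed
  have change_bound: "\<bar>change (p r) (c r) (e r) (P r) i t x\<bar> \<le> E r"
    if tx: "t \<in> {0..T}" "x \<in> linf d" "norm x \<le> R" and r: "n0 \<le> r" for t x r
    using facts[OF tx r] residual_bound[OF tx r] h[of r] r unfolding change_def E_def ySuc
    by (auto split: if_splits)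
  obtain M0 where M0: "M0 summable_on UNIV"
    "\<forall>j. \<forall>t\<in>{0..T}. \<forall>x\<in>linf d. norm x \<le> R \<longrightarrow> \<bar>coupling (Q n0) (l n0) i j t x\<bar> \<le> M0 j"
    using coupling_dominated[OF adm[of n0]] by blast
  \<comment> \<open>Each new player enters once, so the changes of all stages fit into one family indexed by the players.\<close>
  define M where "M j = M0 j + (if j \<in> range c then E (inv c j) else 0)" for j
  have M: "M summable_on UNIV"
    unfolding M_def by (intro summable_on_add M0(1) summable_on_along_injection inj_c Epos \<open>summable E\<close>)
  have dom: "\<bar>coupling (Q s) (l s) i j t x\<bar> \<le> M j"
    if tx: "t \<in> {0..T}" "x \<in> linf d" "norm x \<le> R" and s: "n0 \<le> s" for s j t x
  proof -
    have "\<bar>coupling (Q s) (l s) i j t x\<bar> \<le> M0 j + (if j \<in> c ` {n0..<s} then E (inv c j) else 0)"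
      using s
    proof (induction s rule: dec_induct)
      case base
      then show ?case using M0(2) tx by simp
    next
      case (step s)
      have eq: "coupling (Q (Suc s)) (l (Suc s)) i j t x = coupling (Q s) (l s) i j t x
          + (if j = c s then change (p s) (c s) (e s) (P s) i t x else 0)"
        unfolding Q_step l_step using i[OF step(1)] by (intro coupling_step[OF adm c_new]) auto
      have img: "c ` {n0..<Suc s} = insert (c s) (c ` {n0..<s})"
        using step(1) by (simp add: atLeastLessThanSuc)
      show ?case
      proof (cases "j = c s")
        case True
        then have "j \<notin> c ` {n0..<s}" "inv c j = s" using inj_c by (auto simp: inj_eq)
        then show ?thesis
          using step(3) change_bound[OF tx step(1)] True unfolding eq img by simp
      next
        case False
        then show ?thesis using step(3) unfolding eq img by simp
      qed
    qed
    also have "\<dots> \<le> M j" using Epos by (auto simp: M_def)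
    finally show ?thesis .
  qed
  have coupling_ev: "\<forall>\<^sub>F s in sequentially. coupling (Q s) (l s) i j t x = coupling Qlim llim i j t x" for j t x
    using eventually_ge_at_top[of "max n0 (stage j)"]
    by eventually_elim (use i in_U coupling_frozen in auto)
  have "\<bar>coupling Qlim llim i j t x\<bar> \<le> M j" if tx: "t \<in> {0..T}" "x \<in> linf d" "norm x \<le> R" for j t x
  proof -
    have "coupling (Q (max n0 (stage j))) (l (max n0 (stage j))) i j t x = coupling Qlim llim i j t x"
      by (intro coupling_frozen i in_U) auto
    then show ?thesis using dom[OF tx, of "max n0 (stage j)" j] by simp
  qed
  moreover have "residual Qlim llim i t x = 0" if tx: "t \<in> {0..T}" "x \<in> linf d" "norm x \<le> R" for t x
  proof -
    have "(\<lambda>s. \<Sum>\<^sub>\<infinity>j. coupling (Q s) (l s) i j t x) \<longlonglongrightarrow> (\<Sum>\<^sub>\<infinity>j. coupling Qlim llim i j t x)"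
      using dom[OF tx] by (intro infsum_dominated_limit[OF _ _ M] tendsto_eventually coupling_ev) auto
    moreover have "(\<lambda>s. source_term (Q s) (l s) i t x) \<longlonglongrightarrow> source_term Qlim llim i t x"
    proof -
      have "(\<lambda>s. Rem i t x
          - 2 * (T - t) * (apply_bcontfun x (i, 0) * Qlim i t x + (\<Sum>\<^sub>\<infinity>j. l s i j * apply_bcontfun x (j, 0)))
          + (T - t)^2 * (apply_bcontfun x (i, 0)
              * (deriv (\<lambda>s. Qlim i s x) t + (\<Sum>\<^sub>\<infinity>j. entry_laplacian d j (Qlim i t) x))))
        \<longlonglongrightarrow> source_term Qlim llim i t x"
        unfolding source_term_def by (intro tendsto_intros link_sum_limit)
      moreover have "\<forall>\<^sub>F s in sequentially. Q s i = Qlim i"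
        using eventually_ge_at_top[of n0] by eventually_elim (use i Qlim_eq in auto)
      then have "\<forall>\<^sub>F s in sequentially. Rem i t x
          - 2 * (T - t) * (apply_bcontfun x (i, 0) * Qlim i t x + (\<Sum>\<^sub>\<infinity>j. l s i j * apply_bcontfun x (j, 0)))
          + (T - t)^2 * (apply_bcontfun x (i, 0)
              * (deriv (\<lambda>s. Qlim i s x) t + (\<Sum>\<^sub>\<infinity>j. entry_laplacian d j (Qlim i t) x)))
        = source_term (Q s) (l s) i t x"
        by eventually_elim (simp add: source_term_def)
      ultimately show ?thesis by (rule Lim_transform_eventually)
    qed
    ultimately have lim: "(\<lambda>s. residual (Q s) (l s) i t x) \<longlonglongrightarrow> residual Qlim llim i t x"
      unfolding residual_def by (intro tendsto_diff)
    have turn: "\<bar>residual (Q s) (l s) i t x\<bar> \<le> E s" if "n0 \<le> s" "p s = i" for s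
      using residual_bound[OF tx that(1)] that h[of s] by (simp add: E_def ySuc)
    have "\<bar>residual Qlim llim i t x\<bar> \<le> \<epsilon>" if "0 < \<epsilon>" for \<epsilon>
    proof -
      have "\<forall>\<^sub>F s in sequentially. dist (residual (Q s) (l s) i t x) (residual Qlim llim i t x) < \<epsilon>/2"
        "\<forall>\<^sub>F s in sequentially. dist (E s) 0 < \<epsilon>/2"
        using tendstoD[OF lim, of "\<epsilon>/2"] tendstoD[OF E_lim, of "\<epsilon>/2"] that by simp_all
      then have "\<forall>\<^sub>F s in sequentially. dist (residual (Q s) (l s) i t x) (residual Qlim llim i t x) < \<epsilon>/2
          \<and> dist (E s) 0 < \<epsilon>/2"
        by (rule eventually_conj)
      then obtain N where N: "\<And>s. N \<le> s \<Longrightarrow> dist (residual (Q s) (l s) i t x) (residual Qlim llim i t x) < \<epsilon>/2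
          \<and> dist (E s) 0 < \<epsilon>/2"
        unfolding eventually_sequentially by blast
      obtain s where s: "max n0 N \<le> s" "p s = i" using often by blast
      have "\<bar>residual (Q s) (l s) i t x - residual Qlim llim i t x\<bar> < \<epsilon>/2" "\<bar>E s\<bar> < \<epsilon>/2"
        "\<bar>residual (Q s) (l s) i t x\<bar> \<le> E s"
        using N[of s] turn[of s] s by (auto simp: dist_real_def)
      then show ?thesis by linarith
    qed
    then show ?thesis by (metis abs_le_zero_iff field_le_epsilon add_0)
  qed
  ultimately show ?thesis using M by blast
qed

lemma Qlim_cyl: "\<exists>S. finite S \<and> i \<notin> S \<and> cyl S (Qlim i)"
proof -
  have "admissible (U (stage i)) (Q (stage i)) (l (stage i))" by (rule adm)
  then show ?thesis unfolding admissible_def Qlim_def by (meson finite_subset)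
qed

lemma llim_self: "llim i i = 0"
  using adm[of "stage i"] unfolding admissible_def llim_def by blast

end

context flexible_drift
begin

text \<open>
  The sequence of corrections is built by dependent choice, starting from no corrections at all. The order of treatment
  \<open>p\<close> decodes a pair of numbers, so that every player recurs at arbitrarily late stages.
\<close>

theorem residual_cancellation:
  "\<exists>Q l. (\<forall>i. \<exists>S. finite S \<and> i \<notin> S \<and> cyl S (Q i)) \<and>
     (\<forall>i. l i summable_on UNIV \<and> (\<forall>j. 0 \<le> l i j) \<and> l i i = 0) \<and>
     (\<forall>i R. \<exists>M. M summable_on UNIV \<and>
        (\<forall>t\<in>{0..T}. \<forall>x\<in>linf d. norm x \<le> R \<longrightarrow>
          (\<forall>j. \<bar>coupling Q l i j t x\<bar> \<le> M j) \<and> residual Q l i t x = 0))"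
proof -
  define p where "p s = int_decode (fst (prod_decode s))" for s
  have often: "\<exists>s\<ge>n. p s = i" for n i
    by (rule exI[of _ "prod_encode (int_encode i, n)"]) (simp add: p_def le_prod_encode_2)
  define ok where "ok st = (case st of (U, Q, l) \<Rightarrow> admissible U Q l)" for st
  define nxt where "nxt s st st' = (case st of (U, Q, l) \<Rightarrow> case st' of (U', Q', l') \<Rightarrow>
     \<exists>c e P. good_step s (p s) U Q l c e P \<and> insert c (insert (p s) U) \<subseteq> U' \<and>
       Q' = Q(c := P) \<and> l' = l(p s := (l (p s))(c := e)))" for s st st'
  have "\<exists>st. st 0 = ({}, (\<lambda>_ _ _. 0), (\<lambda>_ _. 0)) \<and> (\<forall>s. ok (st s) \<and> nxt s (st s) (st (Suc s)))"
  proof -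
    have "\<exists>st. \<forall>s. (ok (st s) \<and> (s = 0 \<longrightarrow> st s = ({}, (\<lambda>_ _ _. 0), (\<lambda>_ _. 0)))) \<and> nxt s (st s) (st (Suc s))"
    proof (rule dependent_nat_choice)
      show "\<exists>st. ok st \<and> ((0::nat) = 0 \<longrightarrow> st = ({}, (\<lambda>_ _ _. 0), (\<lambda>_ _. 0)))"
        by (rule exI[of _ "({}, (\<lambda>_ _ _. 0), (\<lambda>_ _. 0))"])
           (auto simp: ok_def admissible_def intro: cyl_const)
    next
      fix st and s :: nat
      assume "ok st \<and> (s = 0 \<longrightarrow> st = ({}, (\<lambda>_ _ _. 0), (\<lambda>_ _. 0)))"
      then obtain U Q l where st: "st = (U, Q, l)" "admissible U Q l"
        unfolding ok_def by (cases st) auto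
      from good_step_exists[OF st(2), of s "p s"]
      obtain c e P U' where 1: "good_step s (p s) U Q l c e P" "insert c (insert (p s) U) \<subseteq> U'"
        "admissible U' (Q(c := P)) (l(p s := (l (p s))(c := e)))" .
      show "\<exists>st'. (ok st' \<and> (Suc s = 0 \<longrightarrow> st' = ({}, (\<lambda>_ _ _. 0), (\<lambda>_ _. 0)))) \<and> nxt s st st'"
        by (rule exI[of _ "(U', Q(c := P), l(p s := (l (p s))(c := e)))"])
           (use 1 st(1) in \<open>auto simp: ok_def nxt_def\<close>)
    qed
    then show ?thesis by blast
  qed
  then obtain st where st: "st 0 = ({}, (\<lambda>_ _ _. 0), (\<lambda>_ _. 0))" "\<And>s. ok (st s)" "\<And>s. nxt s (st s) (st (Suc s))"
    by blast
  define U where "U s = fst (st s)" for s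
  define Q where "Q s = fst (snd (st s))" for s
  define l where "l s = snd (snd (st s))" for s
  have "\<exists>c e P. good_step s (p s) (U s) (Q s) (l s) c e P \<and> insert c (insert (p s) (U s)) \<subseteq> U (Suc s) \<and>
       Q (Suc s) = (Q s)(c := P) \<and> l (Suc s) = (l s)(p s := (l s (p s))(c := e))" for s
    using st(3)[of s] by (simp add: nxt_def U_def Q_def l_def case_prod_beta)
  then obtain c e P where cep: "\<And>s. good_step s (p s) (U s) (Q s) (l s) (c s) (e s) (P s) \<and>
      insert (c s) (insert (p s) (U s)) \<subseteq> U (Suc s) \<and>
       Q (Suc s) = (Q s)(c s := P s) \<and> l (Suc s) = (l s)(p s := (l s (p s))(c s := e s))"
    by metis
  interpret correction_sequence d T DV Rem w p U Q l c e P
  proof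
    show "admissible (U s) (Q s) (l s)" for s
      using st(2)[of s] by (simp add: ok_def U_def Q_def l_def case_prod_beta)
  qed (use often cep st(1) in \<open>auto simp: U_def\<close>)
  show ?thesis
    using Qlim_cyl llim_summable llim_bounds(1) llim_self limit_dominated_and_exact
    by (intro exI[of _ Qlim] exI[of _ llim] conjI allI) auto
qed

end

section \<open>Quadratic forms with dominated coefficients\<close>

definition quad_polar :: "nat \<Rightarrow> (int \<Rightarrow> int \<Rightarrow> real) \<Rightarrow> seqs \<Rightarrow> seqs \<Rightarrow> real" where
  "quad_polar d M x y
    = (\<Sum>\<^sub>\<infinity>(h, k). M h k * (\<Sum>a<d. apply_bcontfun x (h, a) * apply_bcontfun y (k, a)))"

definition row_form :: "(int \<Rightarrow> int \<Rightarrow> real) \<Rightarrow> int \<Rightarrow> nat \<Rightarrow> seqs \<Rightarrow> real" where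
  "row_form M j a x = (\<Sum>\<^sub>\<infinity>k. M j k * apply_bcontfun x (k, a))"

lemma quad_cost_polar: "quad_cost d M x = 1/2 * quad_polar d M x x"
  by (simp add: quad_cost_def quad_polar_def entry_inner_def)

definition coeffs_le :: "real \<Rightarrow> (int \<Rightarrow> real) \<Rightarrow> (int \<Rightarrow> int \<Rightarrow> real) \<Rightarrow> bool" where
  "coeffs_le K b M \<longleftrightarrow> (\<forall>h k. \<bar>M h k\<bar> \<le> K * (b h * b k))"

lemma coeffs_le_mono: "coeffs_le K b M \<Longrightarrow> K \<le> L \<Longrightarrow> (\<And>h. 0 \<le> b h) \<Longrightarrow> coeffs_le L b M"
  unfolding coeffs_le_def by (meson mult_nonneg_nonneg mult_right_mono order_trans)

lemma entry_products_le:
  fixes x y :: seqs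
  shows "\<bar>\<Sum>a<d. apply_bcontfun x (h, a) * apply_bcontfun y (k, a)\<bar> \<le> real d * (norm x * norm y)"
proof -
  have "\<bar>\<Sum>a<d. apply_bcontfun x (h, a) * apply_bcontfun y (k, a)\<bar> \<le> (\<Sum>a<d. norm x * norm y)"
    by (intro order_trans[OF sum_abs] sum_mono)
       (simp add: abs_mult mult_mono coord_le_norm[of x] coord_le_norm[of y])
  then show ?thesis by simp
qed

context
  fixes K :: real and b :: "int \<Rightarrow> real" and d :: nat
  assumes K: "0 \<le> K" and b: "\<And>h. 0 \<le> b h" and b_sum: "b summable_on UNIV"
begin

lemma weights_summable: "(\<lambda>(h, k). b h * b k) summable_on UNIV"
  by (rule summable_on_products) (use b b_sum in auto)

lemma polar_terms_le:
  assumes "coeffs_le K b M"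
  shows "\<bar>(case p of (h, k) \<Rightarrow> M h k * (\<Sum>a<d. apply_bcontfun x (h, a) * apply_bcontfun y (k, a)))\<bar>
    \<le> (case p of (h, k) \<Rightarrow> b h * b k) * (K * (real d * (norm x * norm y)))"
proof (cases p)
  case (Pair h k)
  have "\<bar>M h k * (\<Sum>a<d. apply_bcontfun x (h, a) * apply_bcontfun y (k, a))\<bar>
      \<le> K * (b h * b k) * (real d * (norm x * norm y))"
    unfolding abs_mult using assms K b entry_products_le
    by (intro mult_mono) (auto simp: coeffs_le_def)
  then show ?thesis by (simp add: Pair algebra_simps)
qed

lemma polar_bound_summable: "(\<lambda>p. (case p of (h, k) \<Rightarrow> b h * b k) * c) summable_on UNIV"
  by (rule summable_on_cmult_left[OF weights_summable])

lemma polar_summable: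
  assumes "coeffs_le K b M"
  shows "(\<lambda>(h, k). M h k * (\<Sum>a<d. apply_bcontfun x (h, a) * apply_bcontfun y (k, a))) summable_on UNIV"
  by (rule summable_on_dominated[OF polar_bound_summable polar_terms_le[OF assms]])

lemma polar_bound:
  assumes "coeffs_le K b M"
  shows "\<bar>quad_polar d M x y\<bar> \<le> ((\<Sum>\<^sub>\<infinity>(h, k). b h * b k) * K * real d) * norm x * norm y"
proof -
  have "\<bar>quad_polar d M x y\<bar> \<le> (\<Sum>\<^sub>\<infinity>(h, k). b h * b k) * (K * (real d * (norm x * norm y)))"
    using infsum_le_bound[OF polar_bound_summable polar_terms_le[OF assms], of x y]
    unfolding infsum_cmult_left' quad_polar_def .
  then show ?thesis by (simp add: mult.assoc)
qed

lemma polar_add: 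
  assumes "coeffs_le K b M"
  shows "quad_polar d M (x + x') y = quad_polar d M x y + quad_polar d M x' y"
  unfolding quad_polar_def infsum_add[OF polar_summable[OF assms] polar_summable[OF assms], symmetric]
  by (intro infsum_cong) (auto simp: sum.distrib distrib_left distrib_right)

lemma polar_scale: "quad_polar d M (r *\<^sub>R x) y = r * quad_polar d M x y"
  unfolding quad_polar_def infsum_cmult_right'[symmetric]
  by (intro infsum_cong) (auto simp: sum_distrib_left algebra_simps)

lemma polar_sym:
  assumes "\<And>h k. M h k = M k h"
  shows "quad_polar d M x y = quad_polar d M y x"
proof -
  have "quad_polar d M x y = (\<Sum>\<^sub>\<infinity>(k, h). M h k * (\<Sum>a<d. apply_bcontfun x (h, a) * apply_bcontfun y (k, a)))"
    unfolding quad_polar_def by (rule infsum_swap_pair)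
  then show ?thesis unfolding quad_polar_def using assms by (simp add: mult.commute)
qed

lemma row_terms_le:
  fixes x :: seqs
  assumes "coeffs_le K b M"
  shows "\<bar>M j k * apply_bcontfun x (k, a)\<bar> \<le> (K * b j * norm x) * b k"
proof -
  have "\<bar>M j k * apply_bcontfun x (k, a)\<bar> \<le> K * (b j * b k) * norm x"
    unfolding abs_mult using assms K b coord_le_norm[of x "(k, a)"]
    by (intro mult_mono) (auto simp: coeffs_le_def)
  then show ?thesis by (simp add: algebra_simps)
qed

lemma row_summable:
  fixes x :: seqs
  assumes "coeffs_le K b M"
  shows "(\<lambda>k. M j k * apply_bcontfun x (k, a)) summable_on UNIV"
  by (rule summable_on_dominated[OF summable_on_cmult_right[OF b_sum] row_terms_le[OF assms]])

lemma row_bound: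
  assumes "coeffs_le K b M"
  shows "\<bar>row_form M j a x\<bar> \<le> K * (\<Sum>\<^sub>\<infinity>k. b k) * b j * norm x"
  using infsum_le_bound[OF summable_on_cmult_right[OF b_sum] row_terms_le[OF assms]]
  by (simp add: row_form_def infsum_cmult_right' algebra_simps)

text \<open>
  Testing the polar form with a unit vector selects one row of the coefficient matrix, which is the partial derivative of
  the quadratic form.
\<close>

lemma polar_unit:
  assumes M: "coeffs_le K b M" and sym: "\<And>h k. M h k = M k h" and a: "a < d"
  shows "quad_polar d M x (unit_seq j a) = row_form M j a x"
proof -
  have inner: "(\<Sum>a'<d. apply_bcontfun x (h, a') * apply_bcontfun (unit_seq j a) (k, a'))
      = (if k = j then apply_bcontfun x (h, a) else 0)" for h k
  proof -
    have "(\<Sum>a'<d. apply_bcontfun x (h, a') * apply_bcontfun (unit_seq j a) (k, a'))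
       = (\<Sum>a'<d. if a' = a then (if k = j then apply_bcontfun x (h, a) else 0) else 0)"
      by (rule sum.cong) (auto simp: apply_unit_seq)
    then show ?thesis using a by simp
  qed
  have "quad_polar d M x (unit_seq j a) = (\<Sum>\<^sub>\<infinity>h. \<Sum>\<^sub>\<infinity>k. M h k * (if k = j then apply_bcontfun x (h, a) else 0))"
    using infsum_pairs[OF polar_summable[OF M, of x "unit_seq j a"]]
    unfolding quad_polar_def inner by simp
  also have "\<dots> = (\<Sum>\<^sub>\<infinity>h. M j h * apply_bcontfun x (h, a))"
  proof (rule infsum_cong)
    fix h
    show "(\<Sum>\<^sub>\<infinity>k. M h k * (if k = j then apply_bcontfun x (h, a) else 0)) = M j h * apply_bcontfun x (h, a)"
      by (subst infsum_finite_support[of "{j}"]) (auto simp: sym[of h j])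
  qed
  finally show ?thesis by (simp add: row_form_def)
qed

lemma row_line:
  assumes M: "coeffs_le K b M"
  shows "row_form M j a (x + s *\<^sub>R unit_seq j a) = row_form M j a x + s * M j j"
proof -
  have "row_form M j a (x + s *\<^sub>R unit_seq j a)
     = (\<Sum>\<^sub>\<infinity>k. M j k * apply_bcontfun x (k, a) + (if k = j then s * M j j else 0))"
    unfolding row_form_def by (rule infsum_cong) (auto simp: apply_unit_seq algebra_simps)
  also have "\<dots> = row_form M j a x + s * M j j"
    unfolding row_form_def by (rule infsum_add_single[OF row_summable[OF M]])
  finally show ?thesis .
qed

lemma quad_smooth:
  assumes S: "subspace S" and M: "coeffs_le K b M" and sym: "\<And>h k. M h k = M k h"
  shows "smooth_fun S (quad_cost d M)"
  unfolding quad_cost_polar[abs_def]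
  by (rule smooth_fun_quadratic[OF S _ _ _ polar_bound[OF M]])
     (use K b in \<open>auto intro!: polar_add[OF M] polar_scale polar_sym sym mult_nonneg_nonneg infsum_nonneg\<close>)

lemma quad_line_derivative:
  assumes M: "coeffs_le K b M" and sym: "\<And>h k. M h k = M k h" and a: "a < d"
  shows "((\<lambda>s. quad_cost d M (x + s *\<^sub>R unit_seq j a)) has_real_derivative row_form M j a x) (at 0)"
proof -
  have "((\<lambda>s. 1/2 * quad_polar d M (x + s *\<^sub>R unit_seq j a) (x + s *\<^sub>R unit_seq j a))
      has_real_derivative quad_polar d M x (unit_seq j a)) (at 0)"
    by (rule smooth_bd_quadratic(2)[OF subspace_UNIV _ _ _ polar_bound[OF M]])
       (use K b in \<open>auto intro!: polar_add[OF M] polar_scale polar_sym sym mult_nonneg_nonneg infsum_nonneg\<close>)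
  then show ?thesis unfolding quad_cost_polar polar_unit[OF M sym a] .
qed

lemma quad_add_scaled:
  assumes M: "coeffs_le K b M" and N: "coeffs_le K b N"
  shows "quad_cost d (\<lambda>h k. M h k + r * N h k) x = quad_cost d M x + r * quad_cost d N x"
proof -
  have "quad_polar d (\<lambda>h k. M h k + r * N h k) x x
    = (\<Sum>\<^sub>\<infinity>p. (case p of (h, k) \<Rightarrow> M h k * (\<Sum>a<d. apply_bcontfun x (h, a) * apply_bcontfun x (k, a)))
        + r * (case p of (h, k) \<Rightarrow> N h k * (\<Sum>a<d. apply_bcontfun x (h, a) * apply_bcontfun x (k, a))))"
    unfolding quad_polar_def by (intro infsum_cong) (auto simp: algebra_simps)
  also have "\<dots> = quad_polar d M x x + r * quad_polar d N x x"
    unfolding quad_polar_def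
    by (subst infsum_add) (auto intro!: polar_summable[OF M] polar_summable[OF N] summable_on_cmult_right simp: infsum_cmult_right')
  finally show ?thesis by (simp add: quad_cost_polar algebra_simps)
qed

end

text \<open>
  Multiply the two series and exchange the resulting double series with the finite sum over the components.
\<close>

lemma row_form_products:
  assumes "M1 summable_on UNIV" "M2 summable_on UNIV" "\<And>h. 0 \<le> M1 h" "\<And>k. 0 \<le> M2 k"
    and "\<And>h. \<bar>M j h\<bar> \<le> M1 h" "\<And>k. \<bar>N j k\<bar> \<le> M2 k"
  shows "(\<Sum>a<d. row_form M j a x * row_form N j a x) = (\<Sum>\<^sub>\<infinity>(h, k). M j h * N j k * entry_inner d x h k)"
proof -
  have bd: "\<bar>M j h * apply_bcontfun x (h, a)\<bar> \<le> M1 h * norm x"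
     "\<bar>N j h * apply_bcontfun x (h, a)\<bar> \<le> M2 h * norm x" for h a
    unfolding abs_mult using assms coord_le_norm[of x "(h, a)"] by (auto intro!: mult_mono)
  have sm: "(\<lambda>(h, k). (M j h * apply_bcontfun x (h, a)) * (N j k * apply_bcontfun x (k, a))) summable_on UNIV" for a
  proof (rule summable_on_dominated)
    show "(\<lambda>(h, k). (M1 h * norm x) * (M2 k * norm x)) summable_on UNIV"
      by (rule summable_on_products) (use assms in \<open>auto intro: summable_on_cmult_left\<close>)
    fix p :: "int \<times> int"
    show "\<bar>case p of (h, k) \<Rightarrow> (M j h * apply_bcontfun x (h, a)) * (N j k * apply_bcontfun x (k, a))\<bar>
       \<le> (case p of (h, k) \<Rightarrow> (M1 h * norm x) * (M2 k * norm x))"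
      using bd assms by (cases p) (simp add: abs_mult[of "M j _ * _"] mult_mono)
  qed
  have "row_form M j a x * row_form N j a x
      = (\<Sum>\<^sub>\<infinity>(h, k). (M j h * apply_bcontfun x (h, a)) * (N j k * apply_bcontfun x (k, a)))" for a
    unfolding row_form_def infsum_pairs[OF sm[of a], symmetric] prod.case
    by (simp add: infsum_cmult_right' infsum_cmult_left')
  then have "(\<Sum>a<d. row_form M j a x * row_form N j a x)
     = (\<Sum>\<^sub>\<infinity>p. \<Sum>a<d. case p of (h, k) \<Rightarrow> (M j h * apply_bcontfun x (h, a)) * (N j k * apply_bcontfun x (k, a)))"
    using infsum_finite_sum[of "{..<d}" "\<lambda>a (h, k). (M j h * apply_bcontfun x (h, a)) * (N j k * apply_bcontfun x (k, a))"] sm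
    by simp
  also have "\<dots> = (\<Sum>\<^sub>\<infinity>(h, k). M j h * N j k * entry_inner d x h k)"
    by (intro infsum_cong) (auto simp: entry_inner_def sum_distrib_left algebra_simps)
  finally show ?thesis .
qed

section \<open>The part forced by the terminal condition\<close>

lemma shift_invariant_origin:
  assumes "shift_invariant M"
  shows "M i h k = M 0 (h - i) (k - i)"
proof (induction i arbitrary: h k rule: int_induct[of _ 0])
  case (step1 i)
  have "M (i + 1) h k = M i (h - 1) (k - 1)" using assms unfolding shift_invariant_def by blast
  then show ?case using step1(2)[of "h - 1" "k - 1"] by (simp add: algebra_simps)
next
  case (step2 i)
  have "M (i - 1 + 1) (h + 1) (k + 1) = M (i - 1) (h + 1 - 1) (k + 1 - 1)"
    using assms unfolding shift_invariant_def by blast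
  then show ?case using step2(2)[of "h + 1" "k + 1"] by (simp add: algebra_simps)
qed simp

text \<open>
  The shift-invariant bounds on \<open>f\<close> and \<open>g\<close> enter as bounds of the \<open>i\<close>-th matrices by \<open>\<beta>\<^sub>h\<^sub>-\<^sub>i \<beta>\<^sub>k\<^sub>-\<^sub>i\<close>, and
  self-control as the estimate of \<open>\<beta> * \<beta>\<close> by a multiple of \<open>\<beta>\<close>.
\<close>

locale quadratic_game =
  fixes \<beta> :: "int \<Rightarrow> real" and C C' :: real and d :: nat and T :: real
    and f :: "int \<Rightarrow> int \<Rightarrow> int \<Rightarrow> real \<Rightarrow> real" and g :: "int \<Rightarrow> int \<Rightarrow> int \<Rightarrow> real"
  assumes \<beta>_pos: "0 < \<beta> i" and \<beta>_sum: "\<beta> summable_on UNIV"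
    and C'_pos: "0 < C'" and conv: "(\<Sum>\<^sub>\<infinity>j. \<beta> j * \<beta> (i - j)) \<le> C' * \<beta> i"
    and C_pos: "0 < C" and d: "1 \<le> d" and T: "0 < T"
    and f_sym: "t \<in> {0..T} \<Longrightarrow> f i h k t = f i k h t" and g_sym: "g i h k = g i k h"
    and f_bound: "t \<in> {0..T} \<Longrightarrow> coeffs_le C (\<lambda>h. \<beta> (h - i)) (\<lambda>h k. f i h k t)"
    and g_bound: "coeffs_le C (\<lambda>h. \<beta> (h - i)) (g i)"
    and f_cont: "continuous_on {0..T} (f i h k)"
begin

lemma \<beta>_nonneg: "0 \<le> \<beta> i"
  using \<beta>_pos less_imp_le by blast

lemma \<beta>_shift_sum: "(\<lambda>h. \<beta> (h - i)) summable_on UNIV" "(\<Sum>\<^sub>\<infinity>h. \<beta> (h - i)) = (\<Sum>\<^sub>\<infinity>h. \<beta> h)"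
  using \<beta>_sum summable_on_shift infsum_reindex_bij_betw[OF bij_int_shift, of \<beta> i] by auto

lemma \<beta>_le_sum: "\<beta> i \<le> (\<Sum>\<^sub>\<infinity>h. \<beta> h)"
  using finite_sum_le_infsum[OF \<beta>_sum, of "{i}"] \<beta>_nonneg by simp

lemma convolution:
  "(\<lambda>j. \<beta> (h - j) * \<beta> (j - i)) summable_on UNIV"
  "(\<Sum>\<^sub>\<infinity>j. \<beta> (h - j) * \<beta> (j - i)) \<le> C' * \<beta> (h - i)"
proof -
  show "(\<lambda>j. \<beta> (h - j) * \<beta> (j - i)) summable_on UNIV"
    by (rule summable_on_dominated[OF summable_on_cmult_right[OF \<beta>_shift_sum(1)], of _ "\<Sum>\<^sub>\<infinity>h. \<beta> h" i])
       (simp add: abs_mult \<beta>_nonneg mult_right_mono \<beta>_le_sum)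
  have "(\<Sum>\<^sub>\<infinity>j. \<beta> (h - j) * \<beta> (j - i)) = (\<Sum>\<^sub>\<infinity>j. \<beta> j * \<beta> (h - i - j))"
    using infsum_reindex_bij_betw[OF bij_int_shift, of "\<lambda>j. \<beta> j * \<beta> (h - i - j)" i]
    by (simp add: algebra_simps)
  then show "(\<Sum>\<^sub>\<infinity>j. \<beta> (h - j) * \<beta> (j - i)) \<le> C' * \<beta> (h - i)" using conv[of "h - i"] by simp
qed

text \<open>
  The matrix of the quadratic form \<open>\<Sum>\<^sub>j D\<^sub>j q\<^sup>j \<cdot> D\<^sub>j q\<^sup>i\<close> (with the self weight) for the terminal costs \<open>q\<close>. It is not
  symmetric, so \<open>slope\<close> contains it together with its transpose.
\<close>

definition interaction :: "int \<Rightarrow> int \<Rightarrow> int \<Rightarrow> real" where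
  "interaction i h k = (\<Sum>\<^sub>\<infinity>j. self_weight i j * (g j j h * g i j k))"

text \<open>
  The equation at \<open>t = T\<close> prescribes \<open>- \<partial>\<^sub>t u\<^sup>i\<close>; this is the matrix of its quadratic part, and \<open>slope_trace\<close>
  its constant part, the Laplacian of the terminal cost.
\<close>

definition slope :: "int \<Rightarrow> int \<Rightarrow> int \<Rightarrow> real" where
  "slope i h k = f i h k T - interaction i h k - interaction i k h"

definition slope_trace :: "int \<Rightarrow> real" where
  "slope_trace i = (\<Sum>\<^sub>\<infinity>j. real d * g i j j)"

definition base_coeff :: "int \<Rightarrow> real \<Rightarrow> int \<Rightarrow> int \<Rightarrow> real" where
  "base_coeff i t h k = g i h k + (T - t) * slope i h k"

definition slope_size :: real where "slope_size = C + 2 * (C * C * \<beta> 0 * C')"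
definition coeff_size :: real where "coeff_size = C + T * slope_size"
definition decay :: "int \<Rightarrow> real" where "decay j = coeff_size * (\<Sum>\<^sub>\<infinity>h. \<beta> h) * \<beta> j"

lemma size_facts: "0 \<le> C * C * \<beta> 0 * C'" "0 < slope_size" "0 < coeff_size" "C \<le> slope_size" "C * C * \<beta> 0 * C' \<le> slope_size"
  using C_pos C'_pos \<beta>_pos[of 0] T by (auto simp: slope_size_def coeff_size_def add_pos_nonneg)

lemma interaction_terms: "\<bar>self_weight i j * (g j j h * g i j k)\<bar> \<le> C * C * \<beta> 0 * \<beta> (k - i) * (\<beta> (h - j) * \<beta> (j - i))"
proof -
  have "\<bar>g j j h\<bar> \<le> C * (\<beta> 0 * \<beta> (h - j))" "\<bar>g i j k\<bar> \<le> C * (\<beta> (j - i) * \<beta> (k - i))"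
    using g_bound[of j] g_bound[of i] unfolding coeffs_le_def by (metis diff_self, blast)
  then have "\<bar>g j j h\<bar> * \<bar>g i j k\<bar> \<le> (C * (\<beta> 0 * \<beta> (h - j))) * (C * (\<beta> (j - i) * \<beta> (k - i)))"
    using C_pos \<beta>_nonneg by (intro mult_mono) auto
  moreover have "\<bar>self_weight i j * (g j j h * g i j k)\<bar> \<le> 1 * (\<bar>g j j h\<bar> * \<bar>g i j k\<bar>)"
    unfolding abs_mult using self_weight_bounds[of i j] by (intro mult_right_mono) auto
  ultimately show ?thesis by (simp add: algebra_simps)
qed

text \<open>
  The sum over \<open>j\<close> leads to the convolution \<open>\<Sum>\<^sub>j \<beta>\<^sub>h\<^sub>-\<^sub>j \<beta>\<^sub>j\<^sub>-\<^sub>i\<close>, to which self-control applies. The other two factors are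
  \<open>\<beta>\<^sub>0\<close>, the decay of \<open>g\<^sup>j\<close> in its own entry, and \<open>\<beta>\<^sub>k\<^sub>-\<^sub>i\<close>.
\<close>

lemma interaction_bound: "coeffs_le (C * C * \<beta> 0 * C') (\<lambda>h. \<beta> (h - i)) (interaction i)"
  unfolding coeffs_le_def
proof (intro allI)
    fix h k
    have "\<bar>interaction i h k\<bar> \<le> C * C * \<beta> 0 * \<beta> (k - i) * (\<Sum>\<^sub>\<infinity>j. \<beta> (h - j) * \<beta> (j - i))"
      unfolding interaction_def infsum_cmult_right'[symmetric]
      by (rule infsum_le_bound[OF summable_on_cmult_right[OF convolution(1)] interaction_terms])
    also have "\<dots> \<le> C * C * \<beta> 0 * \<beta> (k - i) * (C' * \<beta> (h - i))"
      using C_pos \<beta>_nonneg by (intro mult_left_mono convolution(2)) auto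
    finally show "\<bar>interaction i h k\<bar> \<le> C * C * \<beta> 0 * C' * (\<beta> (h - i) * \<beta> (k - i))"
      by (simp add: algebra_simps)
qed

lemma interaction_le_slope_size: "coeffs_le slope_size (\<lambda>h. \<beta> (h - i)) (interaction i)"
  by (rule coeffs_le_mono[OF interaction_bound]) (use size_facts \<beta>_nonneg in auto)

lemma slope_bound: "coeffs_le slope_size (\<lambda>h. \<beta> (h - i)) (slope i)"
  unfolding coeffs_le_def
proof (intro allI)
  fix h k
  have m: "\<bar>interaction i h k\<bar> \<le> C * C * \<beta> 0 * C' * (\<beta> (h - i) * \<beta> (k - i))" for h k
    using interaction_bound[of i] unfolding coeffs_le_def by blast
  have "\<bar>f i h k T\<bar> \<le> C * (\<beta> (h - i) * \<beta> (k - i))"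
    using f_bound[of T i] T unfolding coeffs_le_def by simp
  then have "\<bar>slope i h k\<bar> \<le> C * (\<beta> (h - i) * \<beta> (k - i)) + C * C * \<beta> 0 * C' * (\<beta> (h - i) * \<beta> (k - i))
      + C * C * \<beta> 0 * C' * (\<beta> (k - i) * \<beta> (h - i))"
    using m[of h k] m[of k h] unfolding slope_def by linarith
  then show "\<bar>slope i h k\<bar> \<le> slope_size * (\<beta> (h - i) * \<beta> (k - i))"
    by (simp add: slope_size_def algebra_simps)
qed

lemma base_coeff_bound:
  assumes t: "t \<in> {0..T}"
  shows "coeffs_le coeff_size (\<lambda>h. \<beta> (h - i)) (base_coeff i t)"
  unfolding coeffs_le_def
proof (intro allI)
  fix h k
  have "\<bar>(T - t) * slope i h k\<bar> \<le> T * (slope_size * (\<beta> (h - i) * \<beta> (k - i)))"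
    unfolding abs_mult using t slope_bound[of i] size_facts(2) \<beta>_nonneg
    by (intro mult_mono) (auto simp: coeffs_le_def)
  moreover have "\<bar>g i h k\<bar> \<le> C * (\<beta> (h - i) * \<beta> (k - i))"
    using g_bound[of i] unfolding coeffs_le_def by blast
  ultimately have "\<bar>base_coeff i t h k\<bar> \<le> C * (\<beta> (h - i) * \<beta> (k - i)) + T * (slope_size * (\<beta> (h - i) * \<beta> (k - i)))"
    unfolding base_coeff_def by linarith
  then show "\<bar>base_coeff i t h k\<bar> \<le> coeff_size * (\<beta> (h - i) * \<beta> (k - i))"
    by (simp add: coeff_size_def algebra_simps)
qed

lemma slope_sym: "slope i h k = slope i k h"
  using f_sym[of T i h k] T by (simp add: slope_def)

lemma base_coeff_sym: "base_coeff i t h k = base_coeff i t k h"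
  using g_sym slope_sym by (simp add: base_coeff_def)

lemmas weight_facts = less_imp_le[OF size_facts(3)] \<beta>_nonneg \<beta>_shift_sum(1)

definition base_grad :: "int \<Rightarrow> int \<Rightarrow> nat \<Rightarrow> real \<Rightarrow> seqs \<Rightarrow> real" where
  "base_grad i j a t x = row_form (base_coeff i t) j a x"

definition base_source :: "int \<Rightarrow> real \<Rightarrow> seqs \<Rightarrow> real" where
  "base_source i t x = quad_cost d (\<lambda>h k. f i h k t) x - quad_cost d (slope i) x - slope_trace i
     + (\<Sum>\<^sub>\<infinity>j. real d * base_coeff i t j j)"

lemma base_grad_bound:
  assumes "t \<in> {0..T}"
  shows "\<bar>base_grad i j a t x\<bar> \<le> decay (j - i) * norm x"
  using row_bound[OF weight_facts base_coeff_bound[OF assms, of i], where j = j and a = a and x = x]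
  by (simp add: base_grad_def decay_def \<beta>_shift_sum(2))

lemma time_appr: "appr T d (\<lambda>t x. T - t)"
  by (rule cyl_appr[of "{}"]) (auto intro!: cyl_diff cyl.intros)

lemma base_coeff_appr: "appr T d (\<lambda>t x. base_coeff i t h k)"
  unfolding base_coeff_def by (intro appr_add appr_mult appr_const time_appr)

lemma base_grad_appr: "appr T d (base_grad i j a)"
proof -
  have "appr T d (\<lambda>t x. \<Sum>\<^sub>\<infinity>k. base_coeff i t j k * apply_bcontfun x (k, a))"
  proof (rule appr_infsum)
    show "appr T d (\<lambda>t x. base_coeff i t j k * apply_bcontfun x (k, a))" for k
      by (rule appr_mult[OF base_coeff_appr appr_coord])
    fix R :: real
    have "\<bar>base_coeff i t j k * apply_bcontfun x (k, a)\<bar> \<le> (coeff_size * \<beta> (j - i) * \<bar>R\<bar>) * \<beta> (k - i)"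
      if "t \<in> {0..T}" "norm x \<le> R" for t x k
    proof -
      have "\<bar>base_coeff i t j k * apply_bcontfun x (k, a)\<bar> \<le> (coeff_size * \<beta> (j - i) * norm x) * \<beta> (k - i)"
        by (rule row_terms_le[OF weight_facts base_coeff_bound[OF that(1)]])
      also have "\<dots> \<le> (coeff_size * \<beta> (j - i) * \<bar>R\<bar>) * \<beta> (k - i)"
        using that(2) size_facts(3) \<beta>_nonneg by (intro mult_right_mono mult_left_mono) auto
      finally show ?thesis .
    qed
    then show "\<exists>M. M summable_on UNIV \<and> (\<forall>k. \<forall>t\<in>{0..T}. \<forall>x\<in>linf d. norm x \<le> R \<longrightarrow>
        \<bar>base_coeff i t j k * apply_bcontfun x (k, a)\<bar> \<le> M k)"
      by (intro exI[of _ "\<lambda>k. (coeff_size * \<beta> (j - i) * \<bar>R\<bar>) * \<beta> (k - i)"] conjI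
            summable_on_cmult_right \<beta>_shift_sum) auto
  qed
  then show ?thesis by (simp add: base_grad_def[abs_def] row_form_def)
qed

lemma quad_cost_appr:
  assumes cont: "\<And>h k. continuous_on {0..T} (\<lambda>t. M t h k)"
    and le: "\<And>t. t \<in> {0..T} \<Longrightarrow> coeffs_le L (\<lambda>h. \<beta> (h - i)) (M t)" and L: "0 \<le> L"
  shows "appr T d (\<lambda>t x. quad_cost d (M t) x)"
proof -
  have "appr T d (\<lambda>t x. \<Sum>\<^sub>\<infinity>p. case p of (h, k) \<Rightarrow> M t h k * entry_inner d x h k)"
  proof (rule appr_infsum)
    fix p :: "int \<times> int"
    obtain h k where p: "p = (h, k)" by (cases p)
    show "appr T d (\<lambda>t x. case p of (h, k) \<Rightarrow> M t h k * entry_inner d x h k)"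
      unfolding p prod.case entry_inner_def
      by (intro appr_mult[OF appr_continuous[OF cont]] appr_sum appr_mult[OF appr_coord appr_coord])
  next
    fix R :: real
    have "\<bar>case p of (h, k) \<Rightarrow> M t h k * entry_inner d x h k\<bar>
        \<le> (case p of (h, k) \<Rightarrow> \<beta> (h - i) * \<beta> (k - i)) * (L * (real d * (\<bar>R\<bar> * \<bar>R\<bar>)))"
      if "t \<in> {0..T}" "norm x \<le> R" for t x p
    proof -
      have "\<bar>case p of (h, k) \<Rightarrow> M t h k * entry_inner d x h k\<bar>
          \<le> (case p of (h, k) \<Rightarrow> \<beta> (h - i) * \<beta> (k - i)) * (L * (real d * (norm x * norm x)))"
        using polar_terms_le[OF L \<beta>_nonneg \<beta>_shift_sum(1) le[OF that(1)], where p = p and d = d and x = x and y = x]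
        by (simp add: entry_inner_def)
      also have "\<dots> \<le> (case p of (h, k) \<Rightarrow> \<beta> (h - i) * \<beta> (k - i)) * (L * (real d * (\<bar>R\<bar> * \<bar>R\<bar>)))"
        using that(2) L \<beta>_nonneg
        by (intro mult_left_mono mult_mono) (auto split: prod.splits)
      finally show ?thesis .
    qed
    then show "\<exists>N. N summable_on UNIV \<and> (\<forall>p. \<forall>t\<in>{0..T}. \<forall>x\<in>linf d. norm x \<le> R \<longrightarrow>
        \<bar>case p of (h, k) \<Rightarrow> M t h k * entry_inner d x h k\<bar> \<le> N p)"
      by (intro exI[of _ "\<lambda>p. (case p of (h, k) \<Rightarrow> \<beta> (h - i) * \<beta> (k - i)) * (L * (real d * (\<bar>R\<bar> * \<bar>R\<bar>)))"]
           conjI polar_bound_summable[OF L \<beta>_nonneg \<beta>_shift_sum(1)]) auto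
  qed
  then show ?thesis unfolding quad_cost_def by (rule appr_mult[OF appr_const])
qed

lemma diag_bound:
  assumes "t \<in> {0..T}"
  shows "\<bar>real d * base_coeff i t j j\<bar> \<le> real d * decay (j - i)"
proof -
  have "\<bar>base_coeff i t j j\<bar> \<le> coeff_size * (\<beta> (j - i) * \<beta> (j - i))"
    using base_coeff_bound[OF assms, of i] unfolding coeffs_le_def by blast
  also have "\<dots> \<le> coeff_size * ((\<Sum>\<^sub>\<infinity>h. \<beta> h) * \<beta> (j - i))"
    using size_facts(3) \<beta>_nonneg by (intro mult_left_mono mult_right_mono \<beta>_le_sum) auto
  finally show ?thesis by (simp add: abs_mult decay_def mult.assoc mult_left_mono)
qed

lemma decay_facts: "0 \<le> decay j" "decay summable_on UNIV" "(\<lambda>j. decay (j - i)) summable_on UNIV"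
proof -
  have "0 \<le> (\<Sum>\<^sub>\<infinity>h. \<beta> h)" using \<beta>_nonneg by (intro infsum_nonneg) auto
  then show "0 \<le> decay j" using size_facts(3) \<beta>_nonneg unfolding decay_def by auto
  show s: "decay summable_on UNIV" unfolding decay_def[abs_def] by (rule summable_on_cmult_right[OF \<beta>_sum])
  show "(\<lambda>j. decay (j - i)) summable_on UNIV" by (rule summable_on_shift[OF s])
qed

lemma base_source_appr: "appr T d (base_source i)"
proof -
  have "appr T d (\<lambda>t x. \<Sum>\<^sub>\<infinity>j. real d * base_coeff i t j j)"
  proof (rule appr_infsum)
    show "appr T d (\<lambda>t x. real d * base_coeff i t j j)" for j
      by (rule appr_mult[OF appr_const base_coeff_appr])
    show "\<exists>M. M summable_on UNIV \<and> (\<forall>k. \<forall>t\<in>{0..T}. \<forall>x\<in>linf d. norm x \<le> R \<longrightarrow>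
        \<bar>real d * base_coeff i t k k\<bar> \<le> M k)" for R
      by (rule exI[of _ "\<lambda>j. real d * decay (j - i)"])
         (use diag_bound decay_facts(3) in \<open>auto intro: summable_on_cmult_right\<close>)
  qed
  moreover have "appr T d (\<lambda>t x. quad_cost d (\<lambda>h k. f i h k t) x)"
    by (rule quad_cost_appr[of _ C i]) (use f_cont f_bound C_pos in auto)
  moreover have "appr T d (\<lambda>t x. quad_cost d (slope i) x)"
    by (rule quad_cost_appr[of _ slope_size i]) (use slope_bound size_facts in auto)
  ultimately show ?thesis
    unfolding base_source_def[abs_def] by (intro appr_add appr_diff appr_const)
qed

lemma row_products:
  "(\<Sum>a<d. base_grad j j a T x * base_grad i j a T x)
    = (\<Sum>\<^sub>\<infinity>(h, k). g j j h * g i j k * entry_inner d x h k)"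
proof -
  have v: "base_coeff i T = g i" for i by (simp add: base_coeff_def fun_eq_iff)
  have gb: "\<bar>g i j k\<bar> \<le> (C * \<beta> (j - i)) * \<beta> (k - i)" for i j k
    using g_bound[of i] unfolding coeffs_le_def by (simp add: mult.assoc)
  show ?thesis unfolding base_grad_def v
    by (rule row_form_products[OF summable_on_cmult_right[OF \<beta>_shift_sum(1)]
          summable_on_cmult_right[OF \<beta>_shift_sum(1)] _ _ gb gb])
       (use C_pos \<beta>_nonneg in auto)
qed

text \<open>
  The exchange of the series over players with the one over pairs of entries is justified by
  the majorant \<open>\<beta>\<^sub>j\<^sub>-\<^sub>i \<beta>\<^sub>h\<^sub>-\<^sub>j \<beta>\<^sub>k\<^sub>-\<^sub>i\<close>, whose sum over \<open>h\<close> and \<open>k\<close> is \<open>\<beta>\<^sub>j\<^sub>-\<^sub>i\<close> times a constant.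
\<close>

lemma self_interaction_quadratic:
  "(\<Sum>\<^sub>\<infinity>j. self_weight i j * (\<Sum>a<d. base_grad j j a T x * base_grad i j a T x))
    = (\<Sum>\<^sub>\<infinity>(h, k). interaction i h k * entry_inner d x h k)"
proof -
  let ?F = "\<lambda>j (h, k). self_weight i j * (g j j h * g i j k) * entry_inner d x h k"
  let ?c = "C * C * \<beta> 0 * (real d * (norm x * norm x))"
  let ?G = "\<lambda>(j, p). (?c * \<beta> (j - i)) * (case p of (h, k) \<Rightarrow> \<beta> (h - j) * \<beta> (k - i))"
  have pair: "((\<lambda>(h, k). \<beta> (h - j) * \<beta> (k - i)) has_sum ((\<Sum>\<^sub>\<infinity>h. \<beta> h) * (\<Sum>\<^sub>\<infinity>h. \<beta> h))) UNIV" for j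
  proof -
    have s: "(\<lambda>(h, k). \<beta> (h - j) * \<beta> (k - i)) summable_on UNIV"
      by (rule summable_on_products) (use \<beta>_shift_sum \<beta>_nonneg in auto)
    have "(\<Sum>\<^sub>\<infinity>(h, k). \<beta> (h - j) * \<beta> (k - i)) = (\<Sum>\<^sub>\<infinity>h. \<beta> h) * (\<Sum>\<^sub>\<infinity>h. \<beta> h)"
      unfolding infsum_pairs[OF s, symmetric] prod.case
      by (simp add: infsum_cmult_right' infsum_cmult_left' \<beta>_shift_sum(2))
    with has_sum_infsum[OF s] show ?thesis by simp
  qed
  have "?G summable_on Sigma UNIV (\<lambda>_. UNIV)"
  proof (rule summable_on_SigmaI[where g = "\<lambda>j. (?c * \<beta> (j - i)) * ((\<Sum>\<^sub>\<infinity>h. \<beta> h) * (\<Sum>\<^sub>\<infinity>h. \<beta> h))"])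
    show "((\<lambda>p. ?G (j, p)) has_sum (?c * \<beta> (j - i)) * ((\<Sum>\<^sub>\<infinity>h. \<beta> h) * (\<Sum>\<^sub>\<infinity>h. \<beta> h))) UNIV" for j
      unfolding prod.case by (rule has_sum_cmult_right[OF pair])
    show "(\<lambda>j. (?c * \<beta> (j - i)) * ((\<Sum>\<^sub>\<infinity>h. \<beta> h) * (\<Sum>\<^sub>\<infinity>h. \<beta> h))) summable_on UNIV"
      by (rule summable_on_cmult_left[OF summable_on_cmult_right[OF \<beta>_shift_sum(1)]])
    show "0 \<le> ?G (j, p)" for j p
      using C_pos \<beta>_nonneg by (auto split: prod.splits)
  qed
  then have sumG: "?G summable_on UNIV" by simp
  have le: "\<bar>?F j (h, k)\<bar> \<le> ?G (j, (h, k))" for j h k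
  proof -
    have "\<bar>?F j (h, k)\<bar> \<le> C * C * \<beta> 0 * \<beta> (k - i) * (\<beta> (h - j) * \<beta> (j - i)) * (real d * (norm x * norm x))"
      unfolding prod.case abs_mult[of "self_weight i j * _"] using interaction_terms[of i j h k] entry_products_le[where d = d and x = x and y = x and h = h and k = k] C_pos \<beta>_nonneg
      by (intro mult_mono) (auto simp: entry_inner_def)
    then show ?thesis by (simp add: algebra_simps)
  qed
  have sumF: "(\<lambda>(j, p). ?F j p) summable_on UNIV \<times> UNIV"
    unfolding UNIV_Times_UNIV
  proof (rule summable_on_dominated[OF sumG])
    fix q :: "int \<times> int \<times> int"
    show "\<bar>case q of (j, p) \<Rightarrow> ?F j p\<bar> \<le> ?G q"
      using le[of "fst q" "fst (snd q)" "snd (snd q)"] by (simp add: case_prod_beta)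
  qed
  have "(\<Sum>\<^sub>\<infinity>j. self_weight i j * (\<Sum>a<d. base_grad j j a T x * base_grad i j a T x)) = (\<Sum>\<^sub>\<infinity>j. \<Sum>\<^sub>\<infinity>p. ?F j p)"
    by (subst row_products)
      (auto simp flip: infsum_cmult_right' simp: case_prod_beta mult.assoc intro!: infsum_cong)
  also have "\<dots> = (\<Sum>\<^sub>\<infinity>p. \<Sum>\<^sub>\<infinity>j. ?F j p)"
    by (rule infsum_swap_banach[OF sumF])
  also have "\<dots> = (\<Sum>\<^sub>\<infinity>(h, k). interaction i h k * entry_inner d x h k)"
    by (intro infsum_cong) (auto simp: interaction_def infsum_cmult_left' split: prod.splits)
  finally show ?thesis .
qed

text \<open>
  At \<open>t = T\<close> the trace term cancels the Laplacian of the terminal cost, and the quadratic form with matrix \<open>f - slope\<close>,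
  the interaction plus its transpose, is twice that of the interaction.
\<close>

lemma base_compatible:
  "base_source i T x = (\<Sum>\<^sub>\<infinity>j. self_weight i j * (\<Sum>a<d. base_grad j j a T x * base_grad i j a T x))"
proof -
  let ?m' = "\<lambda>h k. interaction i k h"
  note wf = less_imp_le[OF size_facts(2)] \<beta>_nonneg \<beta>_shift_sum(1)
  have m': "coeffs_le slope_size (\<lambda>h. \<beta> (h - i)) ?m'"
    using interaction_le_slope_size[of i] unfolding coeffs_le_def by (metis mult.commute)
  have fT: "coeffs_le slope_size (\<lambda>h. \<beta> (h - i)) (\<lambda>h k. f i h k T)"
    using coeffs_le_mono[OF f_bound[of T i] size_facts(4)] T \<beta>_nonneg by simp
  have "quad_cost d (\<lambda>h k. f i h k T) x + (-1) * quad_cost d (slope i) x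
      = quad_cost d (\<lambda>h k. f i h k T + (-1) * slope i h k) x"
    by (rule quad_add_scaled[OF wf fT slope_bound, symmetric])
  also have "(\<lambda>h k. f i h k T + (-1) * slope i h k) = (\<lambda>h k. interaction i h k + 1 * interaction i k h)"
    by (simp add: slope_def fun_eq_iff)
  also have "quad_cost d (\<lambda>h k. interaction i h k + 1 * interaction i k h) x = quad_cost d (interaction i) x + 1 * quad_cost d ?m' x"
    by (rule quad_add_scaled[OF wf interaction_le_slope_size m'])
  also have "quad_cost d ?m' x = quad_cost d (interaction i) x"
  proof -
    have "(\<Sum>\<^sub>\<infinity>(h, k). interaction i k h * entry_inner d x h k) = (\<Sum>\<^sub>\<infinity>(k, h). interaction i k h * entry_inner d x h k)"
      by (rule infsum_swap_pair)
    then show ?thesis unfolding quad_cost_def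
      by (simp add: entry_inner_def mult.commute)
  qed
  finally have "quad_cost d (\<lambda>h k. f i h k T) x - quad_cost d (slope i) x
      = (\<Sum>\<^sub>\<infinity>(h, k). interaction i h k * entry_inner d x h k)"
    by (simp add: quad_cost_def)
  then show ?thesis
    by (simp add: self_interaction_quadratic base_source_def slope_trace_def base_coeff_def)
qed

sublocale flexible_drift d T base_grad base_source decay
  by unfold_locales
     (use d T decay_facts base_grad_appr base_grad_bound base_source_appr base_compatible in auto)

section \<open>The solution\<close>

definition links :: "(int \<Rightarrow> int \<Rightarrow> real) \<Rightarrow> int \<Rightarrow> seqs \<Rightarrow> real" where
  "links l i x = (\<Sum>\<^sub>\<infinity>j. l i j * apply_bcontfun x (j, 0))"

definition player_value ::
    "(int \<Rightarrow> real \<Rightarrow> seqs \<Rightarrow> real) \<Rightarrow> (int \<Rightarrow> int \<Rightarrow> real) \<Rightarrow> int \<Rightarrow> real \<Rightarrow> seqs \<Rightarrow> real" where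
  "player_value Q l i t x = quad_cost d (base_coeff i t) x + (T - t) * slope_trace i
     + (T - t)^2 * (apply_bcontfun x (i, 0) * Q i t x + links l i x)"

context
  fixes Q :: "int \<Rightarrow> real \<Rightarrow> seqs \<Rightarrow> real" and l :: "int \<Rightarrow> int \<Rightarrow> real"
  assumes Q_cyl: "\<exists>S. finite S \<and> i \<notin> S \<and> cyl S (Q i)"
    and l_sum: "l i summable_on UNIV" and l_nonneg: "0 \<le> l i j" and l_self: "l i i = 0"
begin

lemma links_terms: "\<bar>l i j * apply_bcontfun x (j, 0)\<bar> \<le> l i j * norm (x :: seqs)"
  unfolding abs_mult using l_nonneg[of i j] coord_le_norm[of x "(j, 0)"] by (auto intro: mult_left_mono)

lemma links_summable: "(\<lambda>j. l i j * apply_bcontfun x (j, 0)) summable_on UNIV" for x :: seqs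
  by (rule summable_on_dominated[OF summable_on_cmult_left[OF l_sum] links_terms])

lemma links_line: "links l i (x + s *\<^sub>R unit_seq j a) = links l i x + s * (if a = 0 then l i j else 0)"
proof -
  have "links l i (x + s *\<^sub>R unit_seq j a)
      = (\<Sum>\<^sub>\<infinity>k. l i k * apply_bcontfun x (k, 0) + (if k = j then s * (if a = 0 then l i j else 0) else 0))"
    unfolding links_def by (rule infsum_cong) (auto simp: apply_unit_seq algebra_simps)
  then show ?thesis unfolding links_def by (simp only: infsum_add_single[OF links_summable])
qed

lemma links_smooth: "smooth_fun (linf d) (links l i)"
proof (rule smooth_fun_linear[OF subspace_linf])
  show "links l i (x + y) = links l i x + links l i y" for x y
    unfolding links_def infsum_add[OF links_summable links_summable, symmetric]
    by (simp add: distrib_left)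
  show "links l i (r *\<^sub>R x) = r * links l i x" for r x
    unfolding links_def infsum_cmult_right'[symmetric] by (simp add: algebra_simps)
  show "\<bar>links l i x\<bar> \<le> (\<Sum>\<^sub>\<infinity>j. l i j) * norm x" for x
    using infsum_le_bound[OF summable_on_cmult_left[OF l_sum] links_terms, of i x]
    by (simp add: links_def infsum_cmult_left')
  show "0 \<le> (\<Sum>\<^sub>\<infinity>j. l i j)" using l_nonneg by (intro infsum_nonneg) auto
qed

text \<open>
  For fixed \<open>x\<close> the function is a polynomial in time; \<open>\<phi>\<close> exhibits it as a cylinder polynomial whose coefficients are constants
  depending on \<open>x\<close>.
\<close>

lemma player_value_time:
  "\<exists>S \<phi>. cyl S \<phi> \<and> (\<forall>t. player_value Q l i t x = \<phi> t x) \<and>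
     (\<forall>t. deriv (\<lambda>s. \<phi> s x) t = - quad_cost d (slope i) x - slope_trace i
       - 2 * (T - t) * (apply_bcontfun x (i, 0) * Q i t x + links l i x)
       + (T - t)^2 * (apply_bcontfun x (i, 0) * deriv (\<lambda>s. Q i s x) t))"
proof -
  obtain S where S: "cyl S (Q i)" using Q_cyl by blast
  define \<phi> where "\<phi> t y = quad_cost d (g i) x + (T - t) * (quad_cost d (slope i) x + slope_trace i)
     + (T - t)^2 * (apply_bcontfun x (i, 0) * Q i t y + links l i x)" for t y
  have "cyl S \<phi>" unfolding \<phi>_def[abs_def]
    by (intro cyl_add cyl_mult cyl_power cyl_diff cyl_const cyl_time S)
  moreover have "player_value Q l i t x = \<phi> t x" for t
  proof -
    have "quad_cost d (base_coeff i t) x = quad_cost d (g i) x + (T - t) * quad_cost d (slope i) x"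
      unfolding base_coeff_def[abs_def]
      by (rule quad_add_scaled[OF less_imp_le[OF size_facts(2)] \<beta>_nonneg \<beta>_shift_sum(1) _ slope_bound])
         (rule coeffs_le_mono[OF g_bound size_facts(4) \<beta>_nonneg])
    then show ?thesis by (simp add: player_value_def \<phi>_def distrib_left)
  qed
  moreover have "deriv (\<lambda>s. \<phi> s x) t = - quad_cost d (slope i) x - slope_trace i
       - 2 * (T - t) * (apply_bcontfun x (i, 0) * Q i t x + links l i x)
       + (T - t)^2 * (apply_bcontfun x (i, 0) * deriv (\<lambda>s. Q i s x) t)" for t
    unfolding \<phi>_def
    by (rule DERIV_imp_deriv)
       (auto intro!: derivative_eq_intros cyl_tderiv(2)[OF S] simp: algebra_simps)
  ultimately show ?thesis by blast
qed

lemma player_value_gradient: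
  assumes t: "t \<in> {0..T}" and a: "a < d"
  shows "((\<lambda>s. player_value Q l i t (x + s *\<^sub>R unit_seq j a)) has_real_derivative cross_grad Q l i j a t x) (at 0)"
proof -
  obtain S where S: "cyl S (Q i)" using Q_cyl by blast
  \<comment> \<open>Along the unit vector the factor \<open>x\<^sup>i\<close> and the links move affinely; both are written out before differentiating.\<close>
  have "((\<lambda>s. quad_cost d (base_coeff i t) (x + s *\<^sub>R unit_seq j a) + (T - t) * slope_trace i
      + (T - t)^2 * ((apply_bcontfun x (i, 0) + s * (if (i, 0) = (j, a) then 1 else 0))
            * Q i t (x + s *\<^sub>R unit_seq j a)
          + (links l i x + s * (if a = 0 then l i j else 0))))
    has_real_derivative (row_form (base_coeff i t) j a x + (T - t)^2 *
       ((if (i, 0) = (j, a) then 1 else 0) * Q i t x + apply_bcontfun x (i, 0) * pderiv_seq j a (Q i t) x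
          + (if a = 0 then l i j else 0)))) (at 0)"
    by (rule derivative_eq_intros quad_line_derivative[OF weight_facts base_coeff_bound[OF t] base_coeff_sym a]
        cyl_pderiv_seq(2)[OF S] refl | simp)+
  moreover have "row_form (base_coeff i t) j a x + (T - t)^2 *
       ((if (i, 0) = (j, a) then 1 else 0) * Q i t x + apply_bcontfun x (i, 0) * pderiv_seq j a (Q i t) x
          + (if a = 0 then l i j else 0)) = cross_grad Q l i j a t x"
    by (auto simp: cross_grad_def base_grad_def algebra_simps)
  ultimately show ?thesis unfolding player_value_def links_line by (simp add: apply_unit_seq)
qed

lemma pderiv_player_value: "t \<in> {0..T} \<Longrightarrow> a < d \<Longrightarrow> pderiv_seq j a (player_value Q l i t) = cross_grad Q l i j a t"
  unfolding pderiv_seq_def using player_value_gradient by (auto intro!: DERIV_imp_deriv)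

lemma own_grad_eq_cross_grad: "own_grad Q j a t x = cross_grad Q l j j a t x"
proof -
  obtain S where "cyl S (Q j)" "j \<notin> S" using Q_cyl by blast
  then have "pderiv_seq j a (Q j t) x = 0" by (rule cyl_pderiv_seq(3))
  then show ?thesis by (simp add: own_grad_def cross_grad_def l_self)
qed

lemma grad_inner_player_value:
  "t \<in> {0..T} \<Longrightarrow> coupling Q l i j t x = self_weight i j * grad_inner d j (player_value Q l j t) (player_value Q l i t) x"
  by (simp add: coupling_def grad_inner_def pderiv_player_value own_grad_eq_cross_grad)

text \<open>
  The correction \<open>x\<^sup>i Q\<^sup>i\<close> has no Laplacian in entry \<open>i\<close>, since \<open>Q\<^sup>i\<close> does not depend on that entry, and the links
  are linear.
\<close>

lemma entry_laplacian_player_value: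
  assumes t: "t \<in> {0..T}"
  shows "entry_laplacian d j (player_value Q l i t) x = real d * base_coeff i t j j
     + (T - t)^2 * (apply_bcontfun x (i, 0) * entry_laplacian d j (Q i t) x)"
proof -
  obtain S where S: "cyl S (Q i)" "i \<notin> S" using Q_cyl by blast
  note Q' = cyl_pderiv_seq(1)[OF S(1)]
  have "pderiv_seq j a (pderiv_seq j a (player_value Q l i t)) x = base_coeff i t j j
      + (T - t)^2 * (apply_bcontfun x (i, 0) * pderiv_seq j a (pderiv_seq j a (Q i t)) x)" if a: "a < d" for a
  proof -
    have "((\<lambda>s. cross_grad Q l i j a t (x + s *\<^sub>R unit_seq j a)) has_real_derivative base_coeff i t j j
      + (T - t)^2 * (apply_bcontfun x (i, 0) * pderiv_seq j a (pderiv_seq j a (Q i t)) x)) (at 0)"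
    proof (cases "j = i")
      case True
      have z: "pderiv_seq i a (Q i t) = (\<lambda>y. 0)" using cyl_pderiv_seq(3)[OF S] by auto
      have zz: "pderiv_seq i a (\<lambda>y. 0) x = 0" by (simp add: pderiv_seq_def)
      have Qi: "((\<lambda>s. Q i t (x + s *\<^sub>R unit_seq i a)) has_real_derivative 0) (at 0)"
        using cyl_pderiv_seq(2)[OF S(1), of t x i a] z by simp
      have "((\<lambda>s. row_form (base_coeff i t) i a x + s * base_coeff i t i i + (T - t)^2 *
          (if a = 0 then l i i + Q i t (x + s *\<^sub>R unit_seq i a) else 0)) has_real_derivative base_coeff i t i i) (at 0)"
        using Qi by (cases "a = 0") (auto intro!: derivative_eq_intros)
      then show ?thesis
        unfolding True cross_grad_def base_grad_def row_line[OF weight_facts base_coeff_bound[OF t]] z zz by (simp cong: if_cong)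
    next
      case False
      then have e: "apply_bcontfun (x + s *\<^sub>R unit_seq j a) (i, 0) = apply_bcontfun x (i, 0)"
        "(if a = 0 then l i j + (if j = i then Q i t y else 0) else 0) = (if a = 0 then l i j else 0)" for s y
        by (simp_all add: apply_unit_seq)
      show ?thesis
        unfolding cross_grad_def base_grad_def row_line[OF weight_facts base_coeff_bound[OF t]] e
        by (auto intro!: derivative_eq_intros cyl_pderiv_seq(2)[OF Q'])
    qed
    then show ?thesis unfolding pderiv_player_value[OF t a] pderiv_seq_def[of j a "cross_grad Q l i j a t"]
      by (rule DERIV_imp_deriv)
  qed
  then show ?thesis unfolding entry_laplacian_def by (simp add: sum.distrib sum_distrib_left)
qed

lemma laplacian_dominated:
  "\<exists>M. M summable_on UNIV \<and>
     (\<forall>t\<in>{0..T}. \<forall>x. norm x \<le> R \<longrightarrow> (\<forall>j. \<bar>entry_laplacian d j (player_value Q l i t) x\<bar> \<le> M j))"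
proof -
  obtain S where S: "finite S" "cyl S (Q i)" using Q_cyl by blast
  have "cyl (insert i S) (\<lambda>t x. (T - t)^2 * (apply_bcontfun x (i, 0) * entry_laplacian d j (Q i t) x))" for j
    by (intro cyl_mult cyl_power cyl_diff cyl_const cyl_time cyl_coord
        cyl_mono[OF entry_laplacian_cyl[OF S(2)]]) auto
  from cyl_bounded[OF this] obtain K1 where K1: "\<And>j t x. t \<in> {0..T} \<Longrightarrow> norm x \<le> R \<Longrightarrow>
      \<bar>(T - t)^2 * (apply_bcontfun x (i, 0) * entry_laplacian d j (Q i t) x)\<bar> \<le> K1 j"
    by metis
  have "\<bar>entry_laplacian d j (player_value Q l i t) x\<bar> \<le> real d * decay (j - i) + (if j \<in> S then K1 j else 0)"
    if "t \<in> {0..T}" "norm x \<le> R" for j t x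
    unfolding entry_laplacian_player_value[OF that(1)]
    using diag_bound[OF that(1), of i j] K1[OF that, of j] cyl_laplacian_outside[OF S(2), of j d t x]
    by (intro order_trans[OF abs_triangle_ineq] add_mono) auto
  moreover have "(\<lambda>j. real d * decay (j - i) + (if j \<in> S then K1 j else 0)) summable_on UNIV"
    by (rule summable_on_add[OF summable_on_cmult_right[OF decay_facts(3)] summable_on_finite_support[OF S(1)]]) auto
  ultimately show ?thesis by blast
qed

lemma player_value_smooth:
  assumes "t \<in> {0..T}"
  shows "smooth_fun (linf d) (player_value Q l i t)"
proof -
  obtain S where S: "cyl S (Q i)" using Q_cyl by blast
  have "smooth_fun (linf d) (\<lambda>x. apply_bcontfun x (i, 0))"
    using cyl_smooth_fun[OF cyl_coord[of i "{i}" 0]] by simp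
  then show ?thesis unfolding player_value_def[abs_def]
    by (intro smooth_fun_add smooth_fun_mult smooth_fun_const links_smooth cyl_smooth_fun[OF S]
        quad_smooth[OF weight_facts subspace_linf base_coeff_bound[OF assms] base_coeff_sym])
qed

text \<open>
  The majorants of the coupling terms give uniform convergence on bounded sets, and the vanishing residual is the
  equation, once the term with the self weight is separated from the others.
\<close>

lemma player_value_solves:
  assumes exact: "\<And>i R. \<exists>M. M summable_on UNIV \<and>
     (\<forall>t\<in>{0..T}. \<forall>x\<in>linf d. norm x \<le> R \<longrightarrow> (\<forall>j. \<bar>coupling Q l i j t x\<bar> \<le> M j) \<and> residual Q l i t x = 0)"
  shows "classical_solution d T f g (player_value Q l)" "smooth_family d T (player_value Q l)"
proof -
  have inf_diff: "infinitely_differentiable_on I (\<lambda>t. player_value Q l i t x)" for i x I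
  proof -
    obtain S \<phi> where \<phi>: "cyl S \<phi>" "\<And>t. player_value Q l i t x = \<phi> t x" using player_value_time[of i x] by blast
    show ?thesis unfolding \<phi>(2) by (rule cyl_infinitely_differentiable[OF \<phi>(1)])
  qed
  show "smooth_family d T (player_value Q l)"
    unfolding smooth_family_def using inf_diff smooth_fun_frechet_C[OF subspace_linf player_value_smooth] by blast
  have C1: "(\<lambda>t. player_value Q l i t x) C1_differentiable_on {0<..<T}" for i x
  proof -
    obtain S \<phi> where \<phi>: "cyl S \<phi>" "\<And>t. player_value Q l i t x = \<phi> t x" using player_value_time[of i x] by blast
    have "((\<lambda>s. \<phi> s x) has_vector_derivative deriv (\<lambda>s. \<phi> s x) t) (at t)" for t
      using cyl_tderiv(2)[OF \<phi>(1)] by (simp add: has_real_derivative_iff_has_vector_derivative)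
    then show ?thesis unfolding C1_differentiable_on_def \<phi>(2)
      by (intro exI[of _ "\<lambda>t. deriv (\<lambda>s. \<phi> s x) t"] conjI ballI
            cyl_continuous_time[OF cyl_tderiv(1)[OF \<phi>(1)]])
  qed
  have lap_lim: "uniform_limit B (\<lambda>J (t, x). \<Sum>j\<in>J. entry_laplacian d j (player_value Q l i t) x)
          (\<lambda>(t, x). \<Sum>\<^sub>\<infinity>j. entry_laplacian d j (player_value Q l i t) x) (finite_subsets_at_top UNIV)"
    and grad_lim: "uniform_limit B (\<lambda>J (t, x). \<Sum>j\<in>J. grad_inner d j (player_value Q l j t) (player_value Q l i t) x)
          (\<lambda>(t, x). \<Sum>\<^sub>\<infinity>j\<in>- {i}. grad_inner d j (player_value Q l j t) (player_value Q l i t) x) (finite_subsets_at_top (- {i}))"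
    if B: "B \<subseteq> {0..T} \<times> linf d" "bounded B" for i B
  proof -
    obtain R where R: "\<And>t x. (t, x) \<in> B \<Longrightarrow> norm x \<le> R"
      using B(2) unfolding bounded_iff by (metis norm_snd_le order_trans snd_conv)
    obtain M where M: "M summable_on UNIV"
      "\<forall>t\<in>{0..T}. \<forall>x. norm x \<le> R \<longrightarrow> (\<forall>j. \<bar>entry_laplacian d j (player_value Q l i t) x\<bar> \<le> M j)"
      using laplacian_dominated by blast
    have "uniform_limit B (\<lambda>J y. \<Sum>j\<in>J. (\<lambda>(t, x). entry_laplacian d j (player_value Q l i t) x) y)
        (\<lambda>y. \<Sum>\<^sub>\<infinity>j. (\<lambda>(t, x). entry_laplacian d j (player_value Q l i t) x) y) (finite_subsets_at_top UNIV)"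
      by (rule Weierstrass_m_test_general[OF _ M(1)]) (use M(2) B(1) R in auto)
    then show "uniform_limit B (\<lambda>J (t, x). \<Sum>j\<in>J. entry_laplacian d j (player_value Q l i t) x)
          (\<lambda>(t, x). \<Sum>\<^sub>\<infinity>j. entry_laplacian d j (player_value Q l i t) x) (finite_subsets_at_top UNIV)"
      by (simp add: case_prod_unfold)
    obtain N where N: "N summable_on UNIV"
      "\<forall>t\<in>{0..T}. \<forall>x\<in>linf d. norm x \<le> R \<longrightarrow> (\<forall>j. \<bar>coupling Q l i j t x\<bar> \<le> N j)"
      using exact[where i = i and R = R] by blast
    have N': "N summable_on - {i}" using N(1) by (rule summable_on_subset_banach) simp
    have "uniform_limit B (\<lambda>J y. \<Sum>j\<in>J. (\<lambda>(t, x). grad_inner d j (player_value Q l j t) (player_value Q l i t) x) y)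
        (\<lambda>y. \<Sum>\<^sub>\<infinity>j\<in>- {i}. (\<lambda>(t, x). grad_inner d j (player_value Q l j t) (player_value Q l i t) x) y)
        (finite_subsets_at_top (- {i}))"
    proof (rule Weierstrass_m_test_general[OF _ N'])
      fix j y assume j: "j \<in> - {i}" and y: "y \<in> B"
      obtain t x where tx: "y = (t, x)" by (cases y)
      have "t \<in> {0..T}" "x \<in> linf d" "norm x \<le> R" using B(1) R y tx by auto
      then have "\<bar>coupling Q l i j t x\<bar> \<le> N j" "t \<in> {0..T}"
        using N(2) by blast+
      moreover from this(2) have "coupling Q l i j t x = grad_inner d j (player_value Q l j t) (player_value Q l i t) x"
        using grad_inner_player_value[of t i j x] j by (simp add: self_weight_def)
      ultimately show "norm ((\<lambda>(t, x). grad_inner d j (player_value Q l j t) (player_value Q l i t) x) y) \<le> N j"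
        by (simp add: tx)
    qed
    then show "uniform_limit B (\<lambda>J (t, x). \<Sum>j\<in>J. grad_inner d j (player_value Q l j t) (player_value Q l i t) x)
          (\<lambda>(t, x). \<Sum>\<^sub>\<infinity>j\<in>- {i}. grad_inner d j (player_value Q l j t) (player_value Q l i t) x) (finite_subsets_at_top (- {i}))"
      by (simp add: case_prod_unfold)
  qed
  have system: "- deriv (\<lambda>s. player_value Q l i s x) t - (\<Sum>\<^sub>\<infinity>j. entry_laplacian d j (player_value Q l i t) x)
        + 1/2 * grad_inner d i (player_value Q l i t) (player_value Q l i t) x
        + (\<Sum>\<^sub>\<infinity>j\<in>- {i}. grad_inner d j (player_value Q l j t) (player_value Q l i t) x)
        = quad_cost d (\<lambda>h k. f i h k t) x" if t: "t \<in> {0<..<T}" and x: "x \<in> linf d" for i t x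
  proof -
    have t': "t \<in> {0..T}" using t by simp
    obtain S where S: "finite S" "cyl S (Q i)" using Q_cyl by blast
    have r: "residual Q l i t x = 0" using exact[where i = i and R = "norm x"] t' x by blast
    have dt: "deriv (\<lambda>s. player_value Q l i s x) t = - quad_cost d (slope i) x - slope_trace i
       - 2 * (T - t) * (apply_bcontfun x (i, 0) * Q i t x + links l i x)
       + (T - t)^2 * (apply_bcontfun x (i, 0) * deriv (\<lambda>s. Q i s x) t)"
      using player_value_time[of i x] by force
    have lap: "(\<Sum>\<^sub>\<infinity>j. entry_laplacian d j (player_value Q l i t) x) = (\<Sum>\<^sub>\<infinity>j. real d * base_coeff i t j j)
       + (T - t)^2 * (apply_bcontfun x (i, 0) * (\<Sum>\<^sub>\<infinity>j. entry_laplacian d j (Q i t) x))"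
    proof -
      have 1: "(\<lambda>j. real d * base_coeff i t j j) summable_on UNIV"
        by (rule summable_on_dominated[OF summable_on_cmult_right[OF decay_facts(3)] diag_bound[OF t']])
      have "(\<lambda>j. entry_laplacian d j (Q i t) x) summable_on UNIV"
        by (rule summable_on_finite_support[OF S(1)]) (rule cyl_laplacian_outside[OF S(2)])
      then have "(\<lambda>j. (T - t)^2 * (apply_bcontfun x (i, 0) * entry_laplacian d j (Q i t) x)) summable_on UNIV"
        by (intro summable_on_cmult_right)
      then show ?thesis
        unfolding entry_laplacian_player_value[OF t'] by (simp add: infsum_add[OF 1] infsum_cmult_right')
    qed
    have dr: "(\<Sum>\<^sub>\<infinity>j. coupling Q l i j t x) = 1/2 * grad_inner d i (player_value Q l i t) (player_value Q l i t) x
        + (\<Sum>\<^sub>\<infinity>j\<in>- {i}. grad_inner d j (player_value Q l j t) (player_value Q l i t) x)"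
    proof -
      obtain N where N: "N summable_on UNIV" "\<forall>j. \<bar>coupling Q l i j t x\<bar> \<le> N j"
        using exact[where i = i and R = "norm x"] t' x by blast
      have s: "(\<lambda>j. coupling Q l i j t x) summable_on - {i}"
        by (rule summable_on_subset_banach[OF summable_on_dominated[OF N(1)]]) (use N(2) in auto)
      have insert_compl: "insert i (- {i}) = UNIV" by auto
      have "(\<Sum>\<^sub>\<infinity>j. coupling Q l i j t x) = coupling Q l i i t x + (\<Sum>\<^sub>\<infinity>j\<in>- {i}. coupling Q l i j t x)"
        using infsum_insert[OF s, of i] by (simp add: insert_compl)
      also have "(\<Sum>\<^sub>\<infinity>j\<in>- {i}. coupling Q l i j t x) = (\<Sum>\<^sub>\<infinity>j\<in>- {i}. grad_inner d j (player_value Q l j t) (player_value Q l i t) x)"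
        by (rule infsum_cong) (simp add: grad_inner_player_value[OF t'] self_weight_def)
      finally show ?thesis by (simp add: grad_inner_player_value[OF t'] self_weight_def)
    qed
    show ?thesis
      using r unfolding dt lap residual_def source_term_def dr base_source_def links_def
      by (simp add: algebra_simps)
  qed
  have terminal: "player_value Q l i T x = quad_cost d (g i) x" for i x
    by (simp add: player_value_def base_coeff_def[abs_def])
  show "classical_solution d T f g (player_value Q l)"
    unfolding classical_solution_def
  proof (intro conjI)
    show "\<forall>i. \<forall>x\<in>linf d. (\<lambda>t. player_value Q l i t x) C1_differentiable_on {0<..<T}"
      using C1 by simp
    show "\<forall>i. \<forall>t\<in>{0..T}. frechet_C (linf d) 2 (player_value Q l i t)"
      using smooth_fun_frechet_C[OF subspace_linf player_value_smooth] by simp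
    show "\<forall>i. \<forall>x\<in>linf d. player_value Q l i T x = quad_cost d (g i) x"
      using terminal by simp
  qed (use lap_lim grad_lim in auto, use system in simp)
qed

end

theorem smooth_solution_exists:
  "\<exists>u. classical_solution d T f g u \<and> smooth_family d T u"
proof -
  obtain Q l where Ql: "\<And>i. \<exists>S. finite S \<and> i \<notin> S \<and> cyl S (Q i)"
    "\<And>i. l i summable_on UNIV" "\<And>i j. 0 \<le> l i j" "\<And>i. l i i = 0"
    "\<And>i R. \<exists>M. M summable_on UNIV \<and>
        (\<forall>t\<in>{0..T}. \<forall>x\<in>linf d. norm x \<le> R \<longrightarrow>
          (\<forall>j. \<bar>coupling Q l i j t x\<bar> \<le> M j) \<and> residual Q l i t x = 0)"
    using residual_cancellation by blast
  show ?thesis using player_value_solves[OF Ql] by blast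
qed

end

theorem theorem2p12:
  fixes \<beta> :: "int \<Rightarrow> real" and C :: real
  assumes "\<And>i. 0 < \<beta> i"
    and "\<beta> summable_on UNIV"
    and "c_self_controlled \<beta>"
    and "0 < C"
  shows "\<exists>Tstar>0. \<forall>(d::nat) (T::real)
      (f :: int \<Rightarrow> int \<Rightarrow> int \<Rightarrow> real \<Rightarrow> real) (g :: int \<Rightarrow> int \<Rightarrow> int \<Rightarrow> real).
    1 \<le> d \<longrightarrow> 0 < T \<longrightarrow> T \<le> Tstar \<longrightarrow>
    (\<forall>t\<in>{0..T}. symmetric_family (\<lambda>i h k. f i h k t)) \<longrightarrow>
    (\<forall>t\<in>{0..T}. shift_invariant (\<lambda>i h k. f i h k t)) \<longrightarrow>
    symmetric_family g \<longrightarrow> shift_invariant g \<longrightarrow>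
    (\<forall>i h k. continuous_on {0..T} (f i h k)) \<longrightarrow>
    (\<forall>h k. \<forall>t\<in>{0..T}. \<bar>f 0 h k t\<bar> \<le> C * \<beta> h * \<beta> k) \<longrightarrow>
    (\<forall>h k. \<bar>g 0 h k\<bar> \<le> C * \<beta> h * \<beta> k) \<longrightarrow>
    (\<exists>u :: int \<Rightarrow> real \<Rightarrow> seqs \<Rightarrow> real.
       classical_solution d T f g u \<and> smooth_family d T u)"
proof -
  obtain C' where C': "0 < C'" "\<And>i. (\<Sum>\<^sub>\<infinity>j. \<beta> j * \<beta> (i - j)) \<le> C' * \<beta> i"
    using assms(3) unfolding c_self_controlled_def by blast
  have "\<exists>u. classical_solution d T f g u \<and> smooth_family d T u"
    if "1 \<le> d" "0 < T"
      and fs: "\<forall>t\<in>{0..T}. symmetric_family (\<lambda>i h k. f i h k t)"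
      and fi: "\<forall>t\<in>{0..T}. shift_invariant (\<lambda>i h k. f i h k t)"
      and gs: "symmetric_family g" and gi: "shift_invariant g"
      and fc: "\<forall>i h k. continuous_on {0..T} (f i h k)"
      and fb: "\<forall>h k. \<forall>t\<in>{0..T}. \<bar>f 0 h k t\<bar> \<le> C * \<beta> h * \<beta> k"
      and gb: "\<forall>h k. \<bar>g 0 h k\<bar> \<le> C * \<beta> h * \<beta> k"
    for d T f g
  proof -
    interpret quadratic_game \<beta> C C' d T f g
    proof
      show "f i h k t = f i k h t" if "t \<in> {0..T}" for i h k t
        using fs that unfolding symmetric_family_def by blast
      show "g i h k = g i k h" for i h k using gs unfolding symmetric_family_def by blast
      show "coeffs_le C (\<lambda>h. \<beta> (h - i)) (\<lambda>h k. f i h k t)" if "t \<in> {0..T}" for i t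
        unfolding coeffs_le_def
        using shift_invariant_origin[OF fi[rule_format, OF that], of i] fb that by (simp add: mult.assoc)
      show "coeffs_le C (\<lambda>h. \<beta> (h - i)) (g i)" for i
        unfolding coeffs_le_def
        using shift_invariant_origin[OF gi, of i] gb by (simp add: mult.assoc)
    qed (use assms C' that in auto)
    show ?thesis by (rule smooth_solution_exists)
  qed
  then show ?thesis by (intro exI[of _ 1]) auto
qed

end
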